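(* The maps $F$ and $G$ are the inverse functions of $H$ and $J$, respectively; that is, $F: ET_{n}\to ENNE_{n+1}$ is the inverse of $H:ENNE_{n+1}\to ET_n$ (for every $n\ge -1$), and $G:OT_n\to NEEN_n$ is the inverse of $J:NEEN_n\to OT_n$ (for every $n\ge 0$), where $F,G,H,J$ are the recursively defined maps described in the context.
   Context: Permutations are written in one-line notation; $S_n$ is the set of permutations of $\{1,\dots,n\}$, $|\pi|$ is the length of $\pi$, and $1$ denotes the permutation of length one. For $\pi\in S_n$ the complement $c(\pi)\in S_n$ is $c(\pi)(j)=n+1-\pi(j)$. For $\pi\in S_n$, $\sigma\in S_m$: $\pi\oplus\sigma\in S_{n+m}$ has $(\pi\oplus\sigma)(j)=\pi(j)$ for $j\le n$ and $n+\sigma(j-n)$ for $j>n$; $\pi\ominus\sigma\in S_{n+m}$ has $(\pi\ominus\sigma)(j)=m+\pi(j)$ for $j\le n$ and $\sigma(j-n)$ for $j>n$. $\emptyset$ is the empty permutation (length $0$), an identity for $\oplus$ and $\ominus$. $@$ is a formal symbol, the "antipermutation", regarded as the unique permutation of length $-1$, with $c(@)=@$, $1\oplus @=@\oplus 1=1\ominus @=@\ominus 1=\emptyset$ and $\emptyset\ominus @=@\ominus\emptyset=@$; in an iterated sum each $@$ is combined with an adjacent $1$ first (so $1\oplus @\oplus 1=1$, $\sigma\ominus 1\ominus @=\sigma$, $@\ominus 1\ominus\sigma=\sigma$). The permutation induced by $\pi$ on a set of its entries is the standardization of the corresponding subsequence. A complete Baxter permutation is a permutation $\pi$ of length $2n+1$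 such that $\pi(i)$ is even iff $i$ is even, and whenever $\pi(x)=i$, $\pi(y)=i+1$ and $z$ lies strictly between $x$ and $y$, then $\pi(z)<i$ if $i$ is odd and $\pi(z)>i+1$ if $i$ is even. A permutation is alternating if it begins with an ascent and its ascents and descents alternate; it is doubly alternating if it and its inverse are alternating (permutations of length $\le 1$ are doubly alternating). A permutation $\sigma$ of length $n\ge 0$ is a snow leopard permutation if there is a complete Baxter permutation of length $2n+1$ whose even entries induce $\sigma$ and whose odd entries induce a doubly alternating permutation (of length $n+1$). By convention $@$ is also a snow leopard permutation; "odd length" includes length $-1$. Snow leopard permutations preserve parity ($\pi(j)$ is even iff $j$ is even). For a parity-preserving $\pi$, $\pi^e$ and $\pi^o$ are the permutations induced by $\pi$ on its even and odd entries; if $|\pi|=2n+1\ge 1$ then $|\pi^e|=n$, $|\pi^o|=n+1$. By convention $@^e=@$, $@^o=\emptyset$. An even thread (resp. odd thread) is a permutation of the form $\pi^e$ (resp. $\pi^o$) for some snow leopard permutation $\pi$ of odd length; $ET_n$ (resp. $OT_n$) is the set of even (resp. odd) threads of length $n$. An eligible connector of an even thread $\alpha$ is an entry $\alpha(j)$ such that $c(\alpha)(j)$ is both a left-to-right maximum and a fixed point of $c(\alpha)$. Every even thread $\alpha$ of nonnegative length has a unique leftmost decomposition $\alpha=c(\beta)\ominus 1\ominus\alpha_1$ with $\beta$ an odd thread and $\alpha_1$ an even thread, in which the middle $1$ corresponds to the leftmost eligible connector of $\alpha$; if $\alpha$ has no eligible connector, the leftmost decomposition is the one with $\alpha_1=@$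 (so $\alpha=c(\beta)$). Every odd thread of positive length has a unique decomposition $(1\oplus c(\alpha)\oplus 1)\ominus\beta$ with $\alpha$ an even thread and $\beta$ an odd thread. A Catalan path of length $n$ is a lattice path from $(0,0)$ to $(n,n)$ with unit North ($N$) and East ($E$) steps never passing below $y=x$, written as a word in $N,E$. The reverse $p^r$ is the reflection of $p$ over $x+y=n$ (reverse the word, then exchange $N$ and $E$). An ascent is a maximal run of consecutive $N$ steps. $ENNE_n$ is the set of Catalan paths of length $n$ with no ascent of length exactly two; $NEEN_n$ is the set of Catalan paths of length $n$ not containing four consecutive steps $NEEN$. $\emptyset$ also denotes the empty path. $H:ENNE_{n+1}\to ET_n$ ($n\ge -1$) and $J:NEEN_n\to OT_n$ ($n\ge0$) are the unique maps with $H(\emptyset)=@$, $J(\emptyset)=\emptyset$, $H(aNb^rE)=c(J(b))\ominus 1\ominus H(a)$ whenever $aNb^rE$ (with $a,b$ Catalan paths) is in the domain of $H$, and $J(a^rNbE)=(1\oplus c(H(a))\oplus 1)\ominus J(b)$ whenever $a^rNbE$ (with $a,b$ Catalan paths) is in the domain of $J$. $F:ET_n\to ENNE_{n+1}$ ($n\ge -1$) and $G:OT_n\to NEEN_n$ ($n\ge 0$) are the unique maps with $F(@)=\emptyset$, $G(\emptyset)=\emptyset$, $F(\pi)=F(\alpha)\,N\,G(\beta)^r\,E$ if $\pi=c(\beta)\ominus 1\ominus\alpha$ is the leftmost decomposition of the even thread $\pi$, and $G(\pi)=F(\alpha)^r\,N\,G(\beta)\,E$ if $\pi=(1\oplus c(\alpha)\oplus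 1)\ominus\beta$ for an even thread $\alpha$ and an odd thread $\beta$. *)

theory Defs
  imports
    Main
    "HOL-Library.Sublist"
    "HOL-Library.FuncSet"
    "HOL-Combinatorics.Multiset_Permutations"
begin

section \<open>Permutations in one-line notation\<close>

text \<open>
  A permutation of length \<open>n \<ge> 0\<close> is a list in \<^term>\<open>permutations_of_set {1..n}\<close>;
  \<open>\<pi>(j)\<close> is \<open>entry \<pi> j\<close>, with positions counted from 1.
\<close>

definition entry :: "nat list \<Rightarrow> nat \<Rightarrow> nat" where
  "entry xs j = xs ! (j - 1)"

definition standardize :: "nat list \<Rightarrow> nat list" where
  "standardize ys = map (\<lambda>y. card {z \<in> set ys. z \<le> y}) ys"

definition inverse_perm :: "nat list \<Rightarrow> nat list" where
  "inverse_perm xs = map (inv_into {1..length xs} (entry xs)) [1..<Suc (length xs)]"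

definition alternating :: "nat list \<Rightarrow> bool" where
  "alternating xs \<longleftrightarrow>
    (\<forall>j. 1 \<le> j \<and> j < length xs \<longrightarrow>
      (if odd j then entry xs j < entry xs (j + 1) else entry xs j > entry xs (j + 1)))"

definition doubly_alternating :: "nat list \<Rightarrow> bool" where
  "doubly_alternating xs \<longleftrightarrow> alternating xs \<and> alternating (inverse_perm xs)"

definition complete_baxter :: "nat \<Rightarrow> nat list \<Rightarrow> bool" where
  "complete_baxter n xs \<longleftrightarrow>
    xs \<in> permutations_of_set {1..2 * n + 1} \<and>
    (\<forall>j \<in> {1..2 * n + 1}. even (entry xs j) \<longleftrightarrow> even j) \<and>
    (\<forall>x \<in> {1..2 * n + 1}. \<forall>y \<in> {1..2 * n + 1}. \<forall>z i.
      entry xs x = i \<and> entry xs y = i + 1 \<and> (x < z \<and> z < y \<or> y < z \<and> z < x) \<longrightarrow>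
        (if odd i then entry xs z < i else entry xs z > i + 1))"

section \<open>The antipermutation\<close>

datatype eperm = Anti | Perm "nat list"

fun plen :: "eperm \<Rightarrow> int" where
  "plen Anti = -1"
| "plen (Perm xs) = int (length xs)"

fun compl :: "eperm \<Rightarrow> eperm" where
  "compl Anti = Anti"
| "compl (Perm xs) = Perm (map (\<lambda>v. length xs + 1 - v) xs)"

abbreviation one_perm :: eperm where
  "one_perm \<equiv> Perm [1]"

text \<open>
  As a binary operand, the antipermutation is combined only with 1 and with the empty
  permutation; its other sums have no meaning and are left unspecified. Iterated sums are therefore bracketed
  below so that a summand that may be \<^const>\<open>Anti\<close> meets an adjacent 1 first:
  \<open>c(\<beta>) \<ominus> (1 \<ominus> \<alpha>)\<close> and \<open>(1 \<oplus> c(\<alpha>)) \<oplus> 1\<close>.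
\<close>

fun anti_sum :: "nat list \<Rightarrow> eperm" where
  "anti_sum xs = (if xs = [] then Anti else if xs = [1] then Perm [] else undefined)"

fun osum :: "eperm \<Rightarrow> eperm \<Rightarrow> eperm" (infixr "\<oplus>\<^sub>p" 65) where
  "Perm xs \<oplus>\<^sub>p Perm ys = Perm (xs @ map (\<lambda>v. length xs + v) ys)"
| "Anti \<oplus>\<^sub>p Perm ys = anti_sum ys"
| "Perm xs \<oplus>\<^sub>p Anti = anti_sum xs"
| "Anti \<oplus>\<^sub>p Anti = undefined"

fun ominus :: "eperm \<Rightarrow> eperm \<Rightarrow> eperm" (infixr "\<ominus>\<^sub>p" 65) where
  "Perm xs \<ominus>\<^sub>p Perm ys = Perm (map (\<lambda>v. length ys + v) xs @ ys)"
| "Anti \<ominus>\<^sub>p Perm ys = anti_sum ys"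
| "Perm xs \<ominus>\<^sub>p Anti = anti_sum xs"
| "Anti \<ominus>\<^sub>p Anti = undefined"

section \<open>Snow leopard permutations and threads\<close>

fun snow_leopard :: "eperm \<Rightarrow> bool" where
  "snow_leopard Anti \<longleftrightarrow> True"
| "snow_leopard (Perm xs) \<longleftrightarrow>
    xs \<in> permutations_of_set {1..length xs} \<and>
    (\<exists>bs. complete_baxter (length xs) bs \<and>
          standardize (filter even bs) = xs \<and>
          doubly_alternating (standardize (filter odd bs)))"

fun even_part :: "eperm \<Rightarrow> eperm" where
  "even_part Anti = Anti"
| "even_part (Perm xs) = Perm (standardize (filter even xs))"

fun odd_part :: "eperm \<Rightarrow> eperm" where
  "odd_part Anti = Perm []"
| "odd_part (Perm xs) = Perm (standardize (filter odd xs))"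

definition even_thread :: "eperm \<Rightarrow> bool" where
  "even_thread \<alpha> \<longleftrightarrow> (\<exists>\<pi>. snow_leopard \<pi> \<and> odd (plen \<pi>) \<and> \<alpha> = even_part \<pi>)"

definition odd_thread :: "eperm \<Rightarrow> bool" where
  "odd_thread \<beta> \<longleftrightarrow> (\<exists>\<pi>. snow_leopard \<pi> \<and> odd (plen \<pi>) \<and> \<beta> = odd_part \<pi>)"

definition ET :: "int \<Rightarrow> eperm set" where
  "ET n = {\<alpha>. even_thread \<alpha> \<and> plen \<alpha> = n}"

definition OT :: "int \<Rightarrow> eperm set" where
  "OT n = {\<beta>. odd_thread \<beta> \<and> plen \<beta> = n}"

text \<open>Eligible connectors are referred to by their positions \<open>j\<close>.\<close>

fun eligible_connector :: "eperm \<Rightarrow> nat \<Rightarrow> bool" where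
  "eligible_connector Anti j \<longleftrightarrow> False"
| "eligible_connector (Perm xs) j \<longleftrightarrow>
    j \<in> {1..length xs} \<and>
    (\<exists>ys. compl (Perm xs) = Perm ys \<and>
          entry ys j = j \<and> (\<forall>i. 1 \<le> i \<and> i < j \<longrightarrow> entry ys i < entry ys j))"

text \<open>
  \<open>leftmost_decomp \<pi> \<beta> \<alpha>\<close> says that \<open>\<pi> = c(\<beta>) \<ominus> 1 \<ominus> \<alpha>\<close> is the leftmost decomposition of the
  even thread \<open>\<pi>\<close>; the middle 1 sits at position \<open>|\<beta>| + 1\<close>.
\<close>

definition leftmost_decomp :: "eperm \<Rightarrow> eperm \<Rightarrow> eperm \<Rightarrow> bool" where
  "leftmost_decomp \<pi> \<beta> \<alpha> \<longleftrightarrow>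
    even_thread \<pi> \<and> odd_thread \<beta> \<and> even_thread \<alpha> \<and>
    \<pi> = compl \<beta> \<ominus>\<^sub>p (one_perm \<ominus>\<^sub>p \<alpha>) \<and>
    (if \<exists>j. eligible_connector \<pi> j
     then \<alpha> \<noteq> Anti \<and> plen \<beta> + 1 = int (LEAST j. eligible_connector \<pi> j)
     else \<alpha> = Anti)"

section \<open>Catalan paths\<close>

datatype step = North | East

type_synonym path = "step list"

definition catalan_path :: "nat \<Rightarrow> path \<Rightarrow> bool" where
  "catalan_path n p \<longleftrightarrow>
    count_list p North = n \<and> count_list p East = n \<and>
    (\<forall>q. prefix q p \<longrightarrow> count_list q East \<le> count_list q North)"

fun swap_step :: "step \<Rightarrow> step" where
  "swap_step North = East"
| "swap_step East = North"

definition rev_path :: "path \<Rightarrow> path" where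
  "rev_path p = map swap_step (rev p)"

definition has_ascent_of_length :: "nat \<Rightarrow> path \<Rightarrow> bool" where
  "has_ascent_of_length k p \<longleftrightarrow>
    (\<exists>u v. p = u @ replicate k North @ v \<and>
           (u = [] \<or> last u = East) \<and> (v = [] \<or> hd v = East))"

definition ENNE :: "nat \<Rightarrow> path set" where
  "ENNE n = {p. catalan_path n p \<and> \<not> has_ascent_of_length 2 p}"

definition NEEN :: "nat \<Rightarrow> path set" where
  "NEEN n = {p. catalan_path n p \<and> \<not> sublist [North, East, East, North] p}"

section \<open>The maps F, G, H and J\<close>

text \<open>
  The graphs of the maps: each rule is one of the recursive clauses. Since the recursions are
  well-founded, the least relations closed under the clauses are the graphs of the unique
  maps satisfying them.
\<close>

inductive H_graph :: "path \<Rightarrow> eperm \<Rightarrow> bool" and J_graph :: "path \<Rightarrow> eperm \<Rightarrow> bool" where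
  H_empty: "H_graph [] Anti"
| H_step: "\<lbrakk>catalan_path k a; catalan_path l b;
            a @ [North] @ rev_path b @ [East] \<in> (\<Union>n. ENNE n);
            J_graph b \<beta>; H_graph a \<alpha>\<rbrakk>
     \<Longrightarrow> H_graph (a @ [North] @ rev_path b @ [East]) (compl \<beta> \<ominus>\<^sub>p (one_perm \<ominus>\<^sub>p \<alpha>))"
| J_empty: "J_graph [] (Perm [])"
| J_step: "\<lbrakk>catalan_path k a; catalan_path l b;
            rev_path a @ [North] @ b @ [East] \<in> (\<Union>n. NEEN n);
            H_graph a \<alpha>; J_graph b \<beta>\<rbrakk>
     \<Longrightarrow> J_graph (rev_path a @ [North] @ b @ [East])
          (((one_perm \<oplus>\<^sub>p compl \<alpha>) \<oplus>\<^sub>p one_perm) \<ominus>\<^sub>p \<beta>)"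

inductive F_graph :: "eperm \<Rightarrow> path \<Rightarrow> bool" and G_graph :: "eperm \<Rightarrow> path \<Rightarrow> bool" where
  F_anti: "F_graph Anti []"
| F_step: "\<lbrakk>leftmost_decomp \<pi> \<beta> \<alpha>; F_graph \<alpha> p; G_graph \<beta> q\<rbrakk>
     \<Longrightarrow> F_graph \<pi> (p @ [North] @ rev_path q @ [East])"
| G_empty: "G_graph (Perm []) []"
| G_step: "\<lbrakk>odd_thread \<pi>; even_thread \<alpha>; odd_thread \<beta>;
            \<pi> = ((one_perm \<oplus>\<^sub>p compl \<alpha>) \<oplus>\<^sub>p one_perm) \<ominus>\<^sub>p \<beta>;
            F_graph \<alpha> p; G_graph \<beta> q\<rbrakk>
     \<Longrightarrow> G_graph \<pi> (rev_path p @ [North] @ q @ [East])"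

definition H_map :: "path \<Rightarrow> eperm" where "H_map p = (THE \<alpha>. H_graph p \<alpha>)"
definition J_map :: "path \<Rightarrow> eperm" where "J_map p = (THE \<beta>. J_graph p \<beta>)"
definition F_map :: "eperm \<Rightarrow> path" where "F_map \<alpha> = (THE p. F_graph \<alpha> p)"
definition G_map :: "eperm \<Rightarrow> path" where "G_map \<beta> = (THE p. G_graph \<beta> p)"

definition mutually_inverse_on :: "'a set \<Rightarrow> 'b set \<Rightarrow> ('a \<Rightarrow> 'b) \<Rightarrow> ('b \<Rightarrow> 'a) \<Rightarrow> bool" where
  "mutually_inverse_on A B f g \<longleftrightarrow>
    f \<in> A \<rightarrow> B \<and> g \<in> B \<rightarrow> A \<and> (\<forall>x\<in>A. g (f x) = x) \<and> (\<forall>y\<in>B. f (g y) = y)"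

end

theory Submission
  imports Defs
begin

text \<open>
  Both pairs of maps undo each other because the two recursions follow the same decomposition.
  Two things have to be known for this. On the side of the permutations, the threads are exactly what
  the two sums \<open>c(\<beta>) \<ominus> 1 \<ominus> \<alpha>\<close> and \<open>(1 \<oplus> c(\<alpha>) \<oplus> 1) \<ominus> \<beta>\<close> generate from \<open>@\<close> and \<open>\<emptyset>\<close>, and
  the leftmost decomposition is the one in which \<open>\<beta>\<close> does not begin with 1
  (\<open>leftmost_decomp_iff\<close>, \<open>leftmost_decomp_exists\<close>). On the side of the paths, cutting \<open>aNb\<^sup>rE\<close>
  at its last return to the diagonal shows that such a path has no ascent of length two iff \<open>a\<close> has
  none, \<open>b\<close> avoids \<open>NEEN\<close>, and \<open>b\<close> does not end in \<open>NE\<close> (\<open>ENNE_join_iff\<close>); \<open>a\<^sup>rNbE\<close> avoids \<open>NEEN\<close>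
  iff \<open>a\<close> has no ascent of length two and \<open>b\<close> avoids \<open>NEEN\<close> (\<open>NEEN_join_iff\<close>). An odd thread
  begins with 1 exactly when its path ends in \<open>NE\<close>, so the side conditions agree, and rule induction
  shows that the graphs of \<open>F\<close>, \<open>G\<close> are the converses of the graphs of \<open>H\<close>, \<open>J\<close>.

  That the threads are generated by the two sums comes from a description of the snow leopard
  permutations of odd length: apart from \<open>@\<close> they are the permutations
  \<open>(1 \<oplus> c(\<pi>\<^sub>1) \<oplus> 1) \<ominus> 1 \<ominus> \<pi>\<^sub>2\<close> with \<open>\<pi>\<^sub>1\<close>, \<open>\<pi>\<^sub>2\<close> snow leopard permutations of odd length
  (\<open>odd_snow_split\<close>, \<open>odd_snow_build\<close>). Taking even and odd entries of such a sum gives the two sums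
  for threads (\<open>threads_compose\<close>).

  The description of the snow leopard permutations rests on one fact about a complete Baxter
  permutation \<open>b\<close> with doubly alternating odd entries
  (\<open>baxter_skew_split\<close>): if \<open>b\<close> does not begin with 1, it is a skew sum of a part beginning with its
  minimum, a single even entry, and a remainder. Otherwise some set of consecutive values
  would be confined to positions on the left of that even entry. Every even entry sits in an ascent
  or a descent of the odd entries, and which of the two holds is determined by the parity of half its
  position as well as by the parity of half its value. Counting the even entries of the confined set
  along values, ascents and descents balance; counting along positions, there is at least one ascent
  more than there are descents.
\<close>

section \<open>Complete Baxter permutations and their inverses\<close>

definition inverse_pair :: "nat \<Rightarrow> (nat \<Rightarrow> nat) \<Rightarrow> (nat \<Rightarrow> nat) \<Rightarrow> bool" where
  "inverse_pair N b g \<longleftrightarrow>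
    (\<forall>j. 1 \<le> j \<and> j \<le> N \<longrightarrow> 1 \<le> b j \<and> b j \<le> N \<and> 1 \<le> g j \<and> g j \<le> N \<and> g (b j) = j \<and> b (g j) = j)"

text \<open>
  The permutation \<open>b\<close> of \<open>{1..2n+1}\<close> comes together with its inverse \<open>g\<close>: passing to the inverse
  permutation then means exchanging the two arguments. The betweenness condition speaks of the positions
  \<open>g i\<close> and \<open>g (i + 1)\<close> of two consecutive values.
\<close>

definition baxter :: "nat \<Rightarrow> (nat \<Rightarrow> nat) \<Rightarrow> (nat \<Rightarrow> nat) \<Rightarrow> bool" where
  "baxter n b g \<longleftrightarrow>
    inverse_pair (2 * n + 1) b g \<and>
    (\<forall>j. 1 \<le> j \<and> j \<le> 2 * n + 1 \<longrightarrow> even (b j) = even j) \<and>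
    (\<forall>i z. 1 \<le> i \<and> i \<le> 2 * n \<and> (g i < z \<and> z < g (i + 1) \<or> g (i + 1) < z \<and> z < g i) \<longrightarrow>
      (if odd i then b z < i else i + 1 < b z))"

lemma baxter_bounds:
  assumes "baxter n b g" "1 \<le> j" "j \<le> 2 * n + 1"
  shows "1 \<le> b j" "b j \<le> 2 * n + 1" "1 \<le> g j" "g j \<le> 2 * n + 1" "g (b j) = j" "b (g j) = j"
    "even (b j) = even j" "even (g j) = even j"
proof -
  have *: "\<And>j. 1 \<le> j \<Longrightarrow> j \<le> 2 * n + 1 \<Longrightarrow> 1 \<le> b j \<and> b j \<le> 2 * n + 1 \<and> 1 \<le> g j \<and> g j \<le> 2 * n + 1 \<and> g (b j) = j \<and> b (g j) = j \<and> even (b j) = even j"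
    using assms(1) unfolding baxter_def inverse_pair_def by blast
  show "1 \<le> b j" "b j \<le> 2 * n + 1" "1 \<le> g j" "g j \<le> 2 * n + 1" "g (b j) = j" "b (g j) = j"
    "even (b j) = even j" using *[OF assms(2,3)] by blast+
  show "even (g j) = even j" using *[OF assms(2,3)] *[of "g j"] by metis
qed

lemma baxter_bounds_conj:
  assumes "baxter n b g" "1 \<le> j" "j \<le> 2 * n + 1"
  shows "1 \<le> b j \<and> b j \<le> 2 * n + 1 \<and> 1 \<le> g j \<and> g j \<le> 2 * n + 1 \<and> g (b j) = j \<and> b (g j) = j \<and>
    even (b j) = even j \<and> even (g j) = even j"
  by (intro conjI baxter_bounds[OF assms])

lemma baxter_between:
  assumes "baxter n b g" "1 \<le> i" "i \<le> 2 * n" "g i < z \<and> z < g (i + 1) \<or> g (i + 1) < z \<and> z < g i"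
  shows "if odd i then b z < i else i + 1 < b z"
  using assms unfolding baxter_def by blast

text \<open>
  If both odd neighbours of the value \<open>2i\<close> stood on the same side of it, the entry next to \<open>2i\<close> on
  that side would have to be at most \<open>2i - 1\<close> and at least \<open>2i + 1\<close>.
\<close>

lemma baxter_even_value_between:
  assumes B: "baxter n b g" and i: "1 \<le> i" "i \<le> n"
  shows "g (2*i-1) < g (2*i) \<and> g (2*i) < g (2*i+1) \<or> g (2*i+1) < g (2*i) \<and> g (2*i) < g (2*i-1)"
proof -
  let ?x = "g (2*i)"
  have x: "1 \<le> ?x" "?x \<le> 2*n+1" "b ?x = 2*i" "even ?x"
    using baxter_bounds[OF B, of "2*i"] i by auto
  have x2: "?x \<noteq> 2*n+1" using x by (metis even_mult_iff even_plus_one_iff even_numeral)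
  have l: "b (g (2*i-1)) = 2*i-1" "b (g (2*i+1)) = 2*i+1"
    using baxter_bounds[OF B, of "2*i-1"] baxter_bounds[OF B, of "2*i+1"] i by auto
  have P: "\<And>z. g (2*i-1) < z \<and> z < ?x \<or> ?x < z \<and> z < g (2*i-1) \<Longrightarrow> b z < 2*i-1"
    using baxter_between[OF B, of "2*i-1"] i by auto
  have Q: "\<And>z. g (2*i+1) < z \<and> z < ?x \<or> ?x < z \<and> z < g (2*i+1) \<Longrightarrow> 2*i+1 < b z"
    using baxter_between[OF B, of "2*i"] i by auto
  have n1: "g (2*i-1) \<noteq> ?x" "g (2*i+1) \<noteq> ?x" using l x i by auto
  have "\<not> (g (2*i-1) > ?x \<and> g (2*i+1) > ?x)"
  proof
    assume a: "g (2*i-1) > ?x \<and> g (2*i+1) > ?x"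
    have "b (?x+1) \<le> 2*i-1" using P[of "?x+1"] l(1) a by (cases "g (2*i-1) = ?x+1") auto
    moreover have "2*i+1 \<le> b (?x+1)" using Q[of "?x+1"] l(2) a by (cases "g (2*i+1) = ?x+1") auto
    ultimately show False by simp
  qed
  moreover have "\<not> (g (2*i-1) < ?x \<and> g (2*i+1) < ?x)"
  proof
    assume a: "g (2*i-1) < ?x \<and> g (2*i+1) < ?x"
    have "g (2*i-1) = ?x-1 \<or> g (2*i-1) < ?x-1 \<and> ?x-1 < ?x" using a by linarith
    then have "b (?x-1) \<le> 2*i-1" using P[of "?x-1"] l(1) by auto
    moreover have "g (2*i+1) = ?x-1 \<or> g (2*i+1) < ?x-1 \<and> ?x-1 < ?x" using a by linarith
    then have "2*i+1 \<le> b (?x-1)" using Q[of "?x-1"] l(2) by auto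
    ultimately show False by simp
  qed
  ultimately show ?thesis using n1 by linarith
qed

text \<open>
  Consecutive values \<open>i\<close>, \<open>i + 1\<close> on different sides of the positions \<open>f\<close>, \<open>f + 1\<close> enclose both
  entries there, so both are below \<open>i\<close> or both are above \<open>i + 1\<close>; but one of them is below and the
  other one above.
\<close>

lemma baxter_same_side:
  assumes B: "baxter n b g" and f: "1 \<le> f" "f \<le> 2*n"
    and lo: "b f < lo \<and> lo + d < b (f+1) \<or> b (f+1) < lo \<and> lo + d < b f"
  shows "g (lo + d) < f \<longleftrightarrow> g lo < f"
  using lo
proof (induction d)
  case (Suc d)
  let ?i = "lo + d"
  have bb: "b f \<le> 2*n+1" "b (f+1) \<le> 2*n+1" using baxter_bounds[OF B, of f] baxter_bounds[OF B, of "f+1"] f by auto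
  have i: "1 \<le> ?i" "?i \<le> 2*n" using Suc.prems bb by linarith+
  have ne: "g ?i \<noteq> f" "g ?i \<noteq> f+1" "g (?i+1) \<noteq> f" "g (?i+1) \<noteq> f+1"
    using baxter_bounds[OF B, of ?i] baxter_bounds[OF B, of "?i+1"] i Suc.prems by auto
  have "g (?i+1) < f \<longleftrightarrow> g ?i < f"
  proof (rule ccontr)
    assume "\<not> ?thesis"
    then have "g ?i < f \<and> f + 1 < g (?i+1) \<or> g (?i+1) < f \<and> f + 1 < g ?i" using ne by linarith
    then have "if odd ?i then b f < ?i \<and> b (f+1) < ?i else ?i+1 < b f \<and> ?i+1 < b (f+1)"
      using baxter_between[OF B i, of f] baxter_between[OF B i, of "f+1"] by auto
    then show False using Suc.prems by (auto split: if_splits)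
  qed
  moreover have "g ?i < f \<longleftrightarrow> g lo < f"
    by (rule Suc.IH) (use Suc.prems in linarith)
  ultimately show ?case by simp
qed simp

lemma baxter_gap_one_side:
  assumes B: "baxter n b g" and f: "1 \<le> f" "f \<le> 2*n"
    and lo: "b f < y \<and> y < b (f+1) \<or> b (f+1) < y \<and> y < b f"
      "b f < y' \<and> y' < b (f+1) \<or> b (f+1) < y' \<and> y' < b f"
  shows "g y < f \<longleftrightarrow> g y' < f"
proof (cases "y \<le> y'")
  case True
  then show ?thesis using baxter_same_side[OF B f, of y "y' - y"] lo by auto
next
  case False
  then show ?thesis using baxter_same_side[OF B f, of y' "y - y'"] lo by auto
qed

text \<open>
  The definition treats positions and values differently, but the notion is invariant under
  inversion. All values strictly between \<open>b f\<close> and \<open>b (f + 1)\<close> lie on the same side of these two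
  positions. Exactly one of the two entries is even, and the place of the odd value next to it is
  known, which determines the side.
\<close>

lemma baxter_inverse:
  assumes B: "baxter n b g"
  shows "baxter n g b"
proof -
  have bd: "\<And>j. 1 \<le> j \<Longrightarrow> j \<le> 2 * n + 1 \<Longrightarrow>
      1 \<le> b j \<and> b j \<le> 2 * n + 1 \<and> 1 \<le> g j \<and> g j \<le> 2 * n + 1 \<and>
      g (b j) = j \<and> b (g j) = j \<and> even (b j) = even j \<and> even (g j) = even j"
    by (rule baxter_bounds_conj[OF B])
  have "if odd f then g y < f else f + 1 < g y"
    if f: "1 \<le> f" "f \<le> 2 * n" and y: "b f < y \<and> y < b (f + 1) \<or> b (f + 1) < y \<and> y < b f" for f y
  proof -
    have bb: "1 \<le> b f" "1 \<le> b (f+1)" "b f \<le> 2*n+1" "b (f+1) \<le> 2*n+1" "even (b f) = even f" "even (b (f+1)) = odd f"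
      "g (b f) = f" "g (b (f+1)) = f+1"
      using bd[of f] bd[of "f+1"] f by auto
    have yy: "1 \<le> y" "y \<le> 2*n+1" using y bb by auto
    have ny: "g y \<noteq> f" "g y \<noteq> f+1" using bd[OF yy] y by auto
    define e where "e = (if odd f then f + 1 else f)"
    define u where "u = (if odd f then f else f + 1)"
    have e: "1 \<le> e" "e \<le> 2*n+1" "even e" "even (b e)"
      using f bb unfolding e_def by simp_all
    obtain i where i: "b e = 2*i" using e by auto
    have i1: "1 \<le> i" "i \<le> n" using i bd[of e] e by auto
    have ge: "g (2*i) = e" using bd[of e] e i by metis
    have tri: "g (2*i-1) < e \<and> e < g (2*i+1) \<or> g (2*i+1) < e \<and> e < g (2*i-1)"
      using baxter_even_value_between[OF B i1] ge by simp
    have l: "b (g (2*i-1)) = 2*i-1" "b (g (2*i+1)) = 2*i+1" using bd[of "2*i-1"] bd[of "2*i+1"] i1 by auto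
    have P: "\<And>z. g (2*i-1) < z \<and> z < e \<or> e < z \<and> z < g (2*i-1) \<Longrightarrow> b z < 2*i-1"
      using baxter_between[OF B, of "2*i-1"] i1 ge by auto
    have Q: "\<And>z. g (2*i+1) < z \<and> z < e \<or> e < z \<and> z < g (2*i+1) \<Longrightarrow> 2*i+1 < b z"
      using baxter_between[OF B, of "2*i"] i1 ge by auto
    have yu: "b u < y \<and> y < 2*i \<or> 2*i < y \<and> y < b u"
      using y i unfolding u_def e_def by (auto split: if_splits)
    have *: "g w < f \<longleftrightarrow> odd f" if w: "w = (if b u < 2*i then 2*i-1 else 2*i+1)" for w
    proof -
      have wy: "w \<noteq> b u" using yu w by auto
      show ?thesis
      proof (cases "odd f")
        case True
        have eu: "e = f+1" "u = f" using True by (auto simp: e_def u_def)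
        have "g w < f"
        proof (cases "b f < 2*i")
          case c: True
          then have "w = 2*i-1" using w eu by simp
          moreover have "\<not> g (2*i+1) < e"
            using eu c Q[of f] l(2) by (cases "g (2*i+1) = f") auto
          ultimately show ?thesis using tri wy l(1) eu by (cases "g w = f") auto
        next
          case c: False
          then have "w = 2*i+1" using w eu by simp
          moreover have "\<not> g (2*i-1) < e"
            using eu c P[of f] l(1) yu i1 by (cases "g (2*i-1) = f") auto
          ultimately show ?thesis using tri wy l(2) eu by (cases "g w = f") auto
        qed
        then show ?thesis using True by simp
      next
        case False
        have eu: "e = f" "u = f+1" using False by (auto simp: e_def u_def)
        have "\<not> g w < f"
        proof (cases "b (f+1) < 2*i")
          case c: True
          then have "w = 2*i-1" using w eu by simp
          moreover have "\<not> e < g (2*i+1)"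
            using eu c Q[of "f+1"] l(2) by (cases "g (2*i+1) = f+1") auto
          ultimately show ?thesis using tri eu by auto
        next
          case c: False
          then have "w = 2*i+1" using w eu by simp
          moreover have "\<not> e < g (2*i-1)"
            using eu c P[of "f+1"] l(1) yu i1 by (cases "g (2*i-1) = f+1") auto
          ultimately show ?thesis using tri eu by auto
        qed
        then show ?thesis using False by simp
      qed
    qed
    define w where "w = (if b u < 2*i then 2*i-1 else 2*i+1)"
    have w2: "w \<noteq> b u" using yu w_def by auto
    have "b u < w \<and> w < 2*i \<or> 2*i < w \<and> w < b u"
      using yu w2 i1 unfolding w_def by (auto split: if_splits)
    then have "b f < w \<and> w < b (f+1) \<or> b (f+1) < w \<and> w < b f"
      using i unfolding u_def e_def by (auto split: if_splits)
    then have "g y < f \<longleftrightarrow> odd f"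
      using baxter_gap_one_side[OF B f y] *[OF w_def] by blast
    then show ?thesis using ny by auto
  qed
  then show ?thesis unfolding baxter_def inverse_pair_def using bd by blast
qed

text \<open>
  The even entry \<open>2i\<close> at position \<open>2p\<close> sits in an ascent or descent of the odd entries, and also in
  an ascent or descent of their inverse. They are of the same kind: the entry to the left of \<open>2i\<close> is
  at most \<open>2i - 1\<close> if this value stands on the left, and at least \<open>2i + 1\<close> otherwise.
\<close>

lemma baxter_same_ascents:
  assumes B: "baxter n b g" and p: "1 \<le> p" "p \<le> n" and bp: "b (2*p) = 2*i"
  shows "b (2*p-1) < b (2*p+1) \<longleftrightarrow> g (2*i-1) < g (2*i+1)"
proof -
  have i: "1 \<le> i" "i \<le> n" "g (2*i) = 2*p"
    using baxter_bounds[OF B, of "2*p"] p bp by auto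
  have tri: "g (2*i-1) < 2*p \<and> 2*p < g (2*i+1) \<or> g (2*i+1) < 2*p \<and> 2*p < g (2*i-1)"
    using baxter_even_value_between[OF B i(1,2)] i by auto
  have tri': "b (2*p-1) < 2*i \<and> 2*i < b (2*p+1) \<or> b (2*p+1) < 2*i \<and> 2*i < b (2*p-1)"
    using baxter_even_value_between[OF baxter_inverse[OF B] p] bp by auto
  have l: "b (g (2*i-1)) = 2*i-1" "b (g (2*i+1)) = 2*i+1"
    using baxter_bounds[OF B, of "2*i-1"] baxter_bounds[OF B, of "2*i+1"] i by auto
  have P: "\<And>z. g (2*i-1) < z \<and> z < 2*p \<or> 2*p < z \<and> z < g (2*i-1) \<Longrightarrow> b z < 2*i-1"
    using baxter_between[OF B, of "2*i-1"] i by auto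
  have Q: "\<And>z. g (2*i+1) < z \<and> z < 2*p \<or> 2*p < z \<and> z < g (2*i+1) \<Longrightarrow> 2*i+1 < b z"
    using baxter_between[OF B, of "2*i"] i by auto
  show ?thesis
  proof (cases "g (2*i-1) < 2*p")
    case True
    then have "g (2*i-1) = 2*p-1 \<or> g (2*i-1) < 2*p-1 \<and> 2*p-1 < 2*p" using p by linarith
    then have "b (2*p-1) \<le> 2*i-1" using P[of "2*p-1"] l(1) by auto
    then show ?thesis using tri tri' True i by linarith
  next
    case False
    then have "g (2*i+1) = 2*p-1 \<or> g (2*i+1) < 2*p-1 \<and> 2*p-1 < 2*p" using p tri by linarith
    then have "2*i+1 \<le> b (2*p-1)" using Q[of "2*p-1"] l(2) by auto
    then show ?thesis using tri tri' False i by linarith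
  qed
qed

text \<open>
  For even \<open>c\<close> the odd entries of \<open>b\<close> are alternating, for odd \<open>c\<close> they start with a descent. The
  offset \<open>c\<close> absorbs the changes of parity caused by shifting positions and by complements.
\<close>

definition updown :: "nat \<Rightarrow> nat \<Rightarrow> (nat \<Rightarrow> nat) \<Rightarrow> bool" where
  "updown c n b \<longleftrightarrow> (\<forall>p. 1 \<le> p \<and> p \<le> n \<longrightarrow> (b (2*p-1) < b (2*p+1) \<longleftrightarrow> odd (p + c)))"

lemma baxter_updown:
  assumes "baxter n b g" "updown c n b" "1 \<le> p" "p \<le> n"
  shows "if odd (p + c) then b (2*p-1) < b (2*p) \<and> b (2*p) < b (2*p+1)
         else b (2*p+1) < b (2*p) \<and> b (2*p) < b (2*p-1)"
  using baxter_even_value_between[OF baxter_inverse[OF assms(1)] assms(3,4)] assms(2-4)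
  unfolding updown_def by (auto split: if_splits)

text \<open>
  This is why snow leopard permutations preserve parity: the parity of half the position and the
  parity of half the value both say whether the even entry belongs to an ascent.
\<close>

lemma baxter_preserves_half_parity:
  assumes B: "baxter n b g" and u: "updown c n b" "updown c n g" and p: "1 \<le> p" "p \<le> n" and bp: "b (2*p) = 2*i"
  shows "even i \<longleftrightarrow> even p"
proof -
  have i: "1 \<le> i" "i \<le> n" using baxter_bounds[OF B, of "2*p"] p bp by auto
  have "odd (p + c) \<longleftrightarrow> odd (i + c)"
    using baxter_same_ascents[OF B p bp] u p i unfolding updown_def by blast
  then show ?thesis unfolding even_add by blast
qed

section \<open>A complete Baxter permutation that does not begin with 1\<close>

text \<open>
  Let \<open>2v + 1\<close> be the first entry and \<open>2q\<close> the position of \<open>2v\<close>; here \<open>v\<close> and \<open>q\<close> are even. As \<open>2v\<close> is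
  even, everything before position \<open>2q\<close> is larger than \<open>2v\<close>. Suppose that something after it is larger too. At
  the first such place there is an even entry \<open>2j\<close>, with \<open>j\<close> odd, and all values strictly between
  \<open>2v\<close> and \<open>2j\<close> stand before position \<open>2q\<close>. Weigh an even entry in this range of values by 1 if it
  belongs to an ascent and by \<open>-1\<close> if it belongs to a descent. Ordered by value the weights
  alternate and cancel. Ordered by position, the walk through the positions \<open>1, \<dots>, 2q - 1\<close> starts
  and ends in the range. Whenever it leaves the range and returns to it, it leaves after an ascent and
  returns after a descent, so an excursion skips one descent more than ascents; the total
  weight is at least 1.
\<close>

lemma baxter_skew_split:
  assumes B: "baxter n b g" and u: "updown 0 n b" "updown 0 n g" and b1: "b 1 \<noteq> 1"
  obtains q v where "1 \<le> q" "q \<le> n" "1 \<le> v" "v \<le> n" "even q" "even v" "b (2*q) = 2*v" "b 1 = 2*v+1"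
    "\<And>t. 1 \<le> t \<Longrightarrow> t \<le> 2*n+1 \<Longrightarrow> t < 2*q \<longleftrightarrow> 2*v < b t"
proof -
  have bd: "\<And>j. 1 \<le> j \<Longrightarrow> j \<le> 2 * n + 1 \<Longrightarrow>
      1 \<le> b j \<and> b j \<le> 2 * n + 1 \<and> 1 \<le> g j \<and> g j \<le> 2 * n + 1 \<and>
      g (b j) = j \<and> b (g j) = j \<and> even (b j) = even j \<and> even (g j) = even j"
    by (rule baxter_bounds_conj[OF B])
  have dual: "\<And>f y. 1 \<le> f \<Longrightarrow> f \<le> 2*n \<Longrightarrow> b f < y \<and> y < b (f + 1) \<or> b (f + 1) < y \<and> y < b f \<Longrightarrow> if odd f then g y < f else f + 1 < g y"
    using baxter_between[OF baxter_inverse[OF B]] by blast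
  have ud: "\<And>p. 1 \<le> p \<Longrightarrow> p \<le> n \<Longrightarrow> if odd p then b (2*p-1) < b (2*p) \<and> b (2*p) < b (2*p+1)
         else b (2*p+1) < b (2*p) \<and> b (2*p) < b (2*p-1)"
    using baxter_updown[OF B u(1)] unfolding add_0_right by blast
  have ud': "\<And>p. 1 \<le> p \<Longrightarrow> p \<le> n \<Longrightarrow> if odd p then g (2*p-1) < g (2*p) \<and> g (2*p) < g (2*p+1)
         else g (2*p+1) < g (2*p) \<and> g (2*p) < g (2*p-1)"
    using baxter_updown[OF baxter_inverse[OF B] u(2)] unfolding add_0_right by blast
  have par: "\<And>p i. 1 \<le> p \<Longrightarrow> p \<le> n \<Longrightarrow> b (2*p) = 2*i \<Longrightarrow> even i \<longleftrightarrow> even p"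
    using baxter_preserves_half_parity[OF B u] by blast
  obtain v where v1: "b 1 = 2*v+1" using bd[of 1] by (auto elim: oddE)
  have v: "b 1 = 2*v+1" "1 \<le> v" "v \<le> n" using bd[of 1] b1 v1 by auto
  have gv1: "g (2*v+1) = 1" using bd[of 1] v by auto
  have ev: "even v" using ud'[OF v(2,3)] gv1 bd[of "2*v"] v by (auto split: if_splits)
  define q where "q = g (2*v) div 2"
  have q2: "g (2*v) = 2*q" using bd[of "2*v"] v unfolding q_def by auto
  have q: "1 \<le> q" "q \<le> n" "b (2*q) = 2*v" using bd[of "2*v"] v q2 by auto
  have eq: "even q" using par[OF q] ev by simp
  \<comment> \<open>The value \<open>2v\<close> is even, so the entries between it and \<open>2v + 1\<close> are larger.\<close>
  have S1: "2*v < b t" if "1 \<le> t" "t < 2*q" for t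
  proof (cases "t = 1")
    case False
    then show ?thesis using baxter_between[OF B, of "2*v" t] that v q2 gv1 ev by auto
  qed (use v in simp)
  have S2: "\<not> 2*v < b t" if t: "2*q \<le> t" "t \<le> 2*n+1" for t
  proof
    assume "2*v < b t"
    with t have ex: "\<exists>t. 2*q \<le> t \<and> t \<le> 2*n+1 \<and> 2*v < b t" by blast
    define s where "s = (LEAST t. 2*q \<le> t \<and> t \<le> 2*n+1 \<and> 2*v < b t)"
    have s: "2*q \<le> s" "s \<le> 2*n+1" "2*v < b s" using LeastI_ex[OF ex] unfolding s_def by auto
    have sl: "\<And>t. 2*q \<le> t \<Longrightarrow> t < s \<Longrightarrow> b t \<le> 2*v"
      using not_less_Least[of _ "\<lambda>t. 2*q \<le> t \<and> t \<le> 2*n+1 \<and> 2*v < b t"] s unfolding s_def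
      by (metis (no_types, lifting) leI less_le_trans nat_less_le)
    have "s \<noteq> 2*q" using s q by auto
    moreover have "s \<noteq> 2*q+1" using ud[OF q(1,2)] eq s q by auto
    ultimately have s2: "2*q < s-1" using s by linarith
    have bs1: "b (s-1) < 2*v"
    proof -
      have "1 \<le> s-1" "s-1 \<le> 2*n+1" using s s2 by linarith+
      then have "b (s-1) \<noteq> 2*v" using q2 bd[of "s-1"] s2 by auto
      then show ?thesis using sl[of "s-1"] s2 s by linarith
    qed
    \<comment> \<open>The value \<open>2v\<close> lies between the entries at \<open>s - 1\<close> and \<open>s\<close>; its position before \<open>s - 1\<close>
      forces \<open>s\<close> to be even and the values in between to stand on the left.\<close>
    have cross: "\<And>y. b (s-1) < y \<and> y < b s \<Longrightarrow> if odd (s-1) then g y < s-1 else s < g y"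
      using dual[of "s-1"] s s2 by auto
    have odds: "odd (s-1)" using cross[of "2*v"] bs1 s q2 s2 by (auto split: if_splits)
    define p where "p = s div 2"
    have p: "s = 2*p" "1 \<le> p" "p \<le> n" "q < p" using odds s s2 unfolding p_def by auto
    define j where "j = b s div 2"
    have j: "b (2*p) = 2*j" "1 \<le> j" "j \<le> n" "v < j" "g (2*j) = 2*p" using bd[of s] s p unfolding j_def by auto
    have op: "odd p" using ud[OF p(2,3)] bs1 s p by (auto split: if_splits)
    have oj: "odd j" using par[OF p(2,3) j(1)] op by simp
    have X: "g y < 2*q" if y: "2*v < y" "y < 2*j" for y
    proof -
      have "g y < s-1" using cross[of y] y bs1 j p odds by auto
      moreover have "b (g y) = y" using bd[of y] y j by auto
      ultimately show ?thesis using sl[of "g y"] y by linarith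
    qed
    have last_low: "b (2*q-1) < 2*j"
    proof -
      have "1 \<le> 2*q-1" "2*q-1 \<le> 2*n+1" using q by linarith+
      then have "g (b (2*q-1)) = 2*q-1" using bd[of "2*q-1"] by blast
      then have "b (2*q-1) \<noteq> 2*j" using j p q by auto
      moreover have "\<not> 2*j < b (2*q-1)"
      proof
        assume a: "2*j < b (2*q-1)"
        have f: "1 \<le> 2*q-1" "2*q-1 \<le> 2*n" "2*q-1+1 = 2*q" "odd (2*q-1)" using q by auto
        have "g (2*j) < 2*q-1" using dual[OF f(1,2), of "2*j"] f(3,4) a q j by simp
        then show False using j p by linarith
      qed
      ultimately show ?thesis by linarith
    qed
    \<comment> \<open>The weight of the even entries below \<open>2j\<close> among the first \<open>t\<close> positions.\<close>
    define S where "S t = (\<Sum>u | 1 \<le> u \<and> 2*u \<le> t \<and> b (2*u) < 2*j. if odd u then 1 else - 1 :: int)" for t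
    have fin: "finite {u. 1 \<le> u \<and> 2*u \<le> t \<and> P u}" for t :: nat and P
      by (rule finite_subset[of _ "{..t}"]) auto
    have S_odd: "S (2*u+1) = S (2*u)" for u
    proof -
      have "2*w \<le> 2*u+1 \<longleftrightarrow> 2*w \<le> 2*u" for w :: nat by presburger
      then show ?thesis unfolding S_def by simp
    qed
    have S_in: "S (2*u+2) = S (2*u+1) + (if even u then 1 else -1)" if "b (2*u+2) < 2*j" for u
    proof -
      have *: "{w. 1 \<le> w \<and> 2*w \<le> 2*u+2 \<and> b (2*w) < 2*j} = insert (u+1) {w. 1 \<le> w \<and> 2*w \<le> 2*u+1 \<and> b (2*w) < 2*j}"
      proof (intro set_eqI iffI)
        fix w assume "w \<in> {w. 1 \<le> w \<and> 2*w \<le> 2*u+2 \<and> b (2*w) < 2*j}"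
        then show "w \<in> insert (u+1) {w. 1 \<le> w \<and> 2*w \<le> 2*u+1 \<and> b (2*w) < 2*j}"
          by (cases "w = u+1") auto
      next
        fix w assume "w \<in> insert (u+1) {w. 1 \<le> w \<and> 2*w \<le> 2*u+1 \<and> b (2*w) < 2*j}"
        then show "w \<in> {w. 1 \<le> w \<and> 2*w \<le> 2*u+2 \<and> b (2*w) < 2*j}"
          using that by (cases "w = u+1") auto
      qed
      show ?thesis unfolding S_def * using fin[of "2*u+1" "\<lambda>w. b (2*w) < 2*j"]
        by (subst sum.insert) auto
    qed
    have S_out: "S (2*u+2) = S (2*u+1)" if "\<not> b (2*u+2) < 2*j" for u
      unfolding S_def
    proof (rule sum.cong)
      show "{w. 1 \<le> w \<and> 2*w \<le> 2*u+2 \<and> b (2*w) < 2*j} = {w. 1 \<le> w \<and> 2*w \<le> 2*u+1 \<and> b (2*w) < 2*j}"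
      proof -
        have "w \<noteq> u+1" if "b (2*w) < 2*j" for w using that \<open>\<not> b (2*u+2) < 2*j\<close> by auto
        moreover have "2*w \<le> 2*u+2 \<longleftrightarrow> w = u+1 \<or> 2*w \<le> 2*u+1" for w by presburger
        ultimately show ?thesis by blast
      qed
    qed simp
    \<comment> \<open>Inside the range the running weight is bounded below by its value for an uninterrupted walk,
      which is 1 after an ascent and 0 after a descent; during an excursion it is at least 1, because
      excursions start after an ascent.\<close>
    have inv: "(b (t+1) < 2*j \<longrightarrow> S (t+1) \<ge> (if (t+1) mod 4 \<in> {2,3} then 1 else 0)) \<and> (2*j < b (t+1) \<longrightarrow> S (t+1) \<ge> 1)"
      if "t + 1 < 2*q" for t
      using that
    proof (induction t)
      case 0
      have "S 1 = 0" unfolding S_def by (rule sum.neutral) auto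
      then show ?case using v j by simp
    next
      case (Suc t)
      let ?f = "t+1"
      have f: "1 \<le> ?f" "?f \<le> 2*n" "?f + 1 < 2*q" using Suc.prems q by auto
      have ne: "b ?f \<noteq> 2*j" "b (?f+1) \<noteq> 2*j" using j bd[of ?f] bd[of "?f+1"] f q p by auto
      have IH: "b ?f < 2*j \<Longrightarrow> S ?f \<ge> (if ?f mod 4 \<in> {2,3} then 1 else 0)" "2*j < b ?f \<Longrightarrow> S ?f \<ge> 1"
        using Suc by auto
      \<comment> \<open>A step across the value \<open>2j\<close> must start at an even position, since \<open>2j\<close> stands further to
        the right.\<close>
      have crs: "even ?f" if "b ?f < 2*j \<and> 2*j < b (?f+1) \<or> b (?f+1) < 2*j \<and> 2*j < b ?f"
        using dual[OF f(1,2) that] f p j by (auto split: if_splits)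
      show ?case
      proof (cases "even ?f")
        case True
        then obtain w where w: "?f = 2*w" by blast
        have w1: "1 \<le> w" "w \<le> n" using w f by auto
        have SS: "S (?f+1) = S ?f" using S_odd[of w] w by simp
        show ?thesis
        proof (cases "odd w")
          case True
          then have "?f mod 4 = 2" "(?f+1) mod 4 = 3" unfolding w by presburger+
          then have "1 \<le> S ?f" using IH ne(1) by (cases "b ?f < 2*j") auto
          then show ?thesis using SS by simp
        next
          case False
          then have "?f mod 4 = 0" "(?f+1) mod 4 = 1" unfolding w by presburger+
          moreover have "b (?f+1) < b ?f" using ud[OF w1] False w by auto
          moreover have "0 \<le> S ?f" using IH ne(1) by (cases "b ?f < 2*j") (auto split: if_splits)
          ultimately show ?thesis using IH(2) SS by simp
        qed
      next
        case False
        then obtain w where w: "?f = 2*w+1" by (elim oddE)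
        show ?thesis
        proof (cases "b (?f+1) < 2*j")
          case True
          then have bf: "b ?f < 2*j" using crs False ne by linarith
          have SS: "S (?f+1) = S ?f + (if even w then 1 else -1)" using S_in[of w] w True by simp
          show ?thesis
          proof (cases "even w")
            case True
            then have "?f mod 4 = 1" "(?f+1) mod 4 = 2" unfolding w by presburger+
            then show ?thesis using IH(1)[OF bf] SS True bf by auto
          next
            case False
            then have "?f mod 4 = 3" "(?f+1) mod 4 = 0" unfolding w by presburger+
            then show ?thesis using IH(1)[OF bf] SS False bf \<open>b (?f+1) < 2*j\<close> by auto
          qed
        next
          case F2: False
          then have bf: "2*j < b ?f" using crs False ne by linarith
          have SS: "S (?f+1) = S ?f" using S_out[of w] w F2 by simp
          show ?thesis using IH(2)[OF bf] SS F2 by auto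
        qed
      qed
    qed
    obtain k where "q = 2*k" using eq by blast
    then have "2*q-1 = 3 + 4*(k-1)" using q by linarith
    then have m: "(2*q-1) mod 4 = 3" by (simp only: mod_mult_self2) simp
    have t: "2*q-2+1 = 2*q-1" "2*q-1 < 2*q" using q by linarith+
    have "(if (2*q-1) mod 4 \<in> {2,3} then 1 else 0) \<le> S (2*q-1)"
      using inv[of "2*q-2"] last_low t(2) unfolding t(1) by blast
    then have pos: "1 \<le> S (2*q-1)" unfolding m by simp
    \<comment> \<open>The same weights summed in the order of the values; half position and half value have
      the same parity.\<close>
    have "S (2*q-1) = (\<Sum>i\<in>{v<..<j}. if odd i then 1 else -1)"
      unfolding S_def
    proof (rule sum.reindex_bij_witness[of _ "\<lambda>i. g (2*i) div 2" "\<lambda>u. b (2*u) div 2"])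
      fix a assume a: "a \<in> {u. 1 \<le> u \<and> 2*u \<le> 2*q-1 \<and> b (2*u) < 2*j}"
      then have a1: "1 \<le> a" "a \<le> n" "2*a < 2*q" using q by auto
      then obtain i where i: "b (2*a) = 2*i" using bd[of "2*a"] by auto
      have "2*v < b (2*a)" using S1[of "2*a"] a1 by auto
      moreover have "g (2*i) = 2*a" using i bd[of "2*a"] a1 by auto
      ultimately show "g (2 * (b (2*a) div 2)) div 2 = a" "b (2*a) div 2 \<in> {v<..<j}" "(if odd (b (2*a) div 2) then 1 else -1) = (if odd a then 1 else -1 :: int)"
        using a i par[OF a1(1,2) i] by auto
    next
      fix i assume i: "i \<in> {v<..<j}"
      then have i1: "1 \<le> i" "i \<le> n" using j by auto
      then obtain a where a: "g (2*i) = 2*a" using bd[of "2*i"] by auto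
      then have "b (2*a) = 2*i" using bd[of "2*i"] i1 by auto
      moreover have "1 \<le> a" using bd[of "2*i"] i1 a by auto
      ultimately show "b (2*(g (2*i) div 2)) div 2 = i" "g (2*i) div 2 \<in> {u. 1 \<le> u \<and> 2*u \<le> 2*q-1 \<and> b (2*u) < 2*j}"
        using a X[of "2*i"] i by auto
    qed
    also have "\<dots> = 0"
    proof -
      have "(\<Sum>i\<in>{v<..<v+2*d+1}. if odd i then 1 else -1 :: int) = 0" for d
      proof (induction d)
        case 0
        have *: "{v<..<v+2*0+1} = {}" by auto
        show ?case unfolding * by simp
      next
        case (Suc d)
        have *: "{v<..<v+2*Suc d+1} = insert (v+2*d+1) (insert (v+2*d+2) {v<..<v+2*d+1})" by auto
        show ?case unfolding * using Suc ev by simp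
      qed
      moreover obtain d where "j = v+2*d+1" using j ev oj
        by (metis add.assoc dvdE even_add less_imp_add_positive oddE)
      ultimately show ?thesis by metis
    qed
    finally show False using pos by simp
  qed
  show thesis
  proof (rule that[OF q(1,2) v(2,3) eq ev q(3) v(1)])
    fix t assume "1 \<le> t" "t \<le> 2*n+1"
    then show "t < 2*q \<longleftrightarrow> 2*v < b t" using S1[of t] S2[of t] by linarith
  qed
qed

section \<open>Blocks, complements and reversals\<close>

lemma baxterI:
  assumes "\<And>j. 1 \<le> j \<Longrightarrow> j \<le> 2*n+1 \<Longrightarrow> 1 \<le> b j \<and> b j \<le> 2*n+1 \<and> g (b j) = j \<and> even (b j) = even j"
    and "\<And>j. 1 \<le> j \<Longrightarrow> j \<le> 2*n+1 \<Longrightarrow> 1 \<le> g j \<and> g j \<le> 2*n+1 \<and> b (g j) = j"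
    and "\<And>i z. 1 \<le> i \<Longrightarrow> i \<le> 2*n \<Longrightarrow> g i < z \<and> z < g (i+1) \<or> g (i+1) < z \<and> z < g i \<Longrightarrow>
      (if odd i then b z < i else i+1 < b z)"
  shows "baxter n b g"
  using assms unfolding baxter_def inverse_pair_def by blast

lemma baxter_inject:
  assumes "baxter n b g" "1 \<le> x" "x \<le> 2*n+1" "1 \<le> y" "y \<le> 2*n+1"
  shows "b x = b y \<longleftrightarrow> x = y"
  using baxter_bounds(5)[OF assms(1-3)] baxter_bounds(5)[OF assms(1,4,5)] by metis

lemma baxter_odd_neighbours:
  assumes B: "baxter n b g" and p: "1 \<le> p" "p \<le> n"
  shows "b (2*p-1) \<noteq> b (2*p+1)" "b (2*p-1) \<le> 2*n+1" "b (2*p+1) \<le> 2*n+1"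
proof -
  have r: "1 \<le> 2*p-1" "2*p-1 \<le> 2*n+1" "1 \<le> 2*p+1" "2*p+1 \<le> 2*n+1" "2*p-1 \<noteq> 2*p+1" using p by linarith+
  show "b (2*p-1) \<noteq> b (2*p+1)" using baxter_inject[OF B r(1-4)] r(5) by blast
  show "b (2*p-1) \<le> 2*n+1" "b (2*p+1) \<le> 2*n+1"
    by (rule baxter_bounds(2)[OF B r(1,2)] baxter_bounds(2)[OF B r(3,4)])+
qed

text \<open>
  Both shifts are even, so the roles of odd and even positions and values are kept.
\<close>

lemma baxter_block:
  assumes B: "baxter n b g" and le: "q + m \<le> n" "v + m \<le> n"
    and blk: "\<And>t. 1 \<le> t \<Longrightarrow> t \<le> 2*n+1 \<Longrightarrow>
      (2*q < t \<and> t \<le> 2*q+2*m+1 \<longleftrightarrow> 2*v < b t \<and> b t \<le> 2*v+2*m+1)"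
  shows "baxter m (\<lambda>t. b (t + 2*q) - 2*v) (\<lambda>i. g (i + 2*v) - 2*q)"
proof (rule baxterI)
  fix j assume j: "1 \<le> j" "j \<le> 2*m+1"
  have t: "1 \<le> j+2*q" "j+2*q \<le> 2*n+1" using j le by linarith+
  have "2*v < b (j+2*q) \<and> b (j+2*q) \<le> 2*v+2*m+1" using blk[OF t] j by linarith
  then show "1 \<le> b (j + 2*q) - 2*v \<and> b (j + 2*q) - 2*v \<le> 2*m+1 \<and> g (b (j + 2*q) - 2*v + 2*v) - 2*q = j \<and> even (b (j + 2*q) - 2*v) = even j"
    using baxter_bounds[OF B t] by auto
  have t: "1 \<le> j+2*v" "j+2*v \<le> 2*n+1" using j le by linarith+
  have "2*q < g (j+2*v) \<and> g (j+2*v) \<le> 2*q+2*m+1" using blk[of "g (j+2*v)"] baxter_bounds[OF B t] j by auto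
  then show "1 \<le> g (j + 2*v) - 2*q \<and> g (j + 2*v) - 2*q \<le> 2*m+1 \<and> b (g (j + 2*v) - 2*q + 2*q) - 2*v = j"
    using baxter_bounds[OF B t] by auto
next
  fix i z assume i: "1 \<le> i" "i \<le> 2*m"
    and z: "g (i + 2*v) - 2*q < z \<and> z < g (i + 1 + 2*v) - 2*q \<or> g (i + 1 + 2*v) - 2*q < z \<and> z < g (i + 2*v) - 2*q"
  have t: "1 \<le> i+2*v" "i+2*v \<le> 2*n" using i le by linarith+
  have "2*q < g (i+2*v)" "2*q < g (i+1+2*v)"
    using blk[of "g (i+2*v)"] baxter_bounds[OF B, of "i+2*v"] blk[of "g (i+1+2*v)"] baxter_bounds[OF B, of "i+1+2*v"] t i by auto
  then have "g (i+2*v) < z+2*q \<and> z+2*q < g (i+2*v+1) \<or> g (i+2*v+1) < z+2*q \<and> z+2*q < g (i+2*v)"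
    using z by (auto simp: algebra_simps)
  then have "if odd (i+2*v) then b (z+2*q) < i+2*v else i+2*v+1 < b (z+2*q)"
    by (rule baxter_between[OF B t])
  then show "if odd i then b (z + 2*q) - 2*v < i else i + 1 < b (z + 2*q) - 2*v"
    using i by (auto split: if_splits)
qed

lemma updown_block:
  assumes "updown c n b" "q + m \<le> n" "even (c + q) = even d"
    and "\<And>t. 1 \<le> t \<Longrightarrow> t \<le> 2*m+1 \<Longrightarrow> 2*v < b (t + 2*q)"
  shows "updown d m (\<lambda>t. b (t + 2*q) - 2*v)"
  unfolding updown_def
proof (intro allI impI)
  fix p assume p: "1 \<le> p \<and> p \<le> m"
  have *: "2*p-1+2*q = 2*(p+q)-1" "2*p+1+2*q = 2*(p+q)+1" using p by auto
  have "2*v < b (2*p-1+2*q)" "2*v < b (2*p+1+2*q)" using assms(4)[of "2*p-1"] assms(4)[of "2*p+1"] p by auto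
  then have "b (2*p-1+2*q) - 2*v < b (2*p+1+2*q) - 2*v \<longleftrightarrow> b (2*(p+q)-1) < b (2*(p+q)+1)"
    unfolding * by linarith
  also have "\<dots> \<longleftrightarrow> odd (p+q+c)"
    by (rule assms(1)[unfolded updown_def, rule_format]) (use assms(2) p in linarith)
  also have "\<dots> \<longleftrightarrow> odd (p+d)" using assms(3) by auto
  finally show "b (2*p-1+2*q) - 2*v < b (2*p+1+2*q) - 2*v \<longleftrightarrow> odd (p+d)" .
qed

text \<open>
  The complement exchanges above and below, and it turns a pair \<open>i\<close>, \<open>i + 1\<close> with \<open>i\<close> odd into such
  a pair with \<open>i\<close> even, so the two betweenness conditions are exchanged.
\<close>

lemma baxter_complement:
  assumes B: "baxter n b g"
  shows "baxter n (\<lambda>t. 2*n+2 - b t) (\<lambda>i. g (2*n+2 - i))"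
proof (rule baxterI)
  fix j assume j: "1 \<le> j" "j \<le> 2*n+1"
  have j': "1 \<le> 2*n+2-j" "2*n+2-j \<le> 2*n+1" using j by linarith+
  show "1 \<le> 2*n+2 - b j \<and> 2*n+2 - b j \<le> 2*n+1 \<and> g (2*n+2 - (2*n+2 - b j)) = j \<and> even (2*n+2 - b j) = even j"
  proof -
    have y: "1 \<le> b j" "b j \<le> 2*n+1" "g (b j) = j" "even (b j) = even j" by (rule baxter_bounds[OF B j])+
    have "2*n+2 - (2*n+2 - b j) = b j" using y by linarith
    moreover have "even (2*n+2 - b j) = even (b j)" using y(2) by (simp add: even_diff_nat)
    moreover have "1 \<le> 2*n+2 - b j \<and> 2*n+2 - b j \<le> 2*n+1" using y by linarith
    ultimately show ?thesis using y by metis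
  qed
  show "1 \<le> g (2*n+2-j) \<and> g (2*n+2-j) \<le> 2*n+1 \<and> 2*n+2 - b (g (2*n+2-j)) = j"
  proof -
    have "b (g (2*n+2-j)) = 2*n+2-j" "1 \<le> g (2*n+2-j)" "g (2*n+2-j) \<le> 2*n+1" by (rule baxter_bounds[OF B j'])+
    moreover have "2*n+2 - (2*n+2-j) = j" using j by linarith
    ultimately show ?thesis by metis
  qed
next
  fix i z assume i: "1 \<le> i" "i \<le> 2*n"
    and z: "g (2*n+2-i) < z \<and> z < g (2*n+2-(i+1)) \<or> g (2*n+2-(i+1)) < z \<and> z < g (2*n+2-i)"
  let ?k = "2*n+1-i"
  have k: "1 \<le> ?k" "?k \<le> 2*n" "2*n+2-i = ?k+1" "2*n+2-(i+1) = ?k" "odd ?k \<longleftrightarrow> even i" using i by auto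
  have "if odd ?k then b z < ?k else ?k+1 < b z"
    by (rule baxter_between[OF B k(1,2)]) (use z in \<open>unfold k(3,4), blast\<close>)
  moreover have "b z \<le> 2*n+1"
  proof -
    have kk: "?k \<le> 2*n+1" "1 \<le> ?k+1" "?k+1 \<le> 2*n+1" using i by linarith+
    have "g ?k \<le> 2*n+1" "g (?k+1) \<le> 2*n+1"
      by (rule baxter_bounds(4)[OF B k(1) kk(1)] baxter_bounds(4)[OF B kk(2,3)])+
    then have "1 \<le> z" "z \<le> 2*n+1" using z unfolding k(3,4) by linarith+
    then show ?thesis using baxter_bounds[OF B] by blast
  qed
  ultimately show "if odd i then 2*n+2 - b z < i else i+1 < 2*n+2 - b z"
    using i k(5) by (cases "odd i"; simp; linarith)
qed

lemma updown_complement: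
  assumes B: "baxter n b g" and u: "updown c n b" "even d = odd c"
  shows "updown d n (\<lambda>t. 2*n+2 - b t)"
  unfolding updown_def
proof (intro allI impI)
  fix p assume p: "1 \<le> p \<and> p \<le> n"
  have "b (2*p-1) \<noteq> b (2*p+1)" "b (2*p-1) \<le> 2*n+1" "b (2*p+1) \<le> 2*n+1"
    using baxter_odd_neighbours[OF B] p by blast+
  then have "2*n+2 - b (2*p-1) < 2*n+2 - b (2*p+1) \<longleftrightarrow> \<not> b (2*p-1) < b (2*p+1)" by linarith
  then show "2*n+2 - b (2*p-1) < 2*n+2 - b (2*p+1) \<longleftrightarrow> odd (p+d)" using u p unfolding updown_def by auto
qed

text \<open>
  Reversal exchanges ascents and descents; for odd \<open>n\<close> it moves the \<open>p\<close>-th of them to a place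
  \<open>n + 1 - p\<close> of the same parity, so that the alternation is switched.
\<close>

lemma updown_reverse:
  assumes B: "baxter n b g" and u: "updown c n b" "even d = odd c" and n: "odd n"
  shows "updown d n (\<lambda>t. b (2*n+2 - t))"
  unfolding updown_def
proof (intro allI impI)
  fix p assume p: "1 \<le> p \<and> p \<le> n"
  let ?r = "n+1-p"
  have r: "2*n+2-(2*p-1) = 2*?r+1" "2*n+2-(2*p+1) = 2*?r-1" "1 \<le> ?r \<and> ?r \<le> n" "odd ?r \<longleftrightarrow> odd p" using p n by auto
  have "b (2*?r-1) \<noteq> b (2*?r+1)"
    using baxter_odd_neighbours[OF B] r(3) by blast
  then have "b (2*?r+1) < b (2*?r-1) \<longleftrightarrow> \<not> b (2*?r-1) < b (2*?r+1)" by linarith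
  then show "b (2*n+2 - (2*p-1)) < b (2*n+2 - (2*p+1)) \<longleftrightarrow> odd (p+d)"
    using u r(3,4) unfolding r(1,2) updown_def by (metis even_add)
qed

section \<open>Decomposing and building complete Baxter permutations\<close>

text \<open>
  The complete Baxter permutations behind the snow leopard permutations of odd length.
\<close>

definition snow :: "nat \<Rightarrow> (nat \<Rightarrow> nat) \<Rightarrow> (nat \<Rightarrow> nat) \<Rightarrow> bool" where
  "snow n b g \<longleftrightarrow> odd n \<and> baxter n b g \<and> updown 0 n b \<and> updown 0 n g"

lemma snow_skew_split:
  assumes S: "snow n b g" and b1: "b 1 \<noteq> 1"
  obtains n1 n2 b1 g1 b2 g2 where "n = n1 + n2 + 1" "snow n1 b1 g1" "snow n2 b2 g2" "b1 1 = 1"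
    "\<And>t. 1 \<le> t \<Longrightarrow> t \<le> 2*n1+1 \<Longrightarrow> b t = b1 t + 2*n2 + 2"
    "b (2*n1+2) = 2*n2+2"
    "\<And>t. 1 \<le> t \<Longrightarrow> t \<le> 2*n2+1 \<Longrightarrow> b (t + 2*n1+2) = b2 t"
proof -
  have B: "baxter n b g" and u: "updown 0 n b" "updown 0 n g" and n: "odd n" using S unfolding snow_def by auto
  obtain q v where q: "1 \<le> q" "q \<le> n" "1 \<le> v" "v \<le> n" "even q" "even v" "b (2*q) = 2*v" "b 1 = 2*v+1"
    and sp: "\<And>t. 1 \<le> t \<Longrightarrow> t \<le> 2*n+1 \<Longrightarrow> t < 2*q \<longleftrightarrow> 2*v < b t"
    using baxter_skew_split[OF B u b1] by metis
  have gq: "g (2*v) = 2*q" using baxter_bounds[OF B, of "2*q"] q by auto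
  have "bij_betw b {1..2*q-1} {2*v+1..2*n+1}"
  proof (rule bij_betw_byWitness[of _ g])
    show "\<forall>a\<in>{1..2*q-1}. g (b a) = a" using baxter_bounds[OF B] q by auto
    show "\<forall>a\<in>{2*v+1..2*n+1}. b (g a) = a" using baxter_bounds[OF B] q by auto
    show "b ` {1..2*q-1} \<subseteq> {2*v+1..2*n+1}"
    proof
      fix y assume "y \<in> b ` {1..2*q-1}"
      then obtain t where t: "y = b t" "1 \<le> t" "t < 2*q" by auto
      then show "y \<in> {2*v+1..2*n+1}" using sp[of t] baxter_bounds[OF B, of t] q by auto
    qed
    show "g ` {2*v+1..2*n+1} \<subseteq> {1..2*q-1}"
    proof
      fix y assume "y \<in> g ` {2*v+1..2*n+1}"
      then obtain t where t: "y = g t" "1 \<le> t" "t \<le> 2*n+1" "2*v < t" by auto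
      then show "y \<in> {1..2*q-1}" using sp[of "g t"] baxter_bounds[OF B, of t] by auto
    qed
  qed
  then have "2*q-1 = 2*n+1-2*v" using bij_betw_same_card by fastforce
  then have qv: "q + v = n + 1" using q by linarith
  define n1 where "n1 = q - 1"
  define n2 where "n2 = v - 1"
  have nn: "q = n1+1" "v = n2+1" "n = n1+n2+1" unfolding n1_def n2_def using q qv by auto
  have on: "odd n1" "odd n2" using q nn by auto
  have up: "2*0 < t \<and> t \<le> 2*0+2*n1+1 \<longleftrightarrow> 2*v < b t \<and> b t \<le> 2*v+2*n1+1" if "1 \<le> t" "t \<le> 2*n+1" for t
    using sp[OF that] nn baxter_bounds[OF B that] that by auto
  have lo: "2*q < t \<and> t \<le> 2*q+2*n2+1 \<longleftrightarrow> 2*0 < b t \<and> b t \<le> 2*0+2*n2+1" if "1 \<le> t" "t \<le> 2*n+1" for t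
  proof -
    have "b t = 2*v \<longleftrightarrow> t = 2*q" using q gq baxter_bounds[OF B that] by auto
    then show ?thesis using sp[OF that] nn baxter_bounds[OF B that] that by auto
  qed
  have le: "0 + n1 \<le> n" "v + n1 \<le> n" "q + n2 \<le> n" "0 + n2 \<le> n" using nn by auto
  have B1: "baxter n1 (\<lambda>t. b (t+2*0) - 2*v) (\<lambda>i. g (i+2*v) - 2*0)" by (rule baxter_block[OF B le(1,2) up])
  have B2: "baxter n2 (\<lambda>t. b (t+2*q) - 2*0) (\<lambda>i. g (i+2*0) - 2*q)" by (rule baxter_block[OF B le(3,4) lo])
  have b1: "2*v < b (t+2*0)" if "1 \<le> t" "t \<le> 2*n1+1" for t using up[of t] that nn by auto
  have g1: "2*0 < g (t+2*v)" if "1 \<le> t" "t \<le> 2*n1+1" for t using baxter_bounds[OF B, of "t+2*v"] that nn by auto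
  have b2: "2*0 < b (t+2*q)" if "1 \<le> t" "t \<le> 2*n2+1" for t using baxter_bounds[OF B, of "t+2*q"] that nn by auto
  have g2: "2*q < g (t+2*0)" if "1 \<le> t" "t \<le> 2*n2+1" for t
    using lo[of "g t"] baxter_bounds[OF B, of t] that nn by auto
  have U: "updown 0 n1 (\<lambda>t. b (t+2*0) - 2*v)" "updown 0 n1 (\<lambda>i. g (i+2*v) - 2*0)"
    "updown 0 n2 (\<lambda>t. b (t+2*q) - 2*0)" "updown 0 n2 (\<lambda>i. g (i+2*0) - 2*q)"
    by (rule updown_block[OF u(1) le(1) _ b1] updown_block[OF u(2) le(2) _ g1]
        updown_block[OF u(1) le(3) _ b2] updown_block[OF u(2) le(4) _ g2]; use q in simp)+
  show thesis
  proof (rule that[of n1 n2])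
    show "snow n1 (\<lambda>t. b (t+2*0) - 2*v) (\<lambda>i. g (i+2*v) - 2*0)" unfolding snow_def using on B1 U by blast
    show "snow n2 (\<lambda>t. b (t+2*q) - 2*0) (\<lambda>i. g (i+2*0) - 2*q)" unfolding snow_def using on B2 U by blast
    show "b (1+2*0) - 2*v = 1" using q by simp
    show "b t = b (t+2*0) - 2*v + 2*n2 + 2" if "1 \<le> t" "t \<le> 2*n1+1" for t using b1[OF that] nn by simp
    show "b (2*n1+2) = 2*n2+2" using q nn by simp
    show "b (t + 2*n1 + 2) = b (t+2*q) - 2*0" for t using nn by (simp add: algebra_simps)
  qed (use nn in simp)
qed

lemma snow_reverse_complement:
  assumes "snow n b g"
  shows "snow n (\<lambda>t. 2*n+2 - b (2*n+2 - t)) (\<lambda>i. 2*n+2 - g (2*n+2 - i))"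
proof -
  have B: "baxter n b g" and u: "updown 0 n b" "updown 0 n g" and n: "odd n" using assms unfolding snow_def by auto
  have B1: "baxter n (\<lambda>t. 2*n+2 - b t) (\<lambda>i. g (2*n+2 - i))" by (rule baxter_complement[OF B])
  have B2: "baxter n (\<lambda>i. 2*n+2 - g (2*n+2 - i)) (\<lambda>t. 2*n+2 - b (2*n+2 - t))"
    using baxter_complement[OF baxter_inverse[OF B1]] .
  have "updown 1 n (\<lambda>t. 2*n+2 - b t)" by (rule updown_complement[OF B u(1)]) simp
  then have "updown 0 n (\<lambda>t. 2*n+2 - b (2*n+2 - t))" by (rule updown_reverse[OF B1]) (use n in auto)
  moreover have "updown 1 n (\<lambda>t. 2*n+2 - g t)" by (rule updown_complement[OF baxter_inverse[OF B] u(2)]) simp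
  then have "updown 0 n (\<lambda>t. 2*n+2 - g (2*n+2 - t))"
    by (rule updown_reverse[OF baxter_complement[OF baxter_inverse[OF B]]]) (use n in auto)
  ultimately show ?thesis unfolding snow_def using n baxter_inverse[OF B2] by blast
qed

text \<open>
  After rotation by 180 degrees the claim is that the permutation begins with 1. Otherwise it would
  be a skew sum, and its smallest entry would not come first.
\<close>

lemma snow_last_maximum:
  assumes S: "snow n b g" and b1: "b 1 = 1"
  shows "b (2*n+1) = 2*n+1"
proof -
  have B: "baxter n b g" using S unfolding snow_def by auto
  let ?r = "\<lambda>t. 2*n+2 - b (2*n+2 - t)" let ?s = "\<lambda>i. 2*n+2 - g (2*n+2 - i)"
  have R: "baxter n ?r ?s" "updown 0 n ?r" "updown 0 n ?s"
    using snow_reverse_complement[OF S] unfolding snow_def by auto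
  have "?r 1 = 1"
  proof (rule ccontr)
    assume "?r 1 \<noteq> 1"
    from baxter_skew_split[OF R this] obtain q v where q: "q \<le> n" "v \<le> n"
      and sp: "\<And>t. 1 \<le> t \<Longrightarrow> t \<le> 2*n+1 \<Longrightarrow> t < 2*q \<longleftrightarrow> 2*v < ?r t" by metis
    show False using sp[of "2*n+1"] b1 q by auto
  qed
  then show ?thesis using baxter_bounds[OF B, of "2*n+1"] by simp
qed

text \<open>
  Nothing fits between the first entry 1 and its neighbour, which must therefore be 2, and likewise
  at the end. What is left in the middle starts with a descent, hence the complement.
\<close>

lemma snow_frame_split:
  assumes S: "snow n b g" and b1: "b 1 = 1" and n1: "n \<noteq> 1"
  obtains m b1 g1 where "n = m + 2" "snow m b1 g1" "b 2 = 2" "b (2*n) = 2*n"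
    "\<And>t. 1 \<le> t \<Longrightarrow> t \<le> 2*m+1 \<Longrightarrow> b (t+2) = 2*m+4 - b1 t"
proof -
  have B: "baxter n b g" and u: "updown 0 n b" "updown 0 n g" and n: "odd n" using S unfolding snow_def by auto
  have bl: "b (2*n+1) = 2*n+1" by (rule snow_last_maximum[OF S b1])
  define m where "m = n - 2"
  have "n \<noteq> 0" "n \<noteq> 2" using n even_zero even_numeral by metis+
  then have m: "n = m + 2" "odd m" using n n1 unfolding m_def by auto
  have D: "baxter n g b" by (rule baxter_inverse[OF B])
  have g1: "g 1 = 1" "g (2*n+1) = 2*n+1" using baxter_bounds[OF B, of 1] baxter_bounds[OF B, of "2*n+1"] b1 bl by auto
  have b2: "b 2 = 2"
  proof (rule ccontr)
    assume a: "b 2 \<noteq> 2"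
    have "b 2 \<noteq> 1" using baxter_bounds[OF B, of 2] m g1 by auto
    moreover have "1 \<le> b 2" using baxter_bounds(1)[OF B, of 2] m by simp
    ultimately have "b 1 < 2 \<and> 2 < b (1+1)" using a b1 unfolding one_add_one by linarith
    from baxter_between[OF D, of 1 2] this have "g 2 < 1" using m by auto
    then show False using baxter_bounds[OF B, of 2] m by auto
  qed
  have bn: "b (2*n) = 2*n"
  proof (rule ccontr)
    assume a: "b (2*n) \<noteq> 2*n"
    have "b (2*n) \<noteq> 2*n+1" using baxter_bounds[OF B, of "2*n"] m g1 by auto
    moreover have bb: "b (2*n) \<le> 2*n+1" using baxter_bounds(2)[OF B, of "2*n"] m by simp
    ultimately have "b (2*n) < 2*n \<and> 2*n < b (2*n+1)" using a bl by linarith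
    from baxter_between[OF D, of "2*n" "2*n"] this have "2*n+1 < g (2*n)" using m by auto
    then show False using baxter_bounds[OF B, of "2*n"] m by auto
  qed
  have g2: "g 2 = 2" "g (2*n) = 2*n" using baxter_bounds[OF B, of 2] baxter_bounds[OF B, of "2*n"] b2 bn m by auto
  have blk: "2*1 < t \<and> t \<le> 2*1+2*m+1 \<longleftrightarrow> 2*1 < b t \<and> b t \<le> 2*1+2*m+1" if t: "1 \<le> t" "t \<le> 2*n+1" for t
  proof -
    have "b t = 1 \<longleftrightarrow> t = 1" "b t = 2 \<longleftrightarrow> t = 2" "b t = 2*n \<longleftrightarrow> t = 2*n" "b t = 2*n+1 \<longleftrightarrow> t = 2*n+1"
      using baxter_bounds[OF B t] g1 g2 b1 b2 bl bn by auto
    moreover have "2*1 < x \<and> x \<le> 2*1+2*m+1 \<longleftrightarrow> x \<noteq> 1 \<and> x \<noteq> 2 \<and> x \<noteq> 2*n \<and> x \<noteq> 2*n+1" if "1 \<le> x" "x \<le> 2*n+1" for x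
      using that m(1) by presburger
    ultimately show ?thesis using t baxter_bounds[OF B t] by metis
  qed
  have le: "1 + m \<le> n" using m by simp
  have M: "baxter m (\<lambda>t. b (t+2*1) - 2*1) (\<lambda>i. g (i+2*1) - 2*1)" by (rule baxter_block[OF B le le blk])
  have bb: "2*1 < b (t+2*1)" if "1 \<le> t" "t \<le> 2*m+1" for t using blk[of "t+2"] that m by auto
  have gg: "2*1 < g (t+2*1)" if "1 \<le> t" "t \<le> 2*m+1" for t
    using blk[of "g (t+2)"] baxter_bounds[OF B, of "t+2"] that m by auto
  have MU: "updown 1 m (\<lambda>t. b (t+2*1) - 2*1)" "updown 1 m (\<lambda>i. g (i+2*1) - 2*1)"
    by (rule updown_block[OF u(1) le _ bb] updown_block[OF u(2) le _ gg]; simp)+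
  have C: "baxter m (\<lambda>t. 2*m+2 - (b (t+2*1) - 2*1)) (\<lambda>i. g (2*m+2-i+2*1) - 2*1)"
    by (rule baxter_complement[OF M])
  have U: "updown 0 m (\<lambda>t. 2*m+2 - (b (t+2*1) - 2*1))" by (rule updown_complement[OF M MU(1)]) simp
  have U': "updown 0 m (\<lambda>i. g (2*m+2-i+2*1) - 2*1)"
    by (rule updown_reverse[OF baxter_inverse[OF M] MU(2)]) (use m in auto)
  show thesis
  proof (rule that[of m])
    show "snow m (\<lambda>t. 2*m+2 - (b (t+2*1) - 2*1)) (\<lambda>i. g (2*m+2-i+2*1) - 2*1)"
      unfolding snow_def using m C U U' by blast
    show "b (t+2) = 2*m+4 - (2*m+2 - (b (t+2*1) - 2*1))" if "1 \<le> t" "t \<le> 2*m+1" for t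
      using bb[OF that] blk[of "t+2"] that m by auto
  qed (use m b2 bn in auto)
qed

lemma snow_one: "snow 1 (\<lambda>t. t) (\<lambda>t. t)"
proof -
  have "baxter 1 (\<lambda>t. t) (\<lambda>t. t)" by (rule baxterI) auto
  moreover have "updown 0 1 (\<lambda>t. t)" unfolding updown_def by (auto simp: le_Suc_eq)
  ultimately show ?thesis unfolding snow_def by simp
qed

lemma snow_skew:
  assumes S1: "snow n1 b1 g1" and S2: "snow n2 b2 g2"
  obtains b g where "snow (n1 + n2 + 1) b g"
    "\<And>t. 1 \<le> t \<Longrightarrow> t \<le> 2*n1+1 \<Longrightarrow> b t = b1 t + 2*n2 + 2"
    "b (2*n1+2) = 2*n2+2"
    "\<And>t. 1 \<le> t \<Longrightarrow> t \<le> 2*n2+1 \<Longrightarrow> b (t + 2*n1+2) = b2 t"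
proof -
  have B1: "baxter n1 b1 g1" "updown 0 n1 b1" "updown 0 n1 g1" "odd n1" using S1 unfolding snow_def by auto
  have B2: "baxter n2 b2 g2" "updown 0 n2 b2" "updown 0 n2 g2" "odd n2" using S2 unfolding snow_def by auto
  \<comment> \<open>The same formula with exchanged blocks gives the inverse permutation.\<close>
  define skew where "skew n1 n2 b1 b2 t = (if t < 2*n1+2 then b1 t + (2*n2+2) else if t = 2*n1+2 then 2*n2+2 else b2 (t - (2*n1+2)))"
    for n1 n2 :: nat and b1 b2 :: "nat \<Rightarrow> nat" and t :: nat
  have lo: "skew n1 n2 b1 b2 t = b1 t + (2*n2+2)" if "t < 2*n1+2" for n1 n2 b1 b2 t using that unfolding skew_def by simp
  have mid: "skew n1 n2 b1 b2 (2*n1+2) = 2*n2+2" for n1 n2 b1 b2 unfolding skew_def by simp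
  have hi: "skew n1 n2 b1 b2 (t + (2*n1+2)) = b2 t" if "1 \<le> t" for n1 n2 b1 b2 t using that unfolding skew_def by simp
  have bd1: "\<And>j. 1 \<le> j \<Longrightarrow> j \<le> 2*n1+1 \<Longrightarrow>
      1 \<le> b1 j \<and> b1 j \<le> 2*n1+1 \<and> 1 \<le> g1 j \<and> g1 j \<le> 2*n1+1 \<and>
      g1 (b1 j) = j \<and> b1 (g1 j) = j \<and> even (b1 j) = even j \<and> even (g1 j) = even j"
    by (rule baxter_bounds_conj[OF B1(1)])
  have bd2: "\<And>j. 1 \<le> j \<Longrightarrow> j \<le> 2*n2+1 \<Longrightarrow>
      1 \<le> b2 j \<and> b2 j \<le> 2*n2+1 \<and> 1 \<le> g2 j \<and> g2 j \<le> 2*n2+1 \<and>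
      g2 (b2 j) = j \<and> b2 (g2 j) = j \<and> even (b2 j) = even j \<and> even (g2 j) = even j"
    by (rule baxter_bounds_conj[OF B2(1)])
  let ?b = "skew n1 n2 b1 b2" and ?g = "skew n2 n1 g2 g1" and ?n = "n1 + n2 + 1"
  have cs: "(t < 2*n1+2 \<and> t \<le> 2*n1+1) \<or> t = 2*n1+2 \<or> (\<exists>s. t = s + (2*n1+2) \<and> 1 \<le> s \<and> s \<le> 2*n2+1)"
    if "1 \<le> t" "t \<le> 2*(n1+n2+1)+1" for t n1 n2 :: nat
  proof (cases "2*n1+2 < t")
    case True
    then have "t = (t - (2*n1+2)) + (2*n1+2)" "1 \<le> t - (2*n1+2)" "t - (2*n1+2) \<le> 2*n2+1" using that by arith+
    then show ?thesis by blast
  next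
    case False
    then have "(t < 2*n1+2 \<and> t \<le> 2*n1+1) \<or> t = 2*n1+2" by linarith
    then show ?thesis by blast
  qed
  have "baxter ?n ?b ?g"
  proof (rule baxterI)
    fix j assume j: "1 \<le> j" "j \<le> 2 * ?n + 1"
    from cs[OF j] show "1 \<le> ?b j \<and> ?b j \<le> 2 * ?n + 1 \<and> ?g (?b j) = j \<and> even (?b j) = even j"
    proof (elim disjE exE conjE)
      assume a: "j < 2*n1+2" "j \<le> 2*n1+1"
      have f: "1 \<le> b1 j" "b1 j \<le> 2*n1+1" "g1 (b1 j) = j" "even (b1 j) = even j" using bd1[OF j(1) a(2)] by blast+
      show ?thesis unfolding lo[OF a(1)] hi[OF f(1)] using f by simp
    next
      assume a: "j = 2*n1+2"
      show ?thesis unfolding a mid by simp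
    next
      fix s assume a: "j = s + (2*n1+2)" "1 \<le> s" "s \<le> 2*n2+1"
      have f: "1 \<le> b2 s" "b2 s \<le> 2*n2+1" "b2 s < 2*n2+2" "g2 (b2 s) = s" "even (b2 s) = even s" using bd2[OF a(2,3)] by auto
      show ?thesis unfolding a(1) hi[OF a(2)] lo[OF f(3)] using f by simp
    qed
    have j': "j \<le> 2*(n2+n1+1)+1" using j by simp
    from cs[OF j(1) j'] show "1 \<le> ?g j \<and> ?g j \<le> 2 * ?n + 1 \<and> ?b (?g j) = j"
    proof (elim disjE exE conjE)
      assume a: "j < 2*n2+2" "j \<le> 2*n2+1"
      have f: "1 \<le> g2 j" "g2 j \<le> 2*n2+1" "b2 (g2 j) = j" using bd2[OF j(1) a(2)] by blast+
      show ?thesis unfolding lo[OF a(1)] hi[OF f(1)] using f by simp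
    next
      assume a: "j = 2*n2+2"
      show ?thesis unfolding a mid by simp
    next
      fix s assume a: "j = s + (2*n2+2)" "1 \<le> s" "s \<le> 2*n1+1"
      have f: "1 \<le> g1 s" "g1 s \<le> 2*n1+1" "g1 s < 2*n1+2" "b1 (g1 s) = s" using bd1[OF a(2,3)] by auto
      show ?thesis unfolding a(1) hi[OF a(2)] lo[OF f(3)] using f by simp
    qed
  next
    fix i z assume i: "1 \<le> i" "i \<le> 2 * ?n" and z: "?g i < z \<and> z < ?g (i+1) \<or> ?g (i+1) < z \<and> z < ?g i"
    consider "i \<le> 2*n2" | "i = 2*n2+1" | "i = 2*n2+2" | s where "i = s + (2*n2+2)" "1 \<le> s" "s \<le> 2*n1"
    proof (cases "2*n2+2 < i")
      case True
      then have "i = (i - (2*n2+2)) + (2*n2+2)" "1 \<le> i - (2*n2+2)" "i - (2*n2+2) \<le> 2*n1" using i by arith+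
      then show ?thesis using that(4) by blast
    next
      case False
      then show ?thesis using that(1-3) by linarith
    qed
    then show "if odd i then ?b z < i else i+1 < ?b z"
    proof cases
      case 1
      have e: "?g i = g2 i + (2*n1+2)" "?g (i+1) = g2 (i+1) + (2*n1+2)" using lo 1 by auto
      define w where "w = z - (2*n1+2)"
      have w: "z = w + (2*n1+2)" using z unfolding e w_def by linarith
      have w2: "g2 i < w \<and> w < g2 (i+1) \<or> g2 (i+1) < w \<and> w < g2 i" using z unfolding e w by linarith
      have bz: "?b z = b2 w" unfolding w by (rule hi) (use w2 in linarith)
      show ?thesis unfolding bz by (rule baxter_between[OF B2(1) i(1) 1 w2])
    next
      case 2
      have e: "?g i = g2 (2*n2+1) + (2*n1+2)" "?g (i+1) = 2*n1+2" using lo[of "2*n2+1" n2 n1 g2 g1] mid[of n2 n1 g2 g1] 2 by auto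
      then have z2: "2*n1+2 < z" "z < g2 (2*n2+1) + (2*n1+2)" using z by auto
      define w where "w = z - (2*n1+2)"
      have w: "z = w + (2*n1+2)" "1 \<le> w" "w < g2 (2*n2+1)" using z2 unfolding w_def by auto
      have g: "g2 (2*n2+1) \<le> 2*n2+1" "b2 (g2 (2*n2+1)) = 2*n2+1" using bd2[of "2*n2+1"] by auto
      have "w \<le> 2*n2+1" using w g by linarith
      then have bw: "b2 w \<le> 2*n2+1" "g2 (b2 w) = w" using bd2[of w] w(2) by auto
      have "b2 w \<noteq> 2*n2+1" using bw w by auto
      moreover have "?b z = b2 w" unfolding w(1) by (rule hi[OF w(2)])
      ultimately show ?thesis using 2 bw by simp
    next
      case 3
      have e: "?g i = 2*n1+2" "?g (i+1) = g1 1" using mid[of n2 n1 g2 g1] hi[of 1 n2 n1 g2 g1] 3 by (auto simp: add_ac)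
      have g: "1 \<le> g1 1" "g1 1 \<le> 2*n1+1" "b1 (g1 1) = 1" using bd1[of 1] by auto
      then have z2: "g1 1 < z" "z < 2*n1+2" using z unfolding e by linarith+
      have "1 \<le> b1 z" "g1 (b1 z) = z" using bd1[of z] z2 g by auto
      then have "b1 z \<noteq> 1" using z2 by auto
      moreover have "?b z = b1 z + (2*n2+2)" by (rule lo[OF z2(2)])
      ultimately show ?thesis using 3 \<open>1 \<le> b1 z\<close> by simp
    next
      case 4
      have s1: "i + 1 = (s+1) + (2*n2+2)" using 4 by simp
      have e: "?g i = g1 s" "?g (i+1) = g1 (s+1)" unfolding s1 unfolding 4(1) by (rule hi, use 4 in simp)+
      have "g1 s \<le> 2*n1+1" "g1 (s+1) \<le> 2*n1+1" using bd1[of s] bd1[of "s+1"] 4 by auto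
      then have z3: "z < 2*n1+2" using z unfolding e by linarith
      have "?b z = b1 z + (2*n2+2)" by (rule lo[OF z3])
      then show ?thesis using baxter_between[OF B1(1) 4(2,3) z[unfolded e]] 4 by (auto split: if_splits)
    qed
  qed
  moreover have ud: "updown 0 (n1+n2+1) (skew n1 n2 b1 b2)"
    if B1: "baxter n1 b1 g1" "updown 0 n1 b1" "odd n1" and B2: "baxter n2 b2 g2" "updown 0 n2 b2" "odd n2" for n1 n2 b1 b2 g1 g2
    unfolding updown_def
  proof (intro allI impI)
    fix p assume p: "1 \<le> p \<and> p \<le> n1+n2+1"
    consider "p \<le> n1" | "p = n1+1" | s where "p = s + (n1+1)" "1 \<le> s" "s \<le> n2"
    proof (cases "n1+1 < p")
      case True
      then have "p = (p - (n1+1)) + (n1+1)" "1 \<le> p - (n1+1)" "p - (n1+1) \<le> n2" using p by linarith+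
      then show ?thesis using that(3) by blast
    next
      case False
      then show ?thesis using that(1,2) by linarith
    qed
    then show "skew n1 n2 b1 b2 (2*p-1) < skew n1 n2 b1 b2 (2*p+1) \<longleftrightarrow> odd (p+0)"
    proof cases
      case 1
      have "2*p-1 < 2*n1+2" "2*p+1 < 2*n1+2" using 1 by linarith+
      then show ?thesis using B1(2) p 1 unfolding updown_def by (simp add: lo)
    next
      case 2
      have "2*p-1 < 2*n1+2" "2*p+1 = 1 + (2*n1+2)" using 2 by linarith+
      then have e: "skew n1 n2 b1 b2 (2*p-1) = b1 (2*p-1) + (2*n2+2)" "skew n1 n2 b1 b2 (2*p+1) = b2 1"
        using lo hi[of 1 n1 n2 b1 b2] by auto
      have "b2 1 \<le> 2*n2+1" using baxter_bounds(2)[OF B2(1), of 1] by simp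
      then show ?thesis unfolding e using 2 B1(3) by simp
    next
      case 3
      have a: "2*p-1 = (2*s-1) + (2*n1+2)" "2*p+1 = (2*s+1) + (2*n1+2)" "1 \<le> 2*s-1" "1 \<le> 2*s+1" using 3 by linarith+
      have "odd (p+0) \<longleftrightarrow> odd (s+0)" using 3 B1(3) by simp
      then show ?thesis unfolding a(1,2) hi[OF a(3)] hi[OF a(4)] using B2(2) 3 unfolding updown_def by simp
    qed
  qed
  have "updown 0 ?n ?b" by (rule ud[OF B1(1,2,4) B2(1,2,4)])
  moreover have "updown 0 ?n ?g"
    using ud[OF baxter_inverse[OF B2(1)] B2(3,4) baxter_inverse[OF B1(1)] B1(3,4)] by (simp add: add_ac)
  ultimately have "snow ?n ?b ?g" unfolding snow_def using B1(4) B2(4) by simp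
  then show thesis
  proof (rule that)
    show "?b t = b1 t + 2*n2 + 2" if "t \<le> 2*n1+1" for t using lo[of t n1 n2 b1 b2] that by simp
    show "?b (2*n1+2) = 2*n2+2" by (rule mid)
    show "?b (t + 2*n1+2) = b2 t" if "1 \<le> t" for t using hi[OF that, of n1 n2 b1 b2] by (simp add: add_ac)
  qed
qed

lemma snow_frame:
  assumes S: "snow m b1 g1"
  obtains b g where "snow (m + 2) b g" "b 2 = 2" "b (2*(m+2)) = 2*(m+2)"
    "\<And>t. 1 \<le> t \<Longrightarrow> t \<le> 2*m+1 \<Longrightarrow> b (t+2) = 2*m+4 - b1 t"
proof -
  have B1: "baxter m b1 g1" "updown 0 m b1" "updown 0 m g1" and om: "odd m" using S unfolding snow_def by auto
  define c where "c t = 2*m+2 - b1 t" for t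
  define d where "d i = g1 (2*m+2-i)" for i
  have C: "baxter m c d" using baxter_complement[OF B1(1)] unfolding c_def d_def .
  have U: "updown 1 m c" unfolding c_def by (rule updown_complement[OF B1(1,2)]) simp
  have U': "updown 1 m d" unfolding d_def by (rule updown_reverse[OF baxter_inverse[OF B1(1)] B1(3) _ om]) simp
  \<comment> \<open>The frame consists of two fixed points at either end.\<close>
  define fr where "fr f t = (if 2 < t \<and> t < 2*m+4 then f (t-2) + 2 else t)" for f and t :: nat
  have inn: "fr f (t+2) = f t + 2" if "1 \<le> t" "t \<le> 2*m+1" for f t using that unfolding fr_def by simp
  have out: "fr f t = t" if "t \<le> 2 \<or> 2*m+4 \<le> t" for f t using that unfolding fr_def by auto
  have bd: "\<And>j. 1 \<le> j \<Longrightarrow> j \<le> 2*m+1 \<Longrightarrow>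
      1 \<le> c j \<and> c j \<le> 2*m+1 \<and> 1 \<le> d j \<and> d j \<le> 2*m+1 \<and>
      d (c j) = j \<and> c (d j) = j \<and> even (c j) = even j \<and> even (d j) = even j"
    by (rule baxter_bounds_conj[OF C])
  have cs: "t \<le> 2 \<or> 2*m+4 \<le> t \<or> (\<exists>s. t = s+2 \<and> 1 \<le> s \<and> s \<le> 2*m+1)" for t :: nat
    by presburger
  have "baxter (m+2) (fr c) (fr d)"
  proof (rule baxterI)
    have *: "1 \<le> fr c j \<and> fr c j \<le> 2 * (m+2) + 1 \<and> fr d (fr c j) = j \<and> even (fr c j) = even j"
      if j: "1 \<le> j" "j \<le> 2 * (m+2) + 1"
        and bd: "\<And>j. 1 \<le> j \<Longrightarrow> j \<le> 2*m+1 \<Longrightarrow> 1 \<le> c j \<and> c j \<le> 2*m+1 \<and> d (c j) = j \<and> even (c j) = even j" for j c d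
    proof (cases "j \<le> 2 \<or> 2*m+4 \<le> j")
      case True
      then show ?thesis using j out by simp
    next
      case False
      then obtain s where s: "j = s+2" "1 \<le> s" "s \<le> 2*m+1" using cs by blast
      have f: "1 \<le> c s" "c s \<le> 2*m+1" "d (c s) = s" "even (c s) = even s" using bd[OF s(2,3)] by blast+
      show ?thesis unfolding s(1) inn[OF s(2,3)] inn[OF f(1,2)] using f by simp
    qed
    show "1 \<le> fr c j \<and> fr c j \<le> 2 * (m+2) + 1 \<and> fr d (fr c j) = j \<and> even (fr c j) = even j"
      if j: "1 \<le> j" "j \<le> 2 * (m+2) + 1" for j by (rule *[OF j]) (use bd in blast)
    have "1 \<le> fr d j \<and> fr d j \<le> 2 * (m+2) + 1 \<and> fr c (fr d j) = j \<and> even (fr d j) = even j"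
      if j: "1 \<le> j" "j \<le> 2 * (m+2) + 1" for j by (rule *[OF j]) (use bd in blast)
    then show "1 \<le> fr d j \<and> fr d j \<le> 2 * (m+2) + 1 \<and> fr c (fr d j) = j"
      if j: "1 \<le> j" "j \<le> 2 * (m+2) + 1" for j using j by blast
  next
    fix i z assume i: "1 \<le> i" "i \<le> 2 * (m+2)" and z: "fr d i < z \<and> z < fr d (i+1) \<or> fr d (i+1) < z \<and> z < fr d i"
    consider "i = 1" | "i = 2" | s where "i = s+2" "1 \<le> s" "s \<le> 2*m" | "i = 2*m+3" | "i = 2*m+4"
    proof -
      have "i = 1 \<or> i = 2 \<or> (\<exists>s. i = s+2 \<and> 1 \<le> s \<and> s \<le> 2*m) \<or> i = 2*m+3 \<or> i = 2*m+4" using i by presburger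
      then show ?thesis using that by blast
    qed
    then show "if odd i then fr c z < i else i+1 < fr c z"
    proof cases
      case 1
      then have "fr d i = 1" "fr d (i+1) = 2" using out by auto
      then show ?thesis using z by linarith
    next
      case 2
      have e: "fr d i = 2" "fr d (i+1) = d 1 + 2" using 2 out[of 2 d] inn[of 1 d] by (auto simp: numeral_eq_Suc)
      have g: "1 \<le> d 1" "d 1 \<le> 2*m+1" "c (d 1) = 1" using bd[of 1] by auto
      define w where "w = z - 2"
      have w: "z = w + 2" "1 \<le> w" "w < d 1" "w \<le> 2*m+1" using z g unfolding e w_def by auto
      have f: "1 \<le> c w" "d (c w) = w" using bd[OF w(2,4)] by blast+
      then have "c w \<noteq> 1" using w by auto
      then show ?thesis unfolding w(1) inn[OF w(2,4)] using 2 f by simp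
    next
      case 3
      have s1: "i + 1 = (s+1)+2" using 3 by simp
      have e: "fr d i = d s + 2" "fr d (i+1) = d (s+1) + 2" unfolding s1 unfolding 3(1) by (rule inn; use 3 in simp)+
      have g: "d s \<le> 2*m+1" "d (s+1) \<le> 2*m+1" using bd[of s] bd[of "s+1"] 3 by auto
      define w where "w = z - 2"
      have w: "z = w + 2" "d s < w \<and> w < d (s+1) \<or> d (s+1) < w \<and> w < d s" using z unfolding e w_def by auto
      have w1: "1 \<le> w" "w \<le> 2*m+1" using w(2) g by linarith+
      show ?thesis unfolding w(1) inn[OF w1] using baxter_between[OF C 3(2,3) w(2)] 3 by (auto split: if_splits)
    next
      case 4
      have e: "fr d (i+1) = 2*m+4" "fr d i = d (2*m+1) + 2" using 4 out[of "2*m+4" d] inn[of "2*m+1" d] by (auto simp: numeral_eq_Suc)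
      have g: "1 \<le> d (2*m+1)" "d (2*m+1) \<le> 2*m+1" "c (d (2*m+1)) = 2*m+1" using bd[of "2*m+1"] by auto
      define w where "w = z - 2"
      have w: "z = w + 2" "1 \<le> w" "d (2*m+1) < w" "w \<le> 2*m+1" using z g unfolding e w_def by auto
      have f: "c w \<le> 2*m+1" "d (c w) = w" using bd[OF w(2,4)] by blast+
      then have "c w \<noteq> 2*m+1" using w by auto
      then show ?thesis unfolding w(1) inn[OF w(2,4)] using 4 f by simp
    next
      case 5
      then have "fr d i = 2*m+4" "fr d (i+1) = 2*m+5" using out[of i d] out[of "i+1" d] by auto
      then show ?thesis using z by linarith
    qed
  qed
  moreover have ud: "updown 0 (m+2) (fr c)" if C: "baxter m c d" and U: "updown 1 m c" for c d
    unfolding updown_def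
  proof (intro allI impI)
    fix p assume p: "1 \<le> p \<and> p \<le> m+2"
    have bd: "\<And>j. 1 \<le> j \<Longrightarrow> j \<le> 2*m+1 \<Longrightarrow> 1 \<le> c j \<and> c j \<le> 2*m+1" using baxter_bounds[OF C] by blast
    consider "p = 1" | "p = m+2" | s where "p = s+1" "1 \<le> s" "s \<le> m"
    proof -
      have "p = 1 \<or> p = m+2 \<or> (\<exists>s. p = s+1 \<and> 1 \<le> s \<and> s \<le> m)" using p by presburger
      then show ?thesis using that by blast
    qed
    then show "fr c (2*p-1) < fr c (2*p+1) \<longleftrightarrow> odd (p+0)"
    proof cases
      case 1
      then have "fr c (2*p-1) = 1" "fr c (2*p+1) = c 1 + 2" using out[of 1 c] inn[of 1 c] by (auto simp: numeral_eq_Suc)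
      then show ?thesis using 1 by simp
    next
      case 2
      have a: "2*p-1 = (2*m+1)+2" "2*p+1 = 2*m+5" using 2 by linarith+
      have "fr c (2*p-1) = c (2*m+1) + 2" unfolding a by (rule inn) simp_all
      moreover have "fr c (2*p+1) = 2*m+5" unfolding a by (rule out) simp
      ultimately show ?thesis using 2 bd[of "2*m+1"] om by simp
    next
      case 3
      have a: "2*p-1 = (2*s-1)+2" "2*p+1 = (2*s+1)+2" "1 \<le> 2*s-1" "2*s-1 \<le> 2*m+1" "1 \<le> 2*s+1" "2*s+1 \<le> 2*m+1" using 3 by linarith+
      have "c (2*s-1) < c (2*s+1) \<longleftrightarrow> odd (s+1)"
        by (rule U[unfolded updown_def, rule_format]) (use 3 in blast)
      then show ?thesis unfolding a(1,2) inn[OF a(3,4)] inn[OF a(5,6)] using 3 by simp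
    qed
  qed
  ultimately have "snow (m+2) (fr c) (fr d)"
    unfolding snow_def using om ud[OF C U] ud[OF baxter_inverse[OF C] U'] by simp
  then show thesis
  proof (rule that)
    show "fr c 2 = 2" "fr c (2*(m+2)) = 2*(m+2)" by (rule out, simp)+
    show "fr c (t+2) = 2*m+4 - b1 t" if t: "1 \<le> t" "t \<le> 2*m+1" for t
      unfolding inn[OF t] c_def using baxter_bounds(2)[OF B1(1) t] by simp
  qed
qed

section \<open>From complete Baxter permutations to snow leopard permutations\<close>

text \<open>
  The permutations induced on the even and on the odd entries, written without
  standardization: the even entries are \<open>2, 4, \<dots>, 2n\<close> and the odd ones \<open>1, 3, \<dots>, 2n + 1\<close>.
\<close>

definition even_word :: "nat \<Rightarrow> (nat \<Rightarrow> nat) \<Rightarrow> nat list" where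
  "even_word n b = map (\<lambda>p. b (2*p) div 2) [1..<n+1]"

definition odd_word :: "nat \<Rightarrow> (nat \<Rightarrow> nat) \<Rightarrow> nat list" where
  "odd_word n b = map (\<lambda>p. (b (2*p-1) + 1) div 2) [1..<n+2]"

lemma length_even_word [simp]: "length (even_word n b) = n"
  unfolding even_word_def by simp

lemma even_word_permutation:
  assumes B: "baxter n b g"
  shows "even_word n b \<in> permutations_of_set {1..n}"
proof -
  have bij: "bij_betw (\<lambda>p. b (2*p) div 2) {1..n} {1..n}"
  proof (rule bij_betw_byWitness[of _ "\<lambda>i. g (2*i) div 2"])
    have *: "g (2 * (b (2*a) div 2)) div 2 = a \<and> b (2*a) div 2 \<in> {1..n}" if B: "baxter n b g" and a: "a \<in> {1..n}" for a b g
    proof -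
      have r: "1 \<le> 2*a" "2*a \<le> 2*n+1" using a by auto
      have f: "1 \<le> b (2*a)" "b (2*a) \<le> 2*n+1" "g (b (2*a)) = 2*a" "even (b (2*a))"
        using baxter_bounds[OF B r] by simp_all
      from f(4) obtain i where i: "b (2*a) = 2*i" by blast
      show ?thesis using f i by simp
    qed
    show "\<forall>a\<in>{1..n}. g (2 * (b (2*a) div 2)) div 2 = a" "(\<lambda>p. b (2*p) div 2) ` {1..n} \<subseteq> {1..n}"
      using *[OF B] by auto
    show "\<forall>a\<in>{1..n}. b (2 * (g (2*a) div 2)) div 2 = a" "(\<lambda>p. g (2*p) div 2) ` {1..n} \<subseteq> {1..n}"
      using *[OF baxter_inverse[OF B]] by auto
  qed
  have s: "set [1..<n+1] = {1..n}" by auto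
  show ?thesis
    unfolding permutations_of_set_def even_word_def mem_Collect_eq set_map distinct_map s
    using bij unfolding bij_betw_def by (auto simp del: upt_Suc)
qed

lemma filter_even_one_line:
  assumes "\<And>j. 1 \<le> j \<Longrightarrow> j \<le> 2*n+1 \<Longrightarrow> even (b j) = even j"
  shows "filter even (map b [1..<2*n+2]) = map (\<lambda>p. b (2*p)) [1..<n+1]"
  using assms
proof (induction n)
  case 0
  then show ?case by (simp add: upt_rec)
next
  case (Suc n)
  have *: "[1..<2*Suc n+2] = [1..<2*n+2] @ [2*n+2, 2*n+3]"
    by (simp add: numeral_eq_Suc)
  have "even (b (2*n+2))" "odd (b (2*n+3))" using Suc.prems[of "2*n+2"] Suc.prems[of "2*n+3"] by auto
  then show ?case unfolding * using Suc by simp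
qed

lemma filter_odd_one_line:
  assumes "\<And>j. 1 \<le> j \<Longrightarrow> j \<le> 2*n+1 \<Longrightarrow> even (b j) = even j"
  shows "filter odd (map b [1..<2*n+2]) = map (\<lambda>p. b (2*p-1)) [1..<n+2]"
  using assms
proof (induction n)
  case 0
  have *: "[1..<2*0+2] = [1::nat]" "[1..<0+2] = [1::nat]" by (simp_all add: upt_rec)
  have "odd (b 1)" using 0[of 1] by simp
  then show ?case unfolding * by simp
next
  case (Suc n)
  have *: "[1..<2*Suc n+2] = [1..<2*n+2] @ [2*n+2, 2*n+3]"
    by (simp add: numeral_eq_Suc)
  have **: "[1..<Suc n+2] = [1..<n+2] @ [n+2]" by simp
  have "even (b (2*n+2))" "odd (b (2*n+3))" using Suc.prems[of "2*n+2"] Suc.prems[of "2*n+3"] by auto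
  then have one: "filter odd [b (2*n+2), b (2*n+3)] = [b (2*n+3)]" by simp
  have e: "2*(n+2)-1 = 2*n+3" by simp
  have IH: "filter odd (map b [1..<2*n+2]) = map (\<lambda>p. b (2*p-1)) [1..<n+2]"
    by (rule Suc.IH) (use Suc.prems in auto)
  show ?case unfolding * ** map_append filter_append IH list.map one e ..
qed

lemma standardize_filter_even:
  assumes "set xs = {1..N}"
  shows "standardize (filter even xs) = map (\<lambda>y. y div 2) (filter even xs)"
  unfolding standardize_def
proof (rule map_cong[OF refl])
  fix y assume "y \<in> set (filter even xs)"
  then have y: "1 \<le> y" "y \<le> N" "even y" using assms by auto
  have "{z \<in> set (filter even xs). z \<le> y} = (\<lambda>k. 2*k) ` {1..y div 2}"
    using y assms by (auto elim!: evenE)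
  then show "card {z \<in> set (filter even xs). z \<le> y} = y div 2"
    by (simp add: card_image inj_on_def)
qed

lemma standardize_filter_odd:
  assumes "set xs = {1..N}"
  shows "standardize (filter odd xs) = map (\<lambda>y. (y + 1) div 2) (filter odd xs)"
  unfolding standardize_def
proof (rule map_cong[OF refl])
  fix y assume "y \<in> set (filter odd xs)"
  then have y: "1 \<le> y" "y \<le> N" "odd y" using assms by auto
  have "{z \<in> set (filter odd xs). z \<le> y} = (\<lambda>k. 2*k-1) ` {1..(y+1) div 2}"
  proof (intro set_eqI iffI)
    fix z assume "z \<in> {z \<in> set (filter odd xs). z \<le> y}"
    then have z: "odd z" "z \<le> y" by auto
    then obtain k where "z = 2*k+1" by (elim oddE)
    then show "z \<in> (\<lambda>k. 2*k-1) ` {1..(y+1) div 2}" using z y by (intro image_eqI[of _ _ "k+1"]) auto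
  next
    fix z assume "z \<in> (\<lambda>k. 2*k-1) ` {1..(y+1) div 2}"
    then obtain k where k: "z = 2*k-1" "1 \<le> k" "k \<le> (y+1) div 2" by auto
    then have "odd z" "1 \<le> z" by auto
    moreover obtain w where "y = 2*w+1" using y(3) by (elim oddE)
    then have "z \<le> y" using k by simp
    ultimately show "z \<in> {z \<in> set (filter odd xs). z \<le> y}" using y assms by auto
  qed
  moreover have "card ((\<lambda>k. 2*k-1) ` {1..(y+1) div 2}) = card {1..(y+1) div 2}"
    by (rule card_image) (auto simp: inj_on_def)
  ultimately show "card {z \<in> set (filter odd xs). z \<le> y} = (y + 1) div 2"
    by simp
qed

lemma entry_odd_word: "1 \<le> j \<Longrightarrow> j \<le> n+1 \<Longrightarrow> entry (odd_word n b) j = (b (2*j-1) + 1) div 2"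
  unfolding entry_def odd_word_def by (subst nth_map) (auto simp del: upt_Suc)

lemma length_odd_word [simp]: "length (odd_word n b) = n+1"
  unfolding odd_word_def by simp

lemma alternating_odd_word:
  assumes B: "baxter n b g"
  shows "alternating (odd_word n b) \<longleftrightarrow> updown 0 n b"
proof -
  have "(if odd j then entry (odd_word n b) j < entry (odd_word n b) (j+1) else entry (odd_word n b) (j+1) < entry (odd_word n b) j)
     \<longleftrightarrow> (b (2*j-1) < b (2*j+1) \<longleftrightarrow> odd (j+0))" if j: "1 \<le> j" "j \<le> n" for j
  proof -
    have e: "entry (odd_word n b) j = (b (2*j-1) + 1) div 2" "entry (odd_word n b) (j+1) = (b (2*j+1) + 1) div 2"
      using j by (simp_all add: entry_odd_word)
    have r: "1 \<le> 2*j-1" "2*j-1 \<le> 2*n+1" "1 \<le> 2*j+1" "2*j+1 \<le> 2*n+1" "odd (2*j-1)" "odd (2*j+1)" using j by auto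
    have "odd (b (2*j-1))" "odd (b (2*j+1))"
      using baxter_bounds(7)[OF B r(1,2)] baxter_bounds(7)[OF B r(3,4)] r(5,6) by simp_all
    then obtain x y where xy: "b (2*j-1) = 2*x+1" "b (2*j+1) = 2*y+1" by (elim oddE)
    have "x \<noteq> y" using baxter_odd_neighbours(1)[OF B j] xy by simp
    then show ?thesis unfolding e xy by auto
  qed
  then show ?thesis unfolding alternating_def updown_def length_odd_word by (simp add: less_Suc_eq_le)
qed

lemma inverse_perm_odd_word:
  assumes B: "baxter n b g"
  shows "inverse_perm (odd_word n b) = odd_word n g"
proof -
  have *: "(g (2 * ((b (2*a-1) + 1) div 2) - 1) + 1) div 2 = a \<and> 1 \<le> (b (2*a-1) + 1) div 2 \<and> (b (2*a-1) + 1) div 2 \<le> n+1"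
    if B: "baxter n b g" and a: "1 \<le> a" "a \<le> n+1" for a b g
  proof -
    have r: "1 \<le> 2*a-1" "2*a-1 \<le> 2*n+1" "odd (2*a-1)" using a by auto
    have f: "b (2*a-1) \<le> 2*n+1" "g (b (2*a-1)) = 2*a-1" "odd (b (2*a-1))"
      using baxter_bounds[OF B r(1,2)] r(3) by blast+
    from f(3) obtain i where i: "b (2*a-1) = 2*i+1" by (elim oddE)
    show ?thesis using f i a by simp
  qed
  have inj: "inj_on (entry (odd_word n b)) {1..n+1}"
  proof (rule inj_onI)
    fix x y assume xy: "x \<in> {1..n+1}" "y \<in> {1..n+1}" "entry (odd_word n b) x = entry (odd_word n b) y"
    then have "(b (2*x-1) + 1) div 2 = (b (2*y-1) + 1) div 2" by (simp add: entry_odd_word)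
    then show "x = y" using *[OF B, of x] *[OF B, of y] xy by (metis atLeastAtMost_iff)
  qed
  show ?thesis unfolding inverse_perm_def length_odd_word odd_word_def[of n g]
  proof (rule map_cong)
    fix i assume "i \<in> set [1..<n+2]"
    then have i: "1 \<le> i" "i \<le> n+1" by auto
    let ?a = "(g (2*i-1) + 1) div 2"
    have a: "1 \<le> ?a" "?a \<le> n+1" "(b (2*?a-1) + 1) div 2 = i" using *[OF baxter_inverse[OF B] i] by blast+
    show "inv_into {1..n+1} (entry (odd_word n b)) i = ?a"
      by (rule inv_into_f_eq[OF inj]) (use a entry_odd_word[OF a(1,2)] in auto)
  qed simp
qed

lemma snow_leopard_of_baxter:
  assumes B: "baxter n b g" and u: "updown 0 n b" "updown 0 n g"
  shows "snow_leopard (Perm (even_word n b))"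
proof -
  have par: "\<And>j. 1 \<le> j \<Longrightarrow> j \<le> 2*n+1 \<Longrightarrow> even (b j) = even j" using baxter_bounds[OF B] by blast
  define bs where "bs = map b [1..<2*n+2]"
  have ent: "entry bs j = b j" if "1 \<le> j" "j \<le> 2*n+1" for j
    unfolding entry_def bs_def using that by (subst nth_map) (auto simp del: upt_Suc)
  have s: "set [1..<2*n+2] = {1..2*n+1}" by auto
  have bij: "bij_betw b {1..2*n+1} {1..2*n+1}"
    by (rule bij_betw_byWitness[of _ g]) (use baxter_bounds[OF B] in auto)
  have P: "bs \<in> permutations_of_set {1..2*n+1}"
    unfolding permutations_of_set_def bs_def mem_Collect_eq set_map distinct_map s
    using bij unfolding bij_betw_def by (auto simp del: upt_Suc)
  then have set: "set bs = {1..2*n+1}" unfolding permutations_of_set_def by simp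
  have "complete_baxter n bs"
    unfolding complete_baxter_def
  proof (intro conjI ballI allI impI)
    show "bs \<in> permutations_of_set {1..2*n+1}" by (rule P)
    show "even (entry bs j) = even j" if "j \<in> {1..2*n+1}" for j using that ent par by simp
    fix x y z i assume x: "x \<in> {1..2*n+1}" and y: "y \<in> {1..2*n+1}"
      and h: "entry bs x = i \<and> entry bs y = i + 1 \<and> (x < z \<and> z < y \<or> y < z \<and> z < x)"
    have e: "b x = i" "b y = i+1" "entry bs z = b z" using h ent x y by auto
    have gx: "g i = x" "g (i+1) = y" "1 \<le> i" "i \<le> 2*n"
      using baxter_bounds[OF B, of x] baxter_bounds[OF B, of y] x y e by auto
    show "if odd i then entry bs z < i else i + 1 < entry bs z"
      unfolding e(3) by (rule baxter_between[OF B gx(3,4)]) (unfold gx(1,2), use h in blast)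
  qed
  moreover have fe: "filter even bs = map (\<lambda>p. b (2*p)) [1..<n+1]"
    unfolding bs_def by (rule filter_even_one_line) (rule par)
  have "standardize (filter even bs) = even_word n b"
    by (rule trans[OF standardize_filter_even[OF set]]) (unfold fe even_word_def map_map comp_def, rule refl)
  moreover have fo: "filter odd bs = map (\<lambda>p. b (2*p-1)) [1..<n+2]"
    unfolding bs_def by (rule filter_odd_one_line) (rule par)
  have "standardize (filter odd bs) = odd_word n b"
    by (rule trans[OF standardize_filter_odd[OF set]]) (unfold fo odd_word_def map_map comp_def, rule refl)
  moreover have "doubly_alternating (odd_word n b)"
    unfolding doubly_alternating_def inverse_perm_odd_word[OF B] using alternating_odd_word[OF B] alternating_odd_word[OF baxter_inverse[OF B]] u by blast
  ultimately show ?thesis using even_word_permutation[OF B] by auto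
qed

text \<open>
  Together with \<open>snow_leopard_of_baxter\<close> this translates the definition, which is stated with lists
  and standardization, into the language of inverse pairs of functions.
\<close>

lemma baxter_of_snow_leopard:
  assumes "snow_leopard (Perm xs)"
  obtains b g where "baxter (length xs) b g" "updown 0 (length xs) b" "updown 0 (length xs) g"
    "xs = even_word (length xs) b"
proof -
  define n where "n = length xs"
  obtain bs where cb: "complete_baxter n bs" and ev: "standardize (filter even bs) = xs"
    and da: "doubly_alternating (standardize (filter odd bs))"
    using assms unfolding n_def by auto
  have P: "bs \<in> permutations_of_set {1..2*n+1}"
    and par: "\<And>j. 1 \<le> j \<Longrightarrow> j \<le> 2*n+1 \<Longrightarrow> even (entry bs j) = even j"
    using cb unfolding complete_baxter_def by auto
  have "\<forall>x \<in> {1..2 * n + 1}. \<forall>y \<in> {1..2 * n + 1}. \<forall>z i.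
      entry bs x = i \<and> entry bs y = i + 1 \<and> (x < z \<and> z < y \<or> y < z \<and> z < x) \<longrightarrow>
        (if odd i then entry bs z < i else entry bs z > i + 1)"
    using cb unfolding complete_baxter_def by (elim conjE)
  note bet = this
  have bet: "if odd i then entry bs z < i else i + 1 < entry bs z"
    if "1 \<le> x" "x \<le> 2*n+1" "1 \<le> y" "y \<le> 2*n+1" "entry bs x = i" "entry bs y = i+1"
      "x < z \<and> z < y \<or> y < z \<and> z < x" for x y z i
    by (rule bet[rule_format, of x y]) (use that in auto)
  have set: "set bs = {1..2*n+1}" "distinct bs" using P unfolding permutations_of_set_def by auto
  have len: "length bs = 2*n+1" using distinct_card[OF set(2)] set(1) by simp
  define b where "b = entry bs"
  have bs: "bs = map b [1..<2*n+2]"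
    by (rule nth_equalityI) (auto simp: len b_def entry_def simp del: upt_Suc)
  have bij: "bij_betw b {1..2*n+1} {1..2*n+1}"
  proof -
    have s: "set [1..<2*n+2] = {1..2*n+1}" by auto
    have "inj_on b {1..2*n+1}" using set(2) unfolding bs distinct_map s by simp
    moreover have "b ` {1..2*n+1} = {1..2*n+1}" using set(1) unfolding bs set_map s .
    ultimately show ?thesis unfolding bij_betw_def by blast
  qed
  define g where "g = inv_into {1..2*n+1} b"
  have bb: "1 \<le> b j \<and> b j \<le> 2*n+1 \<and> g (b j) = j" "1 \<le> g j \<and> g j \<le> 2*n+1 \<and> b (g j) = j" if "1 \<le> j" "j \<le> 2*n+1" for j
  proof -
    have j: "j \<in> {1..2*n+1}" using that by simp
    show "1 \<le> b j \<and> b j \<le> 2*n+1 \<and> g (b j) = j"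
      using bij_betwE[OF bij] j bij_betw_inv_into_left[OF bij j] unfolding g_def by auto
    show "1 \<le> g j \<and> g j \<le> 2*n+1 \<and> b (g j) = j"
      using bij_betwE[OF bij_betw_inv_into[OF bij]] j bij_betw_inv_into_right[OF bij j] unfolding g_def by auto
  qed
  have B: "baxter n b g"
  proof (rule baxterI)
    fix j assume j: "1 \<le> j" "j \<le> 2*n+1"
    show "1 \<le> b j \<and> b j \<le> 2*n+1 \<and> g (b j) = j \<and> even (b j) = even j" using bb(1)[OF j] par[OF j] unfolding b_def by blast
    show "1 \<le> g j \<and> g j \<le> 2*n+1 \<and> b (g j) = j" by (rule bb(2)[OF j])
  next
    fix i z assume i: "1 \<le> i" "i \<le> 2*n" and z: "g i < z \<and> z < g (i+1) \<or> g (i+1) < z \<and> z < g i"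
    have r: "i \<le> 2*n+1" "1 \<le> i+1" "i+1 \<le> 2*n+1" using i by auto
    show "if odd i then b z < i else i+1 < b z"
      unfolding b_def by (rule bet[of "g i" "g (i+1)"]) (use bb(2)[OF i(1) r(1)] bb(2)[OF r(2,3)] z in \<open>unfold b_def, blast+\<close>)
  qed
  have par: "\<And>j. 1 \<le> j \<Longrightarrow> j \<le> 2*n+1 \<Longrightarrow> even (b j) = even j" using par unfolding b_def .
  have xs: "xs = even_word n b"
    unfolding ev[symmetric] standardize_filter_even[OF set(1)]
    by (subst bs, subst filter_even_one_line[of n b, OF par]) (simp_all add: even_word_def comp_def del: upt_Suc)
  have "standardize (filter odd bs) = odd_word n b"
    unfolding standardize_filter_odd[OF set(1)]
    by (subst bs, subst filter_odd_one_line[of n b, OF par]) (simp_all add: odd_word_def comp_def del: upt_Suc)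
  then have "alternating (odd_word n b)" "alternating (odd_word n g)"
    using da unfolding doubly_alternating_def by (simp_all add: inverse_perm_odd_word[OF B])
  then have "updown 0 n b" "updown 0 n g"
    using alternating_odd_word[OF B] alternating_odd_word[OF baxter_inverse[OF B]] by blast+
  then show thesis using that B xs unfolding n_def by blast
qed

section \<open>The structure of snow leopard permutations of odd length\<close>

definition odd_snow :: "eperm \<Rightarrow> bool" where
  "odd_snow \<pi> \<longleftrightarrow> snow_leopard \<pi> \<and> odd (plen \<pi>)"

lemma odd_snow_Anti: "odd_snow Anti"
  unfolding odd_snow_def by simp

lemma odd_snow_Perm: "odd_snow (Perm xs) \<longleftrightarrow> (\<exists>n b g. snow n b g \<and> xs = even_word n b)"
proof
  assume "odd_snow (Perm xs)"
  then have S: "snow_leopard (Perm xs)" "odd (length xs)" unfolding odd_snow_def by simp_all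
  then show "\<exists>n b g. snow n b g \<and> xs = even_word n b"
    using baxter_of_snow_leopard[OF S(1)] unfolding snow_def by metis
next
  assume "\<exists>n b g. snow n b g \<and> xs = even_word n b"
  then show "odd_snow (Perm xs)" using snow_leopard_of_baxter unfolding odd_snow_def snow_def by (auto simp del: snow_leopard.simps)
qed

lemma even_word_frame:
  assumes "b 2 = 2" "b (2*(m+2)) = 2*(m+2)" "\<And>t. 1 \<le> t \<Longrightarrow> t \<le> 2*m+1 \<Longrightarrow> b (t+2) = 2*m+4 - b1 t"
    and B1: "baxter m b1 g1"
  shows "Perm (even_word (m+2) b) = (one_perm \<oplus>\<^sub>p compl (Perm (even_word m b1))) \<oplus>\<^sub>p one_perm"
proof -
  have r: "b (2*(k+1)) div 2 = m + 2 - b1 (2*k) div 2" if "1 \<le> k" "k \<le> m" for k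
  proof -
    have k: "1 \<le> 2*k" "2*k \<le> 2*m+1" using that by auto
    have "even (b1 (2*k))" using baxter_bounds(7)[OF B1 k] by simp
    then obtain i where i: "b1 (2*k) = 2*i" by blast
    have "b (2*(k+1)) = 2*m+4 - 2*i" using assms(3)[OF k] i by simp
    also have "\<dots> = 2*(m+2-i)" by simp
    finally show ?thesis unfolding i by simp
  qed
  have e: "1 \<le> v \<and> v \<le> m" if "v \<in> set (even_word m b1)" for v
    using even_word_permutation[OF B1] that unfolding permutations_of_set_def by auto
  have u: "[1..<m+2+1] = [1] @ map Suc [1..<m+1] @ [m+2]"
  proof -
    have "[1..<m+2+1] = 1 # [2..<m+2+1]" by (subst upt_conv_Cons) (simp_all add: numeral_2_eq_2)
    moreover have "[2..<m+2+1] = [2..<m+2] @ [m+2]" by simp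
    moreover have "map Suc [1..<m+1] = [2..<m+2]" by (simp add: map_Suc_upt numeral_2_eq_2 del: upt_Suc)
    ultimately show ?thesis by simp
  qed
  have "even_word (m+2) b = [1] @ map (\<lambda>p. m + 2 - b1 (2*p) div 2) [1..<m+1] @ [m+2]"
    unfolding even_word_def u using assms(1,2) r by (auto simp: simp del: upt_Suc)
  also have "map (\<lambda>p. m + 2 - b1 (2*p) div 2) [1..<m+1] = map (\<lambda>v. m + 2 - v) (even_word m b1)"
    unfolding even_word_def by (simp add: comp_def del: upt_Suc)
  also have "\<dots> = map (\<lambda>v. 1 + (m + 1 - v)) (even_word m b1)"
    using e by fastforce
  finally show ?thesis by (simp add: comp_def)
qed

lemma even_word_skew:
  assumes "\<And>t. 1 \<le> t \<Longrightarrow> t \<le> 2*n1+1 \<Longrightarrow> b t = b1 t + 2*n2 + 2" "b (2*n1+2) = 2*n2+2"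
    "\<And>t. 1 \<le> t \<Longrightarrow> t \<le> 2*n2+1 \<Longrightarrow> b (t + 2*n1+2) = b2 t"
  shows "Perm (even_word (n1+n2+1) b) = Perm (even_word n1 b1) \<ominus>\<^sub>p (one_perm \<ominus>\<^sub>p Perm (even_word n2 b2))"
proof -
  have u: "[1..<n1+n2+1+1] = [1..<n1+1] @ [n1+1] @ map (\<lambda>p. p + (n1+1)) [1..<n2+1]"
    by (induction n2) simp_all
  have "map (\<lambda>p. b (2*p) div 2) [1..<n1+1] = map (\<lambda>v. v + (n2+1)) (even_word n1 b1)"
    unfolding even_word_def map_map comp_def
  proof (rule map_cong[OF refl])
    fix p assume "p \<in> set [1..<n1+1]"
    then have "b (2*p) = b1 (2*p) + 2*(n2+1)" using assms(1)[of "2*p"] by auto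
    then show "b (2*p) div 2 = b1 (2*p) div 2 + (n2+1)" by simp
  qed
  moreover have "b (2*(n1+1)) div 2 = n2+1" using assms(2) by simp
  moreover have "map (\<lambda>p. b (2*p) div 2) (map (\<lambda>p. p + (n1+1)) [1..<n2+1]) = even_word n2 b2"
    unfolding even_word_def map_map comp_def
  proof (rule map_cong[OF refl])
    fix p assume "p \<in> set [1..<n2+1]"
    then have "b (2*p+2*n1+2) = b2 (2*p)" using assms(3)[of "2*p"] by auto
    then show "b (2*(p + (n1+1))) div 2 = b2 (2*p) div 2" by (simp add: algebra_simps)
  qed
  ultimately have "even_word (n1+n2+1) b = map (\<lambda>v. v + (n2+1)) (even_word n1 b1) @ [n2+1] @ even_word n2 b2"
    unfolding even_word_def[of "n1+n2+1"] u map_append by (simp del: upt_Suc)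
  then show ?thesis by (simp add: add.commute)
qed

lemma map_add_zero [simp]: "map ((+) (0::nat)) xs = xs"
  by (simp add: map_idI)

text \<open>
  The antipermutation is not induced by any complete Baxter permutation, but its frame is the
  permutation 1, which is induced by 123; so frames need no case distinction any more.
\<close>

lemma odd_snow_frame:
  assumes "odd_snow \<pi>"
  obtains n b g where "snow n b g" "(one_perm \<oplus>\<^sub>p compl \<pi>) \<oplus>\<^sub>p one_perm = Perm (even_word n b)"
proof (cases \<pi>)
  case Anti
  show ?thesis by (rule that[OF snow_one]) (simp add: Anti even_word_def)
next
  case (Perm xs)
  then obtain m b1 g1 where S: "snow m b1 g1" and xs: "xs = even_word m b1" using assms odd_snow_Perm by blast
  have B: "baxter m b1 g1" using S unfolding snow_def by blast
  obtain b g where b: "snow (m + 2) b g" "b 2 = 2" "b (2*(m+2)) = 2*(m+2)"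
    "\<And>t. 1 \<le> t \<Longrightarrow> t \<le> 2*m+1 \<Longrightarrow> b (t+2) = 2*m+4 - b1 t"
    using snow_frame[OF S] by metis
  show ?thesis by (rule that[OF b(1)]) (unfold Perm xs, rule even_word_frame[OF b(2-4) B, symmetric])
qed

lemma odd_snow_build:
  assumes "odd_snow \<pi>\<^sub>1" "odd_snow \<pi>\<^sub>2"
  shows "odd_snow (((one_perm \<oplus>\<^sub>p compl \<pi>\<^sub>1) \<oplus>\<^sub>p one_perm) \<ominus>\<^sub>p (one_perm \<ominus>\<^sub>p \<pi>\<^sub>2))"
proof -
  obtain n1 b1 g1 where 1: "snow n1 b1 g1" "(one_perm \<oplus>\<^sub>p compl \<pi>\<^sub>1) \<oplus>\<^sub>p one_perm = Perm (even_word n1 b1)"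
    by (rule odd_snow_frame[OF assms(1)])
  show ?thesis
  proof (cases \<pi>\<^sub>2)
    case Anti
    have "odd_snow (Perm (even_word n1 b1))" using odd_snow_Perm 1(1) by blast
    then show ?thesis unfolding 1(2) Anti by simp
  next
    case (Perm xs)
    then obtain n2 b2 g2 where 2: "snow n2 b2 g2" "xs = even_word n2 b2" using assms(2) odd_snow_Perm by blast
    obtain b g where b: "snow (n1 + n2 + 1) b g"
      "\<And>t. 1 \<le> t \<Longrightarrow> t \<le> 2*n1+1 \<Longrightarrow> b t = b1 t + 2*n2 + 2" "b (2*n1+2) = 2*n2+2"
      "\<And>t. 1 \<le> t \<Longrightarrow> t \<le> 2*n2+1 \<Longrightarrow> b (t + 2*n1+2) = b2 t"
      using snow_skew[OF 1(1) 2(1)] by metis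
    have "odd_snow (Perm (even_word (n1+n2+1) b))" unfolding odd_snow_Perm using b(1) by blast
    moreover have "Perm (even_word (n1+n2+1) b) = Perm (even_word n1 b1) \<ominus>\<^sub>p (one_perm \<ominus>\<^sub>p Perm (even_word n2 b2))"
      by (rule even_word_skew) (use b in blast)+
    ultimately show ?thesis unfolding 1(2) Perm 2(2) by metis
  qed
qed

lemma snow_first_minimum_frame:
  assumes S: "snow n b g" and b1: "b 1 = 1"
  obtains \<pi> where "odd_snow \<pi>" "Perm (even_word n b) = (one_perm \<oplus>\<^sub>p compl \<pi>) \<oplus>\<^sub>p one_perm"
proof (cases "n = 1")
  case True
  have B: "baxter n b g" using S unfolding snow_def by blast
  have "b 2 = 2"
  proof -
    have "b 3 = 3" using snow_last_maximum[OF S b1] True by (simp add: numeral_eq_Suc)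
    moreover have "b 2 \<noteq> b 1" "b 2 \<noteq> b 3"
      using baxter_inject[OF B, of 2 1] baxter_inject[OF B, of 2 3] True by simp_all
    moreover have "1 \<le> b 2" "b 2 \<le> 3" using baxter_bounds(1,2)[OF B, of 2] True by auto
    ultimately show ?thesis using b1 by linarith
  qed
  then have "even_word n b = [1]" unfolding True even_word_def by (simp add: numeral_eq_Suc)
  then show ?thesis by (intro that[OF odd_snow_Anti]) simp
next
  case False
  obtain m b' g' where m: "n = m + 2" "snow m b' g'" "b 2 = 2" "b (2*n) = 2*n"
    "\<And>t. 1 \<le> t \<Longrightarrow> t \<le> 2*m+1 \<Longrightarrow> b (t+2) = 2*m+4 - b' t"
    using snow_frame_split[OF S b1 False] by metis
  have "baxter m b' g'" using m(2) unfolding snow_def by blast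
  from even_word_frame[OF m(3) m(4)[unfolded m(1)] m(5) this]
  have "Perm (even_word n b) = (one_perm \<oplus>\<^sub>p compl (Perm (even_word m b'))) \<oplus>\<^sub>p one_perm" unfolding m(1) .
  moreover have "odd_snow (Perm (even_word m b'))" using m(2) odd_snow_Perm by blast
  ultimately show ?thesis using that by blast
qed

text \<open>
  If the complete Baxter permutation begins with 1, it is a frame and \<open>\<pi>\<^sub>2\<close> is the antipermutation.
  Otherwise the upper part of its skew decomposition begins with its minimum and is therefore a frame.
\<close>

lemma odd_snow_split:
  assumes "odd_snow (Perm xs)"
  obtains \<pi>\<^sub>1 \<pi>\<^sub>2 where "odd_snow \<pi>\<^sub>1" "odd_snow \<pi>\<^sub>2"
    "Perm xs = ((one_perm \<oplus>\<^sub>p compl \<pi>\<^sub>1) \<oplus>\<^sub>p one_perm) \<ominus>\<^sub>p (one_perm \<ominus>\<^sub>p \<pi>\<^sub>2)"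
proof -
  obtain n b g where S: "snow n b g" "xs = even_word n b" using assms odd_snow_Perm by blast
  show thesis
  proof (cases "b 1 = 1")
    case True
    obtain \<pi> where p: "odd_snow \<pi>" "Perm (even_word n b) = (one_perm \<oplus>\<^sub>p compl \<pi>) \<oplus>\<^sub>p one_perm"
      by (rule snow_first_minimum_frame[OF S(1) True])
    show thesis by (rule that[OF p(1) odd_snow_Anti]) (unfold S(2) p(2)[symmetric], simp)
  next
    case False
    obtain n1 n2 b1 g1 b2 g2 where d: "n = n1 + n2 + 1" "snow n1 b1 g1" "snow n2 b2 g2" "b1 1 = 1"
      "\<And>t. 1 \<le> t \<Longrightarrow> t \<le> 2*n1+1 \<Longrightarrow> b t = b1 t + 2*n2 + 2" "b (2*n1+2) = 2*n2+2"
      "\<And>t. 1 \<le> t \<Longrightarrow> t \<le> 2*n2+1 \<Longrightarrow> b (t + 2*n1+2) = b2 t"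
      using snow_skew_split[OF S(1) False] by metis
    obtain \<pi> where p: "odd_snow \<pi>" "Perm (even_word n1 b1) = (one_perm \<oplus>\<^sub>p compl \<pi>) \<oplus>\<^sub>p one_perm"
      by (rule snow_first_minimum_frame[OF d(2,4)])
    have "odd_snow (Perm (even_word n2 b2))" using d(3) odd_snow_Perm by blast
    moreover have "Perm (even_word (n1+n2+1) b) = Perm (even_word n1 b1) \<ominus>\<^sub>p (one_perm \<ominus>\<^sub>p Perm (even_word n2 b2))"
      by (rule even_word_skew) (use d in blast)+
    ultimately show thesis using that p unfolding S(2) d(1) by metis
  qed
qed

section \<open>Even and odd threads are generated by two sums\<close>

definition one_line :: "nat list \<Rightarrow> bool" where
  "one_line xs \<longleftrightarrow> distinct xs \<and> set xs = {1..length xs}"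

lemma one_lineD:
  assumes "one_line xs"
  shows "distinct xs" "set xs = {1..length xs}" "\<And>v. v \<in> set xs \<Longrightarrow> 1 \<le> v \<and> v \<le> length xs"
  using assms unfolding one_line_def by auto

lemma odd_snow_one_line:
  assumes "odd_snow (Perm xs)"
  shows "one_line xs" "odd (length xs)"
proof -
  have "xs \<in> permutations_of_set {1..length xs}" "odd (length xs)"
    using assms unfolding odd_snow_def snow_leopard.simps plen.simps by simp_all
  then show "one_line xs" "odd (length xs)" unfolding one_line_def permutations_of_set_def by simp_all
qed

lemma length_standardize [simp]: "length (standardize xs) = length xs"
  unfolding standardize_def by simp

lemma one_line_standardize:
  assumes "distinct xs"
  shows "one_line (standardize xs)"
proof -
  let ?f = "\<lambda>y. card {z \<in> set xs. z \<le> y}"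
  have mono: "?f x < ?f y" if "x \<in> set xs" "y \<in> set xs" "x < y" for x y
  proof (rule psubset_card_mono)
    have "y \<in> {z \<in> set xs. z \<le> y}" "y \<notin> {z \<in> set xs. z \<le> x}" using that by auto
    then show "{z \<in> set xs. z \<le> x} \<subset> {z \<in> set xs. z \<le> y}" using that by fastforce
  qed simp
  have inj: "inj_on ?f (set xs)"
  proof (rule inj_onI)
    fix x y assume "x \<in> set xs" "y \<in> set xs" "?f x = ?f y"
    then show "x = y" using mono[of x y] mono[of y x] by (cases x y rule: linorder_cases) simp_all
  qed
  then have d: "distinct (standardize xs)" using assms unfolding standardize_def by (simp add: distinct_map)
  have "set (standardize xs) \<subseteq> {1..length xs}"
  proof
    fix v assume "v \<in> set (standardize xs)"
    then obtain y where y: "y \<in> set xs" "v = ?f y" unfolding standardize_def by auto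
    have "?f y \<le> card (set xs)" by (rule card_mono) auto
    moreover have "0 < ?f y" using y by (auto simp: card_gt_0_iff)
    ultimately show "v \<in> {1..length xs}" using y distinct_card[OF assms] by (simp add: Suc_le_eq)
  qed
  moreover have "card (set (standardize xs)) = card {1..length xs}"
    using distinct_card[OF d] by simp
  ultimately have "set (standardize xs) = {1..length xs}" by (intro card_subset_eq) auto
  then show ?thesis using d unfolding one_line_def by simp
qed

lemma standardize_append_greater:
  assumes "\<And>x y. x \<in> set xs \<Longrightarrow> y \<in> set ys \<Longrightarrow> y < x" "distinct ys"
  shows "standardize (xs @ ys) = map (\<lambda>v. length ys + v) (standardize xs) @ standardize ys"
proof -
  have "{z \<in> set (xs @ ys). z \<le> x} = set ys \<union> {z \<in> set xs. z \<le> x}" if "x \<in> set xs" for x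
    using assms(1)[OF that] by (auto intro: less_imp_le)
  moreover have "set ys \<inter> {z \<in> set xs. z \<le> x} = {}" for x using assms(1) by fastforce
  ultimately have "card {z \<in> set (xs @ ys). z \<le> x} = length ys + card {z \<in> set xs. z \<le> x}" if "x \<in> set xs" for x
    using that by (simp add: card_Un_disjoint distinct_card[OF assms(2)])
  moreover have "{z \<in> set (xs @ ys). z \<le> y} = {z \<in> set ys. z \<le> y}" if "y \<in> set ys" for y
    using assms(1) that by fastforce
  ultimately show ?thesis unfolding standardize_def by simp
qed

lemma standardize_append_less:
  assumes "\<And>x y. x \<in> set xs \<Longrightarrow> y \<in> set ys \<Longrightarrow> x < y" "distinct xs"
  shows "standardize (xs @ ys) = standardize xs @ map (\<lambda>v. length xs + v) (standardize ys)"
proof -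
  have "{z \<in> set (xs @ ys). z \<le> y} = set xs \<union> {z \<in> set ys. z \<le> y}" if "y \<in> set ys" for y
    using assms(1)[OF _ that] by (auto intro: less_imp_le)
  moreover have "set xs \<inter> {z \<in> set ys. z \<le> y} = {}" for y using assms(1) by fastforce
  ultimately have "card {z \<in> set (xs @ ys). z \<le> y} = length xs + card {z \<in> set ys. z \<le> y}" if "y \<in> set ys" for y
    using that by (simp add: card_Un_disjoint distinct_card[OF assms(2)])
  moreover have "{z \<in> set (xs @ ys). z \<le> x} = {z \<in> set xs. z \<le> x}" if "x \<in> set xs" for x
    using assms(1) that by fastforce
  ultimately show ?thesis unfolding standardize_def by simp
qed

lemma standardize_singleton [simp]: "standardize [x] = [1]"
proof -
  have "{z. z = x \<and> z \<le> x} = {x}" by auto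
  then show ?thesis unfolding standardize_def by simp
qed

lemma standardize_Nil [simp]: "standardize [] = []"
  unfolding standardize_def by simp

lemma standardize_shift: "standardize (map (\<lambda>v. c + v) xs) = standardize xs"
proof -
  have "{z \<in> (\<lambda>v. c + v) ` set xs. z \<le> c + x} = (\<lambda>v. c + v) ` {z \<in> set xs. z \<le> x}" for x by auto
  then have "card {z \<in> (\<lambda>v. c + v) ` set xs. z \<le> c + x} = card {z \<in> set xs. z \<le> x}" for x
    by (simp add: card_image)
  then show ?thesis unfolding standardize_def by simp
qed

lemma standardize_complement:
  assumes "distinct xs" "\<And>x. x \<in> set xs \<Longrightarrow> x \<le> N"
  shows "standardize (map (\<lambda>v. N - v) xs) = map (\<lambda>v. length xs + 1 - v) (standardize xs)"
proof -
  have "card {z \<in> (\<lambda>v. N - v) ` set xs. z \<le> N - x} = length xs + 1 - card {z \<in> set xs. z \<le> x}" if x: "x \<in> set xs" for x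
  proof -
    have "N - w \<le> N - x \<longleftrightarrow> x \<le> w" if "w \<in> set xs" for w
      using assms(2)[OF that] assms(2)[OF x] by linarith
    then have "{z \<in> (\<lambda>v. N - v) ` set xs. z \<le> N - x} = (\<lambda>v. N - v) ` {z \<in> set xs. x \<le> z}"
      by blast
    moreover have "inj_on (\<lambda>v. N - v) {z \<in> set xs. x \<le> z}"
      using assms(2) by (intro inj_onI) (metis (mono_tags, lifting) diff_diff_cancel mem_Collect_eq)
    ultimately have "card {z \<in> (\<lambda>v. N - v) ` set xs. z \<le> N - x} = card {z \<in> set xs. x \<le> z}"
      by (simp add: card_image)
    moreover have "card {z \<in> set xs. x \<le> z} + card {z \<in> set xs. z \<le> x} = length xs + 1"
    proof -
      have u: "{z \<in> set xs. x \<le> z} \<union> {z \<in> set xs. z \<le> x} = set xs" by auto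
      have i: "{z \<in> set xs. x \<le> z} \<inter> {z \<in> set xs. z \<le> x} = {x}" using x by auto
      show ?thesis using card_Un_Int[of "{z \<in> set xs. x \<le> z}" "{z \<in> set xs. z \<le> x}"] distinct_card[OF assms(1)]
        unfolding u i by simp
    qed
    ultimately show ?thesis by linarith
  qed
  then show ?thesis unfolding standardize_def by simp
qed

lemma filter_shift_even:
  fixes c :: nat
  assumes "even c"
  shows "filter even (map (\<lambda>v. c + v) xs) = map (\<lambda>v. c + v) (filter even xs)"
    "filter odd (map (\<lambda>v. c + v) xs) = map (\<lambda>v. c + v) (filter odd xs)"
  using assms by (simp_all add: filter_map comp_def)

lemma filter_shift_odd:
  fixes c :: nat
  assumes "odd c"
  shows "filter even (map (\<lambda>v. c + v) xs) = map (\<lambda>v. c + v) (filter odd xs)"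
    "filter odd (map (\<lambda>v. c + v) xs) = map (\<lambda>v. c + v) (filter even xs)"
  using assms by (simp_all add: filter_map comp_def)

lemma filter_complement_even:
  fixes c :: nat
  assumes "even c" "\<And>x. x \<in> set xs \<Longrightarrow> x \<le> c"
  shows "filter even (map (\<lambda>v. c - v) xs) = map (\<lambda>v. c - v) (filter even xs)"
    "filter odd (map (\<lambda>v. c - v) xs) = map (\<lambda>v. c - v) (filter odd xs)"
proof -
  have "even (c - v) \<longleftrightarrow> even v" if "v \<in> set xs" for v
    using assms(1) assms(2)[OF that] by simp
  then have "filter (\<lambda>v. even (c - v)) xs = filter even xs" "filter (\<lambda>v. odd (c - v)) xs = filter odd xs"
    by (simp_all cong: filter_cong)
  then show "filter even (map (\<lambda>v. c - v) xs) = map (\<lambda>v. c - v) (filter even xs)"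
    "filter odd (map (\<lambda>v. c - v) xs) = map (\<lambda>v. c - v) (filter odd xs)"
    by (simp_all add: filter_map comp_def)
qed

text \<open>
  The complement of \<open>\<pi>\<close> subtracts from the even number \<open>|\<pi>| + 1\<close> and keeps parity; the leading 1
  then raises all entries by one, so even and odd entries change roles. The two entries of the frame
  are odd.
\<close>

lemma threads_frame:
  assumes "odd_snow \<pi>" "Perm F = (one_perm \<oplus>\<^sub>p compl \<pi>) \<oplus>\<^sub>p one_perm"
  shows "even_part (Perm F) = compl (odd_part \<pi>)" (is ?even)
    and "odd_part (Perm F) = (one_perm \<oplus>\<^sub>p compl (even_part \<pi>)) \<oplus>\<^sub>p one_perm" (is ?odd)
proof -
  have "?even \<and> ?odd"
  proof (cases \<pi>)
    case Anti
    then show ?thesis using assms(2) by simp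
  next
    case (Perm xs)
    let ?n = "length xs"
    have P: "one_line xs" "odd ?n" using odd_snow_one_line assms(1) unfolding Perm by blast+
    note x = one_lineD[OF P(1)]
    have b: "v \<le> ?n + 1" if "v \<in> set xs" for v using x(3)[OF that] by simp
    define c where "c = map (\<lambda>v. ?n + 1 - v) xs"
    have F: "F = [1] @ map (\<lambda>v. 1 + v) c @ [?n + 2]" using assms(2) unfolding Perm c_def by simp
    have cb: "1 \<le> v \<and> v \<le> ?n" if "v \<in> set c" for v using that x(3) unfolding c_def by fastforce
    have ev: "even (?n + 1)" using P by simp
    have fc: "filter even c = map (\<lambda>v. ?n + 1 - v) (filter even xs)" "filter odd c = map (\<lambda>v. ?n + 1 - v) (filter odd xs)"
      unfolding c_def using filter_complement_even[OF ev, of xs] b by blast+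
    have dc: "distinct c" unfolding c_def distinct_map using x(1) b
      by (intro conjI inj_onI) (simp, metis diff_diff_cancel)
    have "filter even F = map (\<lambda>v. 1 + v) (filter odd c)"
      unfolding F filter_append filter_shift_odd[OF odd_one] using P by simp
    then have "standardize (filter even F) = standardize (filter odd c)" by (simp only: standardize_shift)
    also have "\<dots> = map (\<lambda>v. length (filter odd xs) + 1 - v) (standardize (filter odd xs))"
      unfolding fc by (rule standardize_complement) (use x(1) b in auto)
    finally have E: "even_part (Perm F) = compl (odd_part \<pi>)" unfolding Perm by simp
    have fo: "filter odd F = [1] @ (map (\<lambda>v. 1 + v) (filter even c) @ [?n + 2])"
      unfolding F filter_append filter_shift_odd[OF odd_one] using P by simp
    have s1: "standardize (filter even c) = map (\<lambda>v. length (filter even xs) + 1 - v) (standardize (filter even xs))"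
      unfolding fc by (rule standardize_complement) (use x(1) b in auto)
    have "standardize (filter odd F) = [1] @ map (\<lambda>v. 1 + v) (standardize (map (\<lambda>v. 1 + v) (filter even c) @ [?n + 2]))"
      unfolding fo by (subst standardize_append_less) (use cb in \<open>auto simp: Suc_le_eq\<close>)
    also have "standardize (map (\<lambda>v. 1 + v) (filter even c) @ [?n + 2]) = standardize (map (\<lambda>v. 1 + v) (filter even c)) @ map (\<lambda>v. length (filter even c) + v) [1]"
      by (subst standardize_append_less) (use cb dc in \<open>auto simp: distinct_map less_Suc_eq_le\<close>)
    also have "standardize (map (\<lambda>v. 1 + v) (filter even c)) = map (\<lambda>v. length (filter even xs) + 1 - v) (standardize (filter even xs))"
      unfolding standardize_shift s1 ..
    finally have O: "odd_part (Perm F) = (one_perm \<oplus>\<^sub>p compl (even_part \<pi>)) \<oplus>\<^sub>p one_perm"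
      unfolding Perm by (simp add: fc)
    show ?thesis using E O by blast
  qed
  then show ?even ?odd by blast+
qed

text \<open>
  The connector has the value \<open>|\<pi>| + 1\<close>, which is even, and the entries above it are shifted by the
  same even number.
\<close>

lemma threads_skew:
  assumes "odd_snow (Perm xs)" "odd_snow \<pi>"
  shows "even_part (Perm xs \<ominus>\<^sub>p (one_perm \<ominus>\<^sub>p \<pi>)) = even_part (Perm xs) \<ominus>\<^sub>p (one_perm \<ominus>\<^sub>p even_part \<pi>)" (is ?even)
    and "odd_part (Perm xs \<ominus>\<^sub>p (one_perm \<ominus>\<^sub>p \<pi>)) = odd_part (Perm xs) \<ominus>\<^sub>p odd_part \<pi>" (is ?odd)
proof -
  have "?even \<and> ?odd"
  proof (cases \<pi>)
    case Anti
    then show ?thesis by simp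
  next
    case (Perm ys)
    let ?m = "length ys"
    have P: "one_line ys" "odd ?m" using odd_snow_one_line assms(2) unfolding Perm by blast+
    have Q: "one_line xs" using odd_snow_one_line assms(1) by blast
    note x = one_lineD[OF Q] and y = one_lineD[OF P(1)]
    have ev: "even (?m + 1)" using P by simp
    have ym: "v < ?m + 1 + w" if "v \<in> set ys" for v w using y(3)[OF that] by simp
    have xp: "0 < v" if "v \<in> set xs" for v using x(3)[OF that] by simp
    have ym': "v < ?m + 1" if "v \<in> set ys" for v using y(3)[OF that] by simp
    have dy: "distinct (filter even ys)" "distinct (filter odd ys)" "?m + 1 \<notin> set ys" using y(1) ym' by auto
    let ?s = "\<lambda>v. (?m + 1) + v"
    have L: "Perm xs \<ominus>\<^sub>p (one_perm \<ominus>\<^sub>p \<pi>) = Perm (map ?s xs @ [?m + 1] @ ys)" unfolding Perm by simp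
    have "filter even (map ?s xs @ [?m + 1] @ ys) = map ?s (filter even xs) @ ([?m + 1] @ filter even ys)"
      unfolding filter_append filter_shift_even[OF ev] using P by simp
    also have "standardize \<dots> = map (\<lambda>v. (length (filter even ys) + 1) + v) (standardize (map ?s (filter even xs))) @ standardize ([?m + 1] @ filter even ys)"
      by (subst standardize_append_greater) (use ym ym' xp dy in auto)
    also have "standardize ([?m + 1] @ filter even ys) = map (\<lambda>v. length (filter even ys) + v) [1] @ standardize (filter even ys)"
      by (subst standardize_append_greater) (use ym ym' xp dy in auto)
    finally have E: "standardize (filter even (map ?s xs @ [?m + 1] @ ys)) =
      map (\<lambda>v. (length (filter even ys) + 1) + v) (standardize (filter even xs)) @ map (\<lambda>v. length (filter even ys) + v) [1] @ standardize (filter even ys)"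
      unfolding standardize_shift .
    have "filter odd (map ?s xs @ [?m + 1] @ ys) = map ?s (filter odd xs) @ filter odd ys"
      unfolding filter_append filter_shift_even[OF ev] using P by simp
    also have "standardize \<dots> = map (\<lambda>v. length (filter odd ys) + v) (standardize (map ?s (filter odd xs))) @ standardize (filter odd ys)"
      by (subst standardize_append_greater) (use ym ym' xp dy in auto)
    finally have O: "standardize (filter odd (map ?s xs @ [?m + 1] @ ys)) =
      map (\<lambda>v. length (filter odd ys) + v) (standardize (filter odd xs)) @ standardize (filter odd ys)"
      unfolding standardize_shift .
    show ?thesis unfolding L even_part.simps odd_part.simps E O unfolding Perm by simp
  qed
  then show ?even ?odd by blast+
qed

lemma threads_compose:
  assumes "odd_snow \<pi>\<^sub>1" "odd_snow \<pi>\<^sub>2"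
  shows "even_part (((one_perm \<oplus>\<^sub>p compl \<pi>\<^sub>1) \<oplus>\<^sub>p one_perm) \<ominus>\<^sub>p (one_perm \<ominus>\<^sub>p \<pi>\<^sub>2)) =
      compl (odd_part \<pi>\<^sub>1) \<ominus>\<^sub>p (one_perm \<ominus>\<^sub>p even_part \<pi>\<^sub>2)"
    "odd_part (((one_perm \<oplus>\<^sub>p compl \<pi>\<^sub>1) \<oplus>\<^sub>p one_perm) \<ominus>\<^sub>p (one_perm \<ominus>\<^sub>p \<pi>\<^sub>2)) =
      ((one_perm \<oplus>\<^sub>p compl (even_part \<pi>\<^sub>1)) \<oplus>\<^sub>p one_perm) \<ominus>\<^sub>p odd_part \<pi>\<^sub>2"
proof -
  obtain n b g where 1: "snow n b g" "(one_perm \<oplus>\<^sub>p compl \<pi>\<^sub>1) \<oplus>\<^sub>p one_perm = Perm (even_word n b)"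
    by (rule odd_snow_frame[OF assms(1)])
  have S: "odd_snow (Perm (even_word n b))" using 1(1) odd_snow_Perm by blast
  show "even_part (((one_perm \<oplus>\<^sub>p compl \<pi>\<^sub>1) \<oplus>\<^sub>p one_perm) \<ominus>\<^sub>p (one_perm \<ominus>\<^sub>p \<pi>\<^sub>2)) =
      compl (odd_part \<pi>\<^sub>1) \<ominus>\<^sub>p (one_perm \<ominus>\<^sub>p even_part \<pi>\<^sub>2)"
    "odd_part (((one_perm \<oplus>\<^sub>p compl \<pi>\<^sub>1) \<oplus>\<^sub>p one_perm) \<ominus>\<^sub>p (one_perm \<ominus>\<^sub>p \<pi>\<^sub>2)) =
      ((one_perm \<oplus>\<^sub>p compl (even_part \<pi>\<^sub>1)) \<oplus>\<^sub>p one_perm) \<ominus>\<^sub>p odd_part \<pi>\<^sub>2"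
    unfolding 1(2) threads_skew[OF S assms(2)] threads_frame[OF assms(1) 1(2)[symmetric]] by blast+
qed

lemma even_thread_odd_snow: "even_thread \<alpha> \<longleftrightarrow> (\<exists>\<pi>. odd_snow \<pi> \<and> \<alpha> = even_part \<pi>)"
  unfolding even_thread_def odd_snow_def by blast

lemma odd_thread_odd_snow: "odd_thread \<alpha> \<longleftrightarrow> (\<exists>\<pi>. odd_snow \<pi> \<and> \<alpha> = odd_part \<pi>)"
  unfolding odd_thread_def odd_snow_def by blast

lemma even_thread_Anti: "even_thread Anti"
  unfolding even_thread_odd_snow using odd_snow_Anti by (metis even_part.simps(1))

lemma odd_thread_empty: "odd_thread (Perm [])"
  unfolding odd_thread_odd_snow using odd_snow_Anti by (metis odd_part.simps(1))

lemma even_thread_build: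
  assumes "odd_thread \<beta>" "even_thread \<alpha>"
  shows "even_thread (compl \<beta> \<ominus>\<^sub>p (one_perm \<ominus>\<^sub>p \<alpha>))"
  using assms odd_snow_build threads_compose(1) unfolding even_thread_odd_snow odd_thread_odd_snow by metis

lemma odd_thread_build:
  assumes "even_thread \<alpha>" "odd_thread \<beta>"
  shows "odd_thread (((one_perm \<oplus>\<^sub>p compl \<alpha>) \<oplus>\<^sub>p one_perm) \<ominus>\<^sub>p \<beta>)"
  using assms odd_snow_build threads_compose(2) unfolding even_thread_odd_snow odd_thread_odd_snow by metis

lemma even_thread_split:
  assumes "even_thread \<pi>" "\<pi> \<noteq> Anti"
  obtains \<beta> \<alpha> where "odd_thread \<beta>" "even_thread \<alpha>" "\<pi> = compl \<beta> \<ominus>\<^sub>p (one_perm \<ominus>\<^sub>p \<alpha>)"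
proof -
  obtain s where s: "odd_snow s" "\<pi> = even_part s" using assms(1) even_thread_odd_snow by blast
  then obtain xs where xs: "s = Perm xs" using assms(2) by (cases s) auto
  obtain \<pi>\<^sub>1 \<pi>\<^sub>2 where p: "odd_snow \<pi>\<^sub>1" "odd_snow \<pi>\<^sub>2"
    "Perm xs = ((one_perm \<oplus>\<^sub>p compl \<pi>\<^sub>1) \<oplus>\<^sub>p one_perm) \<ominus>\<^sub>p (one_perm \<ominus>\<^sub>p \<pi>\<^sub>2)"
    using odd_snow_split s(1) unfolding xs by metis
  show thesis
  proof (rule that)
    show "odd_thread (odd_part \<pi>\<^sub>1)" using p(1) odd_thread_odd_snow by blast
    show "even_thread (even_part \<pi>\<^sub>2)" using p(2) even_thread_odd_snow by blast
    show "\<pi> = compl (odd_part \<pi>\<^sub>1) \<ominus>\<^sub>p (one_perm \<ominus>\<^sub>p even_part \<pi>\<^sub>2)" unfolding s(2) xs p(3) by (rule threads_compose(1)[OF p(1,2)])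
  qed
qed

lemma odd_thread_split:
  assumes "odd_thread \<pi>" "\<pi> \<noteq> Perm []"
  obtains \<beta> \<alpha> where "even_thread \<alpha>" "odd_thread \<beta>" "\<pi> = ((one_perm \<oplus>\<^sub>p compl \<alpha>) \<oplus>\<^sub>p one_perm) \<ominus>\<^sub>p \<beta>"
proof -
  obtain s where s: "odd_snow s" "\<pi> = odd_part s" using assms(1) odd_thread_odd_snow by blast
  then obtain xs where xs: "s = Perm xs" using assms(2) by (cases s) auto
  obtain \<pi>\<^sub>1 \<pi>\<^sub>2 where p: "odd_snow \<pi>\<^sub>1" "odd_snow \<pi>\<^sub>2"
    "Perm xs = ((one_perm \<oplus>\<^sub>p compl \<pi>\<^sub>1) \<oplus>\<^sub>p one_perm) \<ominus>\<^sub>p (one_perm \<ominus>\<^sub>p \<pi>\<^sub>2)"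
    using odd_snow_split s(1) unfolding xs by metis
  show thesis
  proof (rule that)
    show "even_thread (even_part \<pi>\<^sub>1)" using p(1) even_thread_odd_snow by blast
    show "odd_thread (odd_part \<pi>\<^sub>2)" using p(2) odd_thread_odd_snow by blast
    show "\<pi> = ((one_perm \<oplus>\<^sub>p compl (even_part \<pi>\<^sub>1)) \<oplus>\<^sub>p one_perm) \<ominus>\<^sub>p odd_part \<pi>\<^sub>2" unfolding s(2) xs p(3) by (rule threads_compose(2)[OF p(1,2)])
  qed
qed

lemma even_thread_one_line:
  assumes "even_thread (Perm xs)"
  shows "one_line xs"
proof -
  obtain s where s: "odd_snow s" "Perm xs = even_part s" using assms even_thread_odd_snow by blast
  then obtain ys where ys: "s = Perm ys" "xs = standardize (filter even ys)" by (cases s) auto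
  have "distinct ys" using odd_snow_one_line(1) s(1) one_lineD(1) unfolding ys by blast
  then show ?thesis unfolding ys by (intro one_line_standardize) simp
qed

lemma odd_thread_one_line:
  assumes "odd_thread \<beta>"
  obtains xs where "\<beta> = Perm xs" "one_line xs"
proof -
  obtain s where s: "odd_snow s" "\<beta> = odd_part s" using assms odd_thread_odd_snow by blast
  show thesis
  proof (cases s)
    case Anti
    then show thesis using s that unfolding one_line_def by simp
  next
    case (Perm ys)
    have "distinct ys" using odd_snow_one_line(1) s(1) one_lineD(1) unfolding Perm by blast
    then show thesis using that s(2) one_line_standardize unfolding Perm by simp
  qed
qed

section \<open>Unique decompositions of threads\<close>

abbreviation even_compose :: "eperm \<Rightarrow> eperm \<Rightarrow> eperm" where
  "even_compose \<beta> \<alpha> \<equiv> compl \<beta> \<ominus>\<^sub>p (one_perm \<ominus>\<^sub>p \<alpha>)"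

abbreviation odd_compose :: "eperm \<Rightarrow> eperm \<Rightarrow> eperm" where
  "odd_compose \<alpha> \<beta> \<equiv> ((one_perm \<oplus>\<^sub>p compl \<alpha>) \<oplus>\<^sub>p one_perm) \<ominus>\<^sub>p \<beta>"

lemma compl_compl:
  assumes "one_line bs"
  shows "compl (compl (Perm bs)) = Perm bs"
  using one_lineD(3)[OF assms] by (auto intro!: map_idI) (metis Suc_diff_diff diff_diff_cancel diff_Suc_Suc le_SucI minus_nat.diff_0)

text \<open>
  The list \<open>1 \<oplus> c(\<alpha>) \<oplus> 1\<close>. That the antipermutation gives \<open>[1]\<close> is the convention
  \<open>1 \<oplus> @ \<oplus> 1 = 1\<close>.
\<close>

definition frame_word :: "eperm \<Rightarrow> nat list" where
  "frame_word \<alpha> = (case \<alpha> of Anti \<Rightarrow> [1]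
     | Perm xs \<Rightarrow> [1] @ map (\<lambda>v. 1 + (length xs + 1 - v)) xs @ [length xs + 2])"

lemma frame_word: "(one_perm \<oplus>\<^sub>p compl \<alpha>) \<oplus>\<^sub>p one_perm = Perm (frame_word \<alpha>)"
  unfolding frame_word_def by (cases \<alpha>) (simp_all add: comp_def)

lemma frame_word_Cons: "frame_word \<alpha> = 1 # tl (frame_word \<alpha>)"
  unfolding frame_word_def by (cases \<alpha>) simp_all

lemma length_frame_word: "int (length (frame_word \<alpha>)) = plen \<alpha> + 2"
  unfolding frame_word_def by (cases \<alpha>) simp_all

lemma frame_word_inject:
  assumes "frame_word \<alpha> = frame_word \<alpha>'" "even_thread \<alpha>" "even_thread \<alpha>'"
  shows "\<alpha> = \<alpha>'"
proof -
  have l: "plen \<alpha> = plen \<alpha>'" using length_frame_word[of \<alpha>] length_frame_word[of \<alpha>'] assms(1) by simp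
  show ?thesis
  proof (cases \<alpha>)
    case Anti
    then show ?thesis using l by (cases \<alpha>') auto
  next
    case (Perm xs)
    with l obtain ys where ys: "\<alpha>' = Perm ys" by (cases \<alpha>') auto
    have le: "length xs = length ys" using l Perm ys by simp
    have x: "one_line xs" "one_line ys" using even_thread_one_line assms(2,3) unfolding Perm ys by blast+
    have m: "map (\<lambda>v. 1 + (length ys + 1 - v)) xs = map (\<lambda>v. 1 + (length ys + 1 - v)) ys"
      using assms(1) le unfolding frame_word_def Perm ys by simp
    have "inj_on (\<lambda>v. 1 + (length ys + 1 - v)) (set xs \<union> set ys)"
      using one_lineD(3)[OF x(1)] one_lineD(3)[OF x(2)] le by (intro inj_onI) fastforce
    from map_inj_on[OF m this] show ?thesis unfolding Perm ys by simp
  qed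
qed

lemma odd_compose_word: "odd_compose \<alpha> (Perm bs) = Perm (map (\<lambda>v. length bs + v) (frame_word \<alpha>) @ bs)"
  unfolding frame_word by simp

lemma odd_compose_hd: "\<exists>ws. odd_compose \<alpha> (Perm bs) = Perm ((length bs + 1) # ws)"
  unfolding odd_compose_word by (subst frame_word_Cons) simp

text \<open>
  The first entry of the sum is the minimum of the upper block, which reveals the length of \<open>\<beta>\<close>.
\<close>

lemma odd_compose_inject:
  assumes "odd_compose \<alpha> (Perm bs) = odd_compose \<alpha>' (Perm bs')" "even_thread \<alpha>" "even_thread \<alpha>'"
  shows "\<alpha> = \<alpha>' \<and> bs = bs'"
proof -
  have l: "length bs = length bs'"
    using odd_compose_hd[of \<alpha> bs] odd_compose_hd[of \<alpha>' bs'] assms(1) by (auto simp del: ominus.simps osum.simps)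
  then have "map (\<lambda>v. length bs' + v) (frame_word \<alpha>) = map (\<lambda>v. length bs' + v) (frame_word \<alpha>')" "bs = bs'"
    using assms(1) unfolding odd_compose_word by simp_all
  moreover have "inj (\<lambda>v. length bs' + v)" by simp
  ultimately show ?thesis using frame_word_inject[OF _ assms(2,3)] by (metis inj_map_eq_map)
qed

lemma even_compose_word:
  "even_compose (Perm bs) (Perm as) = Perm (map (\<lambda>v. length as + 1 + (length bs + 1 - v)) bs @ [length as + 1] @ as)"
  by (simp add: comp_def)

lemma even_compose_Anti: "even_compose (Perm bs) Anti = compl (Perm bs)"
  by simp

text \<open>
  Eligible connectors are read off from the complement, which is the direct sum \<open>\<beta> \<oplus> 1 \<oplus> c(\<alpha>)\<close>.
\<close>

lemma compl_even_compose:
  assumes "one_line bs" "one_line as"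
  shows "compl (even_compose (Perm bs) (Perm as)) =
    Perm (bs @ [length bs + 1] @ map (\<lambda>v. length bs + 1 + (length as + 1 - v)) as)"
proof -
  have "length bs + Suc (length as) + 1 - (length as + 1 + (length bs + 1 - v)) = v" if "v \<in> set bs" for v
    using one_lineD(3)[OF assms(1) that] by simp
  moreover have "length bs + Suc (length as) + 1 - v = length bs + 1 + (length as + 1 - v)" if "v \<in> set as" for v
    using one_lineD(3)[OF assms(2) that] by linarith
  ultimately show ?thesis unfolding even_compose_word by (simp add: map_idI)
qed

text \<open>
  The condition of an eligible connector for the complement as a list; in a permutation the first \<open>j\<close>
  entries then form a permutation of length \<open>j\<close> that ends with its maximum.
\<close>

definition eligible_position :: "nat list \<Rightarrow> nat \<Rightarrow> bool" where
  "eligible_position ys j \<longleftrightarrow> 1 \<le> j \<and> j \<le> length ys \<and> entry ys j = j \<and> (\<forall>i. 1 \<le> i \<and> i < j \<longrightarrow> entry ys i < j)"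

lemma eligible_connector_position:
  assumes "compl \<pi> = Perm ys"
  shows "eligible_connector \<pi> j \<longleftrightarrow> eligible_position ys j"
proof (cases \<pi>)
  case Anti
  then show ?thesis using assms by simp
next
  case (Perm xs)
  then have "length ys = length xs" using assms by auto
  then show ?thesis unfolding eligible_position_def Perm eligible_connector.simps
    using assms unfolding Perm by auto
qed

lemma eligible_position_connector:
  assumes "one_line bs"
  shows "eligible_position (bs @ [length bs + 1] @ ws) (length bs + 1)"
proof -
  have "entry (bs @ [length bs + 1] @ ws) i < length bs + 1" if "1 \<le> i" "i < length bs + 1" for i
  proof -
    have "i - 1 < length bs" using that by simp
    then have "bs ! (i-1) \<in> set bs" "entry (bs @ [length bs + 1] @ ws) i = bs ! (i-1)"
      unfolding entry_def by (simp_all add: nth_append)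
    then show ?thesis using one_lineD(3)[OF assms] by fastforce
  qed
  then show ?thesis unfolding eligible_position_def by (simp add: entry_def)
qed

lemma eligible_position_first: "eligible_position (1 # ws) 1"
  unfolding eligible_position_def by (simp add: entry_def)

text \<open>
  For an odd thread, not beginning with 1 means not being of the form \<open>1 \<oplus> c(\<alpha>) \<oplus> 1\<close>, because a
  nonempty lower block would raise the first entry.
\<close>

definition frameless :: "eperm \<Rightarrow> bool" where
  "frameless \<beta> \<longleftrightarrow> (\<forall>ws. \<beta> \<noteq> Perm (1 # ws))"

text \<open>
  A nonempty frameless odd thread is a skew sum with a nonempty lower block of some length \<open>k\<close>. A
  prefix of length \<open>j\<close> that carries the values up to \<open>j\<close> cannot end in the upper block,
  where all values exceed \<open>k\<close>, nor in the lower block, where its last entry would be smaller than its first.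
\<close>

lemma not_eligible_position_frameless:
  assumes "odd_thread (Perm bs)" "frameless (Perm bs)" "j \<le> length bs"
  shows "\<not> eligible_position (bs @ ws) j"
proof
  assume e: "eligible_position (bs @ ws) j"
  have ent: "entry (bs @ ws) i = bs ! (i-1)" if "1 \<le> i" "i \<le> j" for i
  proof -
    have "i - 1 < length bs" using that assms(3) by linarith
    then show ?thesis unfolding entry_def by (simp add: nth_append)
  qed
  have e: "1 \<le> j" "bs ! (j-1) = j" "\<And>i. 1 \<le> i \<Longrightarrow> i < j \<Longrightarrow> bs ! (i-1) < j"
    using e ent unfolding eligible_position_def by auto
  have "Perm bs \<noteq> Perm []" using e assms(3) by auto
  then obtain \<alpha> \<beta> where d: "odd_thread \<beta>" "Perm bs = odd_compose \<alpha> \<beta>"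
    using odd_thread_split[OF assms(1)] by metis
  obtain cs where cs: "\<beta> = Perm cs" "one_line cs" using odd_thread_one_line[OF d(1)] .
  define k where "k = length cs"
  have bs: "bs = map (\<lambda>v. k + v) (frame_word \<alpha>) @ cs" using d(2) unfolding cs odd_compose_word k_def by simp
  have h: "bs = (k + 1) # tl bs" unfolding bs by (subst (1 2) frame_word_Cons) simp
  then have k: "k \<noteq> 0" using assms(2) unfolding frameless_def by (metis add_0)
  have b0: "bs ! 0 = k + 1" by (subst h) simp
  have j: "k + 1 < j"
    using e(3)[of 1] e(2) b0 k e(1) by (cases "j = 1") auto
  have obs: "one_line bs" using odd_thread_one_line[OF assms(1)] by auto
  show False
  proof (cases "j \<le> length (frame_word \<alpha>)")
    case False
    have "bs ! (j-1) = cs ! (j - 1 - length (frame_word \<alpha>))"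
    proof -
      have "\<not> j - 1 < length (frame_word \<alpha>)" using False by linarith
      then show ?thesis unfolding bs by (simp add: nth_append)
    qed
    moreover have "j - 1 - length (frame_word \<alpha>) < length cs" using assms(3) False e(1) unfolding bs by simp
    then have "cs ! (j - 1 - length (frame_word \<alpha>)) \<le> k"
      using one_lineD(3)[OF cs(2)] nth_mem unfolding k_def by blast
    ultimately show False using e(2) j by simp
  next
    case True
    \<comment> \<open>Pigeonhole: \<open>j\<close> distinct entries cannot fit into the \<open>j - k\<close> values above \<open>k\<close> and up to \<open>j\<close>.\<close>
    have sub: "(\<lambda>i. bs ! i) ` {..<j} \<subseteq> {k+1..j}"
    proof
      fix y assume "y \<in> (\<lambda>i. bs ! i) ` {..<j}"
      then obtain i where i: "y = bs ! i" "i < j" by auto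
      have "y \<le> j"
      proof (cases "i = j - 1")
        case False
        then have "i + 1 < j" using i(2) by linarith
        then show ?thesis using e(3)[of "i+1"] i by simp
      qed (use i e in simp)
      moreover have "y = k + frame_word \<alpha> ! i" unfolding i(1) bs using i(2) True by (simp add: nth_append)
      moreover have "1 \<le> y - k"
      proof -
        have "set (frame_word \<alpha>) \<subseteq> {1..}" unfolding frame_word_def by (cases \<alpha>) auto
        moreover have "frame_word \<alpha> ! i \<in> set (frame_word \<alpha>)" using i(2) True by simp
        ultimately show ?thesis using \<open>y = k + frame_word \<alpha> ! i\<close> by auto
      qed
      ultimately show "y \<in> {k+1..j}" by simp
    qed
    have "inj_on (\<lambda>i. bs ! i) {..<j}"
      using one_lineD(1)[OF obs] assms(3) by (auto simp: inj_on_def nth_eq_iff_index_eq)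
    then have "j \<le> card {k+1..j}" using card_mono[OF _ sub] by (simp add: card_image)
    then show False using k j by simp
  qed
qed

text \<open>
  The connector of a decomposition is always eligible. If \<open>\<beta>\<close> begins with 1, then position 1 is
  eligible as well and lies further to the left; if \<open>\<beta>\<close> is frameless, no earlier position is eligible.
\<close>

lemma leftmost_decomp_iff:
  "leftmost_decomp \<pi> \<beta> \<alpha> \<longleftrightarrow> odd_thread \<beta> \<and> even_thread \<alpha> \<and> \<pi> = even_compose \<beta> \<alpha> \<and> frameless \<beta>"
proof (cases "odd_thread \<beta> \<and> even_thread \<alpha> \<and> \<pi> = even_compose \<beta> \<alpha>")
  case True
  then have t: "odd_thread \<beta>" "even_thread \<alpha>" "\<pi> = even_compose \<beta> \<alpha>" by blast+
  obtain bs where bs: "\<beta> = Perm bs" "one_line bs" using odd_thread_one_line[OF t(1)] .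
  have ld: "leftmost_decomp \<pi> \<beta> \<alpha> \<longleftrightarrow> (if \<exists>j. eligible_connector \<pi> j
     then \<alpha> \<noteq> Anti \<and> plen \<beta> + 1 = int (LEAST j. eligible_connector \<pi> j) else \<alpha> = Anti)"
    unfolding leftmost_decomp_def using True even_thread_build by blast
  show ?thesis
  proof (cases \<alpha>)
    case Anti
    have c: "compl \<pi> = Perm bs" unfolding t(3) bs(1) Anti even_compose_Anti by (rule compl_compl[OF bs(2)])
    have "(\<exists>j. eligible_connector \<pi> j) \<longleftrightarrow> \<not> frameless \<beta>"
    proof
      assume "\<exists>j. eligible_connector \<pi> j"
      then obtain j where "eligible_position bs j" using eligible_connector_position[OF c] by blast
      then show "\<not> frameless \<beta>"
        using not_eligible_position_frameless[of bs j "[]"] t(1) unfolding bs eligible_position_def by auto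
    next
      assume "\<not> frameless \<beta>"
      then show "\<exists>j. eligible_connector \<pi> j"
        using eligible_position_first eligible_connector_position[OF c] unfolding frameless_def bs by blast
    qed
    then show ?thesis unfolding ld using Anti t by auto
  next
    case (Perm as)
    have oa: "one_line as" using even_thread_one_line t(2) unfolding Perm by blast
    define ws where "ws = map (\<lambda>v. length bs + 1 + (length as + 1 - v)) as"
    have c: "compl \<pi> = Perm (bs @ [length bs + 1] @ ws)"
      unfolding t(3) bs(1) Perm ws_def by (rule compl_even_compose[OF bs(2) oa])
    have el: "eligible_connector \<pi> (length bs + 1)"
      unfolding eligible_connector_position[OF c] by (rule eligible_position_connector[OF bs(2)])
    have "length bs + 1 = (LEAST j. eligible_connector \<pi> j) \<longleftrightarrow> frameless \<beta>"
    proof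
      assume f: "frameless \<beta>"
      show "length bs + 1 = (LEAST j. eligible_connector \<pi> j)"
      proof (rule Least_equality[symmetric, where P = "eligible_connector \<pi>"])
        show "eligible_connector \<pi> (length bs + 1)" by (rule el)
        fix j assume "eligible_connector \<pi> j"
        then show "length bs + 1 \<le> j"
          using not_eligible_position_frameless[of bs j "[length bs + 1] @ ws"] f t(1)
          unfolding eligible_connector_position[OF c] bs by fastforce
      qed
    next
      assume l: "length bs + 1 = (LEAST j. eligible_connector \<pi> j)"
      show "frameless \<beta>"
      proof (rule ccontr)
        assume "\<not> frameless \<beta>"
        then obtain vs where vs: "bs = 1 # vs" unfolding frameless_def bs by blast
        have "eligible_connector \<pi> 1" unfolding eligible_connector_position[OF c] vs
          using eligible_position_first by simp
        then have "(LEAST j. eligible_connector \<pi> j) \<le> 1" by (rule Least_le)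
        then show False using l vs by simp
      qed
    qed
    moreover have "plen \<beta> + 1 = int (LEAST j. eligible_connector \<pi> j) \<longleftrightarrow> length bs + 1 = (LEAST j. eligible_connector \<pi> j)"
      unfolding bs by simp linarith
    ultimately show ?thesis unfolding ld using el Perm t by auto
  qed
next
  case False
  then show ?thesis unfolding leftmost_decomp_def by blast
qed

lemma leftmost_decomp_unique:
  assumes "leftmost_decomp \<pi> \<beta> \<alpha>" "leftmost_decomp \<pi> \<beta>' \<alpha>'"
  shows "\<beta> = \<beta>' \<and> \<alpha> = \<alpha>'"
proof -
  have 1: "odd_thread \<beta>" "even_thread \<alpha>" "\<pi> = even_compose \<beta> \<alpha>"
    and 2: "odd_thread \<beta>'" "even_thread \<alpha>'" "\<pi> = even_compose \<beta>' \<alpha>'"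
    using assms unfolding leftmost_decomp_iff by blast+
  obtain bs where bs: "\<beta> = Perm bs" "one_line bs" using odd_thread_one_line[OF 1(1)] .
  obtain bs' where bs': "\<beta>' = Perm bs'" "one_line bs'" using odd_thread_one_line[OF 2(1)] .
  have e: "if \<exists>j. eligible_connector \<pi> j then \<alpha> \<noteq> Anti \<and> plen \<beta> + 1 = int (LEAST j. eligible_connector \<pi> j) else \<alpha> = Anti"
    "if \<exists>j. eligible_connector \<pi> j then \<alpha>' \<noteq> Anti \<and> plen \<beta>' + 1 = int (LEAST j. eligible_connector \<pi> j) else \<alpha>' = Anti"
    using assms[unfolded leftmost_decomp_def, THEN conjunct2, THEN conjunct2, THEN conjunct2, THEN conjunct2]
    by blast+
  show ?thesis
  proof (cases "\<exists>j. eligible_connector \<pi> j")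
    case True
    have n: "\<alpha> \<noteq> Anti" "\<alpha>' \<noteq> Anti" and l: "plen \<beta> = plen \<beta>'"
      using e unfolding if_P[OF True] by simp_all
    obtain as where as: "\<alpha> = Perm as" using n by (cases \<alpha>) auto
    obtain as' where as': "\<alpha>' = Perm as'" using n by (cases \<alpha>') auto
    have lb: "length bs = length bs'" using l unfolding bs bs' by simp
    have o: "one_line as" "one_line as'" using even_thread_one_line 1(2) 2(2) unfolding as as' by blast+
    have "bs @ [length bs + 1] @ map (\<lambda>v. length bs + 1 + (length as + 1 - v)) as =
      bs' @ [length bs' + 1] @ map (\<lambda>v. length bs' + 1 + (length as' + 1 - v)) as'"
      using compl_even_compose[OF bs(2) o(1)] compl_even_compose[OF bs'(2) o(2)] 1(3) 2(3) unfolding bs bs' as as' by (metis eperm.inject)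
    then have "bs = bs'" using lb by simp
    moreover have "as = as'"
      using 1(3) 2(3) lb unfolding bs(1) bs'(1) as as' even_compose_word by simp
    ultimately show ?thesis unfolding bs bs' as as' by simp
  next
    case False
    have a: "\<alpha> = Anti" "\<alpha>' = Anti" using e unfolding if_not_P[OF False] by simp_all
    have "compl \<beta> = compl \<beta>'" using 1(3) 2(3) unfolding bs(1) bs'(1) a even_compose_Anti by metis
    then show ?thesis using compl_compl bs bs' a by metis
  qed
qed

text \<open>
  Associativity of \<open>\<ominus>\<close> allows to peel off the summands \<open>c(\<beta>) \<ominus> 1\<close> of the first thread one by one.
\<close>

lemma even_thread_join:
  assumes "even_thread (Perm as)" "even_thread \<alpha>"
  shows "even_thread (Perm as \<ominus>\<^sub>p (one_perm \<ominus>\<^sub>p \<alpha>))"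
  using assms(1)
proof (induction "length as" arbitrary: as rule: less_induct)
  case less
  obtain \<beta> \<alpha>1 where d: "odd_thread \<beta>" "even_thread \<alpha>1" "Perm as = even_compose \<beta> \<alpha>1"
    using even_thread_split[OF less.prems] by blast
  obtain bs where bs: "\<beta> = Perm bs" using odd_thread_one_line[OF d(1)] by metis
  obtain ds where ds: "one_perm \<ominus>\<^sub>p \<alpha> = Perm ds" by (cases \<alpha>) simp_all
  obtain cs where cs: "compl \<beta> = Perm cs" unfolding bs by simp
  show ?case
  proof (cases \<alpha>1)
    case Anti
    then have e: "Perm as = compl \<beta>" using d(3) unfolding bs by simp
    show ?thesis unfolding e by (rule even_thread_build[OF d(1) assms(2)])
  next
    case (Perm es)
    have "length es < length as" using d(3) unfolding bs Perm by simp
    then have "even_thread (Perm es \<ominus>\<^sub>p (one_perm \<ominus>\<^sub>p \<alpha>))"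
      using less.hyps d(2) unfolding Perm by blast
    from even_thread_build[OF d(1) this]
    have "even_thread (Perm cs \<ominus>\<^sub>p (one_perm \<ominus>\<^sub>p (Perm es \<ominus>\<^sub>p Perm ds)))" unfolding ds cs .
    also have "Perm cs \<ominus>\<^sub>p (one_perm \<ominus>\<^sub>p (Perm es \<ominus>\<^sub>p Perm ds)) = (Perm cs \<ominus>\<^sub>p (one_perm \<ominus>\<^sub>p Perm es)) \<ominus>\<^sub>p Perm ds"
      by (simp add: comp_def add_ac)
    finally show ?thesis unfolding d(3) ds Perm cs .
  qed
qed

text \<open>
  If \<open>\<beta> = 1 \<oplus> c(\<alpha>') \<oplus> 1\<close>, then \<open>c(\<beta>) \<ominus> 1 \<ominus> \<alpha> = 1 \<ominus> (\<alpha>' \<ominus> 1 \<ominus> (1 \<ominus> \<alpha>))\<close>, which is a decomposition with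
  the empty permutation in place of \<open>\<beta>\<close>.
\<close>

lemma leftmost_decomp_exists:
  assumes "even_thread \<pi>" "\<pi> \<noteq> Anti"
  obtains \<beta> \<alpha> where "leftmost_decomp \<pi> \<beta> \<alpha>"
proof -
  obtain \<beta> \<alpha> where d: "odd_thread \<beta>" "even_thread \<alpha>" "\<pi> = even_compose \<beta> \<alpha>"
    using even_thread_split[OF assms] .
  show thesis
  proof (cases "frameless \<beta>")
    case True
    then show thesis using that d unfolding leftmost_decomp_iff by blast
  next
    case False
    then obtain ws where ws: "\<beta> = Perm (1 # ws)" unfolding frameless_def by blast
    obtain \<alpha>' \<beta>' where d': "even_thread \<alpha>'" "odd_thread \<beta>'" "\<beta> = odd_compose \<alpha>' \<beta>'"
      using odd_thread_split[OF d(1)] ws by (metis eperm.inject list.discI)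
    obtain cs where cs: "\<beta>' = Perm cs" using odd_thread_one_line[OF d'(2)] by metis
    have "cs = []" using odd_compose_hd[of \<alpha>' cs] d'(3) unfolding cs ws by auto
    then have fr: "\<beta> = Perm (frame_word \<alpha>')" using d'(3) unfolding cs odd_compose_word by simp
    have one: "even_thread (one_perm \<ominus>\<^sub>p \<alpha>)"
    proof -
      have "even_thread (even_compose (Perm []) \<alpha>)" by (rule even_thread_build[OF odd_thread_empty d(2)])
      then show ?thesis by (cases \<alpha>) simp_all
    qed
    obtain ds where ds: "one_perm \<ominus>\<^sub>p \<alpha> = Perm ds" by (cases \<alpha>) simp_all
    have "\<exists>\<gamma>. even_thread \<gamma> \<and> \<pi> = even_compose (Perm []) \<gamma>"
    proof (cases \<alpha>')
      case Anti
      have "\<pi> = even_compose (Perm []) (Perm ds)" unfolding d(3) ds fr Anti frame_word_def by simp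
      then show ?thesis using one unfolding ds by blast
    next
      case (Perm as)
      have o: "one_line as" using even_thread_one_line d'(1) unfolding Perm by blast
      have "even_thread (Perm as \<ominus>\<^sub>p (one_perm \<ominus>\<^sub>p Perm ds))"
        using even_thread_join[of as "Perm ds"] d'(1) one unfolding Perm ds by blast
      moreover have "compl \<beta> = Perm ([length as + 2] @ map (\<lambda>v. 1 + v) as @ [1])"
      proof -
        have "Suc (Suc (length as)) + 1 - (1 + (length as + 1 - v)) = 1 + v" if "v \<in> set as" for v
          using one_lineD(3)[OF o that] by simp
        then show ?thesis unfolding fr frame_word_def Perm by simp
      qed
      then have "\<pi> = even_compose (Perm []) (Perm as \<ominus>\<^sub>p (one_perm \<ominus>\<^sub>p Perm ds))"
        unfolding d(3) ds by (simp add: comp_def)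
      ultimately show ?thesis by blast
    qed
    then obtain \<gamma> where "even_thread \<gamma>" "\<pi> = even_compose (Perm []) \<gamma>" by blast
    then show thesis using that[of "Perm []" \<gamma>] odd_thread_empty unfolding leftmost_decomp_iff frameless_def by simp
  qed
qed

section \<open>Catalan paths and their last return to the diagonal\<close>

lemma catalan_pathD:
  assumes "catalan_path n p"
  shows "count_list p North = n" "count_list p East = n"
    "\<And>q r. p = q @ r \<Longrightarrow> count_list q East \<le> count_list q North"
  using assms unfolding catalan_path_def prefix_def by auto

lemma catalan_path_Nil: "catalan_path n [] \<longleftrightarrow> n = 0"
  unfolding catalan_path_def by auto

lemma catalan_path_join:
  assumes a: "catalan_path k a" and b: "catalan_path l b"
  shows "catalan_path (k + l + 1) (a @ [North] @ b @ [East])"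
  unfolding catalan_path_def
proof (intro conjI allI impI)
  note A = catalan_pathD[OF a] and B = catalan_pathD[OF b]
  show "count_list (a @ [North] @ b @ [East]) North = k + l + 1" "count_list (a @ [North] @ b @ [East]) East = k + l + 1"
    using A B by simp_all
  fix q assume "prefix q (a @ [North] @ b @ [East])"
  then consider "prefix q a" | us where "q = a @ us" "prefix us (North # b @ [East])" by (auto simp: prefix_append)
  then show "count_list q East \<le> count_list q North"
  proof cases
    case 1
    then show ?thesis using A(3) by (auto simp: prefix_def)
  next
    case 2
    show ?thesis
    proof (cases us)
      case Nil
      then show ?thesis using 2 A by simp
    next
      case (Cons x vs)
      then have v: "x = North" "prefix vs (b @ [East])" using 2 by auto
      have "count_list vs East \<le> count_list vs North + 1"
      proof (cases "prefix vs b")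
        case True
        then show ?thesis using B(3) by (auto simp: prefix_def intro: le_SucI)
      next
        case False
        then have "vs = b @ [East]" using v(2) by (simp add: prefix_snoc)
        then show ?thesis using B by simp
      qed
      then show ?thesis using 2 A Cons v by simp
    qed
  qed
qed

lemma catalan_path_ends:
  assumes "catalan_path n p" "p \<noteq> []"
  shows "hd p = North" "last p = East"
proof -
  note C = catalan_pathD[OF assms(1)]
  obtain x q where p: "p = x # q" using assms(2) by (cases p) auto
  show "hd p = North" using C(3)[of "[x]" q] unfolding p by (cases x) auto
  obtain y r where p: "p = r @ [y]" using assms(2) by (cases p rule: rev_cases) auto
  show "last p = East" using C(1,2) C(3)[of r "[y]"] unfolding p by (cases y) auto
qed

text \<open>
  Take for \<open>a\<close> the longest proper prefix that returns to the diagonal; after it the path stays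
  strictly above the diagonal until its end.
\<close>

lemma catalan_path_decompose:
  assumes c: "catalan_path n p" and ne: "p \<noteq> []"
  obtains k l a b where "catalan_path k a" "catalan_path l b" "p = a @ [North] @ b @ [East]"
proof -
  note C = catalan_pathD[OF c]
  let ?bal = "\<lambda>q. count_list q East = count_list q North"
  let ?P = "\<lambda>q. strict_prefix q p \<and> ?bal q"
  have "?P []" using ne by (simp add: strict_prefix_def)
  moreover have "\<forall>q. ?P q \<longrightarrow> length q < Suc (length p)" by (auto dest: prefix_length_less)
  ultimately obtain a where a: "?P a" "\<And>q. ?P q \<Longrightarrow> length q \<le> length a"
    using ex_has_greatest_nat[of ?P "[]" length "Suc (length p)"] by blast
  obtain r where r: "p = a @ r" "r \<noteq> []" using a(1) by (auto simp: strict_prefix_def prefix_def)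
  obtain x s where x: "r = x # s" using r(2) by (cases r) auto
  have xN: "x = North" using C(3)[of "a @ [x]" s] a(1) unfolding r x by (cases x) auto
  have "s \<noteq> []"
  proof
    assume "s = []"
    then show False using C(1,2) a(1) unfolding r x xN by simp
  qed
  then obtain b y where y: "s = b @ [y]" by (cases s rule: rev_cases) auto
  have yE: "y = East" using catalan_path_ends(2)[OF c ne] unfolding r x y by simp
  have p: "p = a @ [North] @ b @ [East]" unfolding r x y xN yE by simp
  have "catalan_path (count_list a North) a"
    unfolding catalan_path_def using a(1) C(3) by (auto simp: p prefix_def)
  moreover have "catalan_path (count_list b North) b"
    unfolding catalan_path_def
  proof (intro conjI allI impI)
    show "count_list b East = count_list b North" using C(1,2) a(1) unfolding p by simp
    fix q assume "prefix q b"
    then obtain t where t: "b = q @ t" by (auto simp: prefix_def)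
    have "\<not> ?bal (a @ [North] @ q)"
    proof
      assume "?bal (a @ [North] @ q)"
      then have "?P (a @ [North] @ q)" unfolding p t by (simp add: strict_prefix_def)
      from a(2)[OF this] show False by simp
    qed
    moreover have "count_list (a @ [North] @ q) East \<le> count_list (a @ [North] @ q) North"
      using C(3)[of "a @ [North] @ q" "t @ [East]"] unfolding p t by simp
    ultimately show "count_list q East \<le> count_list q North" using a(1) by simp
  qed simp
  ultimately show thesis using that p by blast
qed

lemma catalan_path_decompose_prefix:
  assumes c: "catalan_path k a" "catalan_path l b" "catalan_path k' a'" "catalan_path l' b'"
    and e: "a @ [North] @ b @ [East] = a' @ [North] @ b' @ [East]" and us: "a' = a @ us"
  shows "us = []"
proof (rule ccontr)
  assume "us \<noteq> []"
  then obtain x vs where x: "us = x # vs" by (cases us) auto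
  have "North # b @ [East] = x # vs @ North # b' @ [East]" using e unfolding us x by simp
  then have "x = North" "b = vs @ (North # b')" by auto
  then show False
    using catalan_pathD(3)[OF c(2), of vs "North # b'"] catalan_pathD(1,2)[OF c(1)] catalan_pathD(1,2)[OF c(3)]
    unfolding us x by simp
qed

lemma catalan_path_decompose_unique:
  assumes c: "catalan_path k a" "catalan_path l b" "catalan_path k' a'" "catalan_path l' b'"
    and e: "a @ [North] @ b @ [East] = a' @ [North] @ b' @ [East]"
  shows "a = a' \<and> b = b'"
proof -
  obtain us where "a' = a @ us \<or> a = a' @ us" using e by (auto simp: append_eq_append_conv2)
  then have "a = a'"
  proof
    assume us: "a' = a @ us"
    show ?thesis using catalan_path_decompose_prefix[OF c e us] us by simp
  next
    assume us: "a = a' @ us"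
    show ?thesis using catalan_path_decompose_prefix[OF c(3,4,1,2) e[symmetric] us] us by simp
  qed
  then show ?thesis using e by simp
qed

lemma swap_step_swap_step [simp]: "swap_step (swap_step x) = x"
  by (cases x) simp_all

lemma rev_path_rev_path [simp]: "rev_path (rev_path p) = p"
  unfolding rev_path_def by (simp add: rev_map comp_def)

lemma rev_path_append: "rev_path (p @ q) = rev_path q @ rev_path p"
  unfolding rev_path_def by simp

lemma rev_path_simps [simp]: "rev_path [] = []" "rev_path [North] = [East]" "rev_path [East] = [North]"
  unfolding rev_path_def by simp_all

lemma length_rev_path [simp]: "length (rev_path p) = length p"
  unfolding rev_path_def by simp

lemma count_list_rev_path: "count_list (rev_path p) North = count_list p East" "count_list (rev_path p) East = count_list p North"
proof -
  have *: "count_list (rev_path p) North = count_list p East \<and> count_list (rev_path p) East = count_list p North"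
  proof (induction p)
    case (Cons x p)
    have "rev_path (x # p) = rev_path p @ rev_path [x]" using rev_path_append[of "[x]" p] by simp
    then show ?case using Cons by (cases x) simp_all
  qed simp
  then show "count_list (rev_path p) North = count_list p East" "count_list (rev_path p) East = count_list p North" by blast+
qed

lemma catalan_path_rev_path:
  assumes "catalan_path n p"
  shows "catalan_path n (rev_path p)"
  unfolding catalan_path_def
proof (intro conjI allI impI)
  note C = catalan_pathD[OF assms]
  show "count_list (rev_path p) North = n" "count_list (rev_path p) East = n" using C by (simp_all add: count_list_rev_path)
  fix q assume "prefix q (rev_path p)"
  then obtain r where "rev_path p = q @ r" by (auto simp: prefix_def)
  then have p: "p = rev_path r @ rev_path q" by (metis rev_path_append rev_path_rev_path)
  have "count_list (rev_path r) East \<le> count_list (rev_path r) North" by (rule C(3)[OF p])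
  moreover have "count_list (rev_path r) North + count_list (rev_path q) North = n"
    "count_list (rev_path r) East + count_list (rev_path q) East = n" using C(1,2) unfolding p by simp_all
  ultimately show "count_list q East \<le> count_list q North" by (simp add: count_list_rev_path)
qed

lemma sublist_rev_path: "sublist (rev_path p) (rev_path q) \<longleftrightarrow> sublist p q"
proof -
  have *: "sublist (rev_path p) (rev_path q)" if "sublist p q" for p q
    using that unfolding sublist_def by (metis append_assoc rev_path_append)
  show ?thesis using *[of p q] *[of "rev_path p" "rev_path q"] by auto
qed

lemma sublist_rev_pattern: "sublist [North, East, East, North] p \<longleftrightarrow> sublist [East, North, North, East] (rev_path p)"
proof -
  have "rev_path [North, East, East, North] = [East, North, North, East]" unfolding rev_path_def by simp
  then show ?thesis using sublist_rev_path[of "[North, East, East, North]" p] by simp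
qed

section \<open>Ascents of length two and the pattern NEEN\<close>

text \<open>
  An occurrence of a pattern of four steps in a concatenation lies in one part or is split in one of
  three ways.
\<close>

lemma sublist_pattern_append:
  "sublist [w, x, y, z] (p @ q) \<longleftrightarrow> sublist [w, x, y, z] p \<or> sublist [w, x, y, z] q \<or>
    suffix [w] p \<and> prefix [x, y, z] q \<or> suffix [w, x] p \<and> prefix [y, z] q \<or> suffix [w, x, y] p \<and> prefix [z] q"
proof -
  have "(\<exists>u v. [w, x, y, z] = u @ v \<and> suffix u p \<and> prefix v q) \<longleftrightarrow>
    prefix [w, x, y, z] q \<or> suffix [w] p \<and> prefix [x, y, z] q \<or> suffix [w, x] p \<and> prefix [y, z] q \<or>
    suffix [w, x, y] p \<and> prefix [z] q \<or> suffix [w, x, y, z] p" (is "?l \<longleftrightarrow> ?r")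
  proof
    assume ?l
    then show ?r by (auto simp: Cons_eq_append_conv)
  next
    assume ?r
    then show ?l
    proof (elim disjE conjE)
      assume "prefix [w, x, y, z] q"
      then show ?l by (intro exI[of _ "[]"] exI[of _ "[w, x, y, z]"]) simp
    next
      assume "suffix [w] p" "prefix [x, y, z] q"
      then show ?l by (intro exI[of _ "[w]"] exI[of _ "[x, y, z]"]) simp
    next
      assume "suffix [w, x] p" "prefix [y, z] q"
      then show ?l by (intro exI[of _ "[w, x]"] exI[of _ "[y, z]"]) simp
    next
      assume "suffix [w, x, y] p" "prefix [z] q"
      then show ?l by (intro exI[of _ "[w, x, y]"] exI[of _ "[z]"]) simp
    next
      assume "suffix [w, x, y, z] p"
      then show ?l by (intro exI[of _ "[w, x, y, z]"] exI[of _ "[]"]) simp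
    qed
  qed
  then show ?thesis unfolding sublist_append
    using prefix_imp_sublist suffix_imp_sublist by blast
qed

text \<open>
  The additional east steps serve as sentinels, which make ascents at either end of the path look
  like all others.
\<close>

lemma has_ascent_two_iff: "has_ascent_of_length 2 p \<longleftrightarrow> sublist [East, North, North, East] (East # p @ [East])"
proof
  assume "has_ascent_of_length 2 p"
  then obtain u v where p: "p = u @ [North, North] @ v" "u = [] \<or> last u = East" "v = [] \<or> hd v = East"
    unfolding has_ascent_of_length_def by (auto simp: numeral_2_eq_2)
  obtain u' where u': "East # u = u' @ [East]"
    using p(2) by (metis append_Nil append_butlast_last_id last_ConsR list.distinct(1))
  obtain v' where v': "v @ [East] = East # v'" using p(3) by (cases v) auto
  have "East # p @ [East] = u' @ [East, North, North, East] @ v'"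
    using u' v' unfolding p(1) by (metis append.assoc append_Cons append_Nil)
  then show "sublist [East, North, North, East] (East # p @ [East])" unfolding sublist_def by blast
next
  assume "sublist [East, North, North, East] (East # p @ [East])"
  then obtain x y where xy: "East # p @ [East] = x @ [East, North, North, East] @ y" unfolding sublist_def by blast
  obtain v where v: "East # y = v @ [East]" "v = [] \<or> hd v = East"
  proof (cases y rule: rev_cases)
    case Nil
    then show thesis using that[of "[]"] by simp
  next
    case (snoc y' z)
    then have "z = East" using xy by (metis append_Cons append_assoc last_snoc)
    then show thesis using that[of "East # y'"] snoc by simp
  qed
  have xy: "East # p @ [East] = x @ [East, North, North] @ v @ [East]" using xy v(1) by (metis append_Cons append_Nil)
  show "has_ascent_of_length 2 p"
  proof (cases x)
    case Nil
    then have "p = [] @ replicate 2 North @ v" using xy by (simp add: numeral_2_eq_2)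
    then show ?thesis unfolding has_ascent_of_length_def using v(2) by blast
  next
    case (Cons z x')
    then have "p = (x' @ [East]) @ replicate 2 North @ v" using xy by (simp add: numeral_2_eq_2)
    moreover have "last (x' @ [East]) = East" by simp
    ultimately show ?thesis unfolding has_ascent_of_length_def using v(2) by blast
  qed
qed

lemma catalan_path_not_suffix_North:
  assumes "catalan_path n p"
  shows "\<not> suffix (w @ [North]) p"
proof
  assume "suffix (w @ [North]) p"
  then have "p \<noteq> []" "last p = North" by (auto simp: suffix_def)
  then show False using catalan_path_ends(2)[OF assms] by simp
qed

lemma suffix_Cons_catalan:
  assumes "catalan_path n p"
  shows "\<not> suffix [x, y, North] (z # p)" "z = East \<Longrightarrow> \<not> suffix [x, North] (z # p)"
proof -
  have *: "\<not> suffix (w @ [North]) (z # p)" if "p \<noteq> [] \<or> z = East" for w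
  proof
    assume "suffix (w @ [North]) (z # p)"
    then obtain zs where "z # p = (zs @ w) @ [North]" by (auto simp: suffix_def)
    then have "last (z # p) = North" by (metis last_snoc)
    then show False using catalan_path_ends(2)[OF assms] that by (auto split: if_splits)
  qed
  show "\<not> suffix [x, y, North] (z # p)"
  proof (cases p)
    case Nil
    then show ?thesis by (auto dest: suffix_length_le)
  next
    case (Cons u v)
    then show ?thesis using *[of "[x, y]"] by simp
  qed
  show "z = East \<Longrightarrow> \<not> suffix [x, North] (z # p)" using *[of "[x]"] by simp
qed

text \<open>
  A Catalan path ends with an east step, so the sentinel in front suffices.
\<close>

lemma ENNE_iff: "p \<in> ENNE n \<longleftrightarrow> catalan_path n p \<and> \<not> sublist [East, North, North, East] (East # p)"
proof -
  have "sublist [East, North, North, East] ((East # p) @ [East]) \<longleftrightarrow> sublist [East, North, North, East] (East # p)" if "catalan_path n p"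
    unfolding sublist_pattern_append using suffix_Cons_catalan[OF that] by (auto dest: sublist_length_le)
  then show ?thesis unfolding ENNE_def has_ascent_two_iff by auto
qed

text \<open>
  Reversal turns \<open>NEEN\<close> into \<open>ENNE\<close>; compared with paths without ascents of length
  two, only the first ascent of the reversed path is exempt.
\<close>

lemma NEEN_iff: "p \<in> NEEN n \<longleftrightarrow> catalan_path n p \<and> \<not> sublist [East, North, North, East] (rev_path p)"
  unfolding NEEN_def sublist_rev_pattern by simp

text \<open>
  A pattern across the junction of \<open>a\<close> and \<open>Nb\<^sup>rE\<close> starts at the last step of \<open>a\<close> (or at the sentinel), so it
  means that \<open>b\<^sup>r\<close> begins with \<open>NE\<close>. Inside \<open>Nb\<^sup>rE\<close> the pattern can only occur within \<open>b\<^sup>r\<close>.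
\<close>

lemma ENNE_join_iff:
  assumes a: "catalan_path k a" and b: "catalan_path l b"
  shows "a @ [North] @ rev_path b @ [East] \<in> ENNE (k + l + 1) \<longleftrightarrow>
    a \<in> ENNE k \<and> b \<in> NEEN l \<and> \<not> suffix [North, East] b"
proof -
  let ?c = "rev_path b"
  have c: "catalan_path l ?c" by (rule catalan_path_rev_path[OF b])
  have last: "suffix [East] (East # a)"
    using catalan_path_ends(2)[OF a] by (cases a rule: rev_cases) (auto simp: suffix_def)
  have 1: "sublist [East, North, North, East] ((East # a) @ (North # ?c @ [East])) \<longleftrightarrow>
    sublist [East, North, North, East] (East # a) \<or> sublist [East, North, North, East] (North # ?c @ [East]) \<or>
    prefix [North, East] (?c @ [East])"
    unfolding sublist_pattern_append using suffix_Cons_catalan[OF a] last by auto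
  have 2: "sublist [East, North, North, East] (North # ?c @ [East]) \<longleftrightarrow> sublist [East, North, North, East] ?c"
    unfolding sublist_Cons_right sublist_pattern_append
    using catalan_path_not_suffix_North[OF c, of "[East, North]"] by (auto dest: sublist_length_le)
  have 3: "prefix [North, East] (?c @ [East]) \<longleftrightarrow> suffix [North, East] b"
  proof -
    have "?c \<noteq> [North]"
    proof
      assume "?c = [North]"
      then show False using catalan_pathD(1,2)[OF c] by simp
    qed
    then have "prefix [North, East] (?c @ [East]) \<longleftrightarrow> prefix [North, East] ?c"
      by (cases ?c; cases "tl ?c") auto
    also have "\<dots> \<longleftrightarrow> (\<exists>r. ?c = [North, East] @ r)" by (auto simp: prefix_def)
    also have "\<dots> \<longleftrightarrow> (\<exists>r. b = r @ [North, East])"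
    proof -
      have "rev_path [North, East] = [North, East]" unfolding rev_path_def by simp
      then show ?thesis by (metis rev_path_append rev_path_rev_path)
    qed
    finally show ?thesis by (simp add: suffix_def)
  qed
  have "catalan_path (k + l + 1) (a @ [North] @ ?c @ [East])" by (rule catalan_path_join[OF a c])
  then show ?thesis unfolding ENNE_iff NEEN_iff using a b 1 2 3 by simp
qed

text \<open>
  The reversed path is \<open>Nb\<^sup>rEa\<close>. No pattern crosses the junction before \<open>E\<close>, as \<open>Nb\<^sup>r\<close> never
  ends with \<open>ENN\<close>, and this \<open>E\<close> is the sentinel for \<open>a\<close>.
\<close>

lemma NEEN_join_iff:
  assumes a: "catalan_path k a" and b: "catalan_path l b"
  shows "rev_path a @ [North] @ b @ [East] \<in> NEEN (k + l + 1) \<longleftrightarrow> a \<in> ENNE k \<and> b \<in> NEEN l"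
proof -
  have r: "rev_path (rev_path a @ [North] @ b @ [East]) = (North # rev_path b) @ (East # a)"
    unfolding rev_path_append by simp
  have "sublist [East, North, North, East] ((North # rev_path b) @ (East # a)) \<longleftrightarrow>
    sublist [East, North, North, East] (rev_path b) \<or> sublist [East, North, North, East] (East # a)"
    unfolding sublist_pattern_append sublist_Cons_right
    using suffix_Cons_catalan(1)[OF catalan_path_rev_path[OF b]] by auto
  moreover have "catalan_path (k + l + 1) (rev_path a @ [North] @ b @ [East])"
    by (rule catalan_path_join[OF catalan_path_rev_path[OF a] b])
  ultimately show ?thesis unfolding ENNE_iff NEEN_iff r using a b by auto
qed

lemma suffix_NE_join:
  assumes "catalan_path l b"
  shows "suffix [North, East] (w @ [North] @ b @ [East]) \<longleftrightarrow> b = []"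
  using catalan_path_ends(2)[OF assms] by (cases b rule: rev_cases) (auto simp: suffix_def)

section \<open>The graphs of F and G are the converses of those of H and J\<close>

lemma plen_even_compose:
  assumes "odd_thread \<beta>"
  shows "plen (even_compose \<beta> \<alpha>) = plen \<beta> + plen \<alpha> + 1"
proof -
  obtain bs where "\<beta> = Perm bs" using odd_thread_one_line[OF assms] by metis
  then show ?thesis by (cases \<alpha>) simp_all
qed

lemma plen_odd_compose:
  assumes "odd_thread \<beta>"
  shows "plen (odd_compose \<alpha> \<beta>) = plen \<alpha> + 2 + plen \<beta>"
proof -
  obtain bs where "\<beta> = Perm bs" using odd_thread_one_line[OF assms] by metis
  then show ?thesis using length_frame_word[of \<alpha>] unfolding \<open>\<beta> = Perm bs\<close> odd_compose_word by simp
qed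

lemma frameless_odd_compose:
  assumes "odd_thread \<beta>"
  shows "frameless (odd_compose \<alpha> \<beta>) \<longleftrightarrow> plen \<beta> \<noteq> 0"
proof -
  obtain bs where bs: "\<beta> = Perm bs" using odd_thread_one_line[OF assms] by metis
  obtain ws where "odd_compose \<alpha> (Perm bs) = Perm ((length bs + 1) # ws)" using odd_compose_hd by blast
  then show ?thesis unfolding bs frameless_def by auto
qed

text \<open>
  Invariants of corresponding threads and paths. For odd threads the last conjunct links the side
  condition on leftmost decompositions with the one on paths without ascents of length two.
\<close>

definition even_match :: "eperm \<Rightarrow> path \<Rightarrow> bool" where
  "even_match \<alpha> p \<longleftrightarrow> even_thread \<alpha> \<and> (\<exists>k. p \<in> ENNE k \<and> int k = plen \<alpha> + 1)"

definition odd_match :: "eperm \<Rightarrow> path \<Rightarrow> bool" where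
  "odd_match \<beta> p \<longleftrightarrow> odd_thread \<beta> \<and> (\<exists>k. p \<in> NEEN k \<and> int k = plen \<beta>) \<and>
    (frameless \<beta> \<longleftrightarrow> \<not> suffix [North, East] p)"

lemma even_match_Anti: "even_match Anti []"
  unfolding even_match_def ENNE_iff using even_thread_Anti
  by (auto simp: catalan_path_Nil dest: sublist_length_le)

lemma odd_match_empty: "odd_match (Perm []) []"
  unfolding odd_match_def NEEN_iff frameless_def using odd_thread_empty
  by (auto simp: catalan_path_Nil dest: sublist_length_le)

lemma even_match_compose:
  assumes "even_match \<alpha> a" "odd_match \<beta> b" "frameless \<beta>"
  shows "even_match (even_compose \<beta> \<alpha>) (a @ [North] @ rev_path b @ [East])"
    "leftmost_decomp (even_compose \<beta> \<alpha>) \<beta> \<alpha>"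
proof -
  obtain k l where k: "even_thread \<alpha>" "a \<in> ENNE k" "int k = plen \<alpha> + 1"
    and l: "odd_thread \<beta>" "b \<in> NEEN l" "int l = plen \<beta>" and s: "\<not> suffix [North, East] b"
    using assms unfolding even_match_def odd_match_def by blast
  have c: "catalan_path k a" "catalan_path l b" using k l unfolding ENNE_iff NEEN_iff by blast+
  have "a @ [North] @ rev_path b @ [East] \<in> ENNE (k + l + 1)" using ENNE_join_iff[OF c] k l s by blast
  moreover have "int (k + l + 1) = plen (even_compose \<beta> \<alpha>) + 1" using plen_even_compose[OF l(1)] k l by simp
  ultimately show "even_match (even_compose \<beta> \<alpha>) (a @ [North] @ rev_path b @ [East])"
    unfolding even_match_def using even_thread_build[OF l(1) k(1)] by blast
  show "leftmost_decomp (even_compose \<beta> \<alpha>) \<beta> \<alpha>"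
    unfolding leftmost_decomp_iff using k l assms(3) by blast
qed

lemma odd_match_compose:
  assumes "even_match \<alpha> a" "odd_match \<beta> b"
  shows "odd_match (odd_compose \<alpha> \<beta>) (rev_path a @ [North] @ b @ [East])"
proof -
  obtain k l where k: "even_thread \<alpha>" "a \<in> ENNE k" "int k = plen \<alpha> + 1"
    and l: "odd_thread \<beta>" "b \<in> NEEN l" "int l = plen \<beta>"
    using assms unfolding even_match_def odd_match_def by blast
  have c: "catalan_path k a" "catalan_path l b" using k l unfolding ENNE_iff NEEN_iff by blast+
  have "rev_path a @ [North] @ b @ [East] \<in> NEEN (k + l + 1)" using NEEN_join_iff[OF c] k l by blast
  moreover have "int (k + l + 1) = plen (odd_compose \<alpha> \<beta>)" using plen_odd_compose[OF l(1)] k l by simp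
  moreover have "plen \<beta> \<noteq> 0 \<longleftrightarrow> b \<noteq> []" using l(3) catalan_pathD(1,2)[OF c(2)] c(2) catalan_path_ends(1)[OF c(2)]
    by (cases b) (auto simp: catalan_path_Nil)
  ultimately show ?thesis
    unfolding odd_match_def frameless_odd_compose[OF l(1)] suffix_NE_join[OF c(2)]
    using odd_thread_build[OF k(1) l(1)] by blast
qed

lemma even_match_catalan: "even_match \<alpha> p \<Longrightarrow> \<exists>k. catalan_path k p"
  unfolding even_match_def ENNE_iff by blast

lemma odd_match_catalan: "odd_match \<beta> p \<Longrightarrow> \<exists>k. catalan_path k p"
  unfolding odd_match_def NEEN_iff by blast

lemma catalan_path_same: "catalan_path k p \<Longrightarrow> catalan_path l p \<Longrightarrow> k = l"
  unfolding catalan_path_def by blast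

lemma ENNE_join:
  assumes "catalan_path k a" "catalan_path l b" "a @ [North] @ rev_path b @ [East] \<in> ENNE n"
  shows "a \<in> ENNE k" "b \<in> NEEN l" "\<not> suffix [North, East] b"
proof -
  have "n = k + l + 1"
    using catalan_path_same catalan_path_join[OF assms(1) catalan_path_rev_path[OF assms(2)]] assms(3) unfolding ENNE_iff by blast
  then show "a \<in> ENNE k" "b \<in> NEEN l" "\<not> suffix [North, East] b"
    using ENNE_join_iff[OF assms(1,2)] assms(3) by blast+
qed

lemma NEEN_join:
  assumes "catalan_path k a" "catalan_path l b" "rev_path a @ [North] @ b @ [East] \<in> NEEN n"
  shows "a \<in> ENNE k" "b \<in> NEEN l"
proof -
  have "n = k + l + 1"
    using catalan_path_same catalan_path_join[OF catalan_path_rev_path[OF assms(1)] assms(2)] assms(3) unfolding NEEN_iff by blast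
  then show "a \<in> ENNE k" "b \<in> NEEN l" using NEEN_join_iff[OF assms(1,2)] assms(3) by blast+
qed

text \<open>
  The premise of a step for \<open>H\<close> that the path has no ascent of length two supplies what is missing
  for a leftmost decomposition: \<open>b\<close> does not end in \<open>NE\<close>, so \<open>\<beta>\<close> is frameless.
\<close>

lemma H_graph_imp_F_graph:
  "H_graph p \<alpha> \<Longrightarrow> F_graph \<alpha> p \<and> even_match \<alpha> p"
  "J_graph q \<beta> \<Longrightarrow> G_graph \<beta> q \<and> odd_match \<beta> q"
proof (induction rule: H_graph_J_graph.inducts)
  case H_empty
  then show ?case using F_anti even_match_Anti by blast
next
  case (H_step k a l b \<beta> \<alpha>)
  then have m: "even_match \<alpha> a" "odd_match \<beta> b" by blast+
  have "\<not> suffix [North, East] b" using ENNE_join(3)[OF H_step(1,2)] H_step(3) by blast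
  then have "frameless \<beta>" using m(2) unfolding odd_match_def by blast
  from even_match_compose[OF m this] show ?case using F_step H_step by blast
next
  case J_empty
  then show ?case using G_empty odd_match_empty by blast
next
  case (J_step k a l b \<alpha> \<beta>)
  then have m: "even_match \<alpha> a" "odd_match \<beta> b" by blast+
  note o = odd_match_compose[OF m]
  have t: "odd_thread (odd_compose \<alpha> \<beta>)" "even_thread \<alpha>" "odd_thread \<beta>"
    using o m unfolding odd_match_def even_match_def by blast+
  have "G_graph (odd_compose \<alpha> \<beta>) (rev_path a @ [North] @ b @ [East])"
    by (rule G_step[OF t refl]) (use J_step in blast)+
  then show ?case using o by blast
qed

text \<open>
  Conversely, \<open>\<beta>\<close> is frameless in a leftmost decomposition, so that its path does not end in \<open>NE\<close>
  and the combined path has no ascent of length two.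
\<close>

lemma F_graph_imp_H_graph:
  "F_graph \<alpha> p \<Longrightarrow> H_graph p \<alpha> \<and> even_match \<alpha> p"
  "G_graph \<beta> q \<Longrightarrow> J_graph q \<beta> \<and> odd_match \<beta> q"
proof (induction rule: F_graph_G_graph.inducts)
  case F_anti
  then show ?case using H_empty even_match_Anti by blast
next
  case (F_step \<pi> \<beta> \<alpha> p q)
  then have m: "even_match \<alpha> p" "odd_match \<beta> q" and d: "\<pi> = even_compose \<beta> \<alpha>" "frameless \<beta>"
    unfolding leftmost_decomp_iff by blast+
  note e = even_match_compose(1)[OF m d(2)]
  obtain k l where c: "catalan_path k p" "catalan_path l q" using even_match_catalan[OF m(1)] odd_match_catalan[OF m(2)] by blast
  have "H_graph (p @ [North] @ rev_path q @ [East]) (even_compose \<beta> \<alpha>)"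
    by (rule H_step[OF c]) (use e F_step in \<open>unfold even_match_def, blast+\<close>)
  then show ?case using e d by blast
next
  case G_empty
  then show ?case using J_empty odd_match_empty by blast
next
  case (G_step \<pi> \<alpha> \<beta> p q)
  then have m: "even_match \<alpha> p" "odd_match \<beta> q" by blast+
  note o = odd_match_compose[OF m]
  obtain k l where c: "catalan_path k p" "catalan_path l q" using even_match_catalan[OF m(1)] odd_match_catalan[OF m(2)] by blast
  have "J_graph (rev_path p @ [North] @ q @ [East]) (odd_compose \<alpha> \<beta>)"
    by (rule J_step[OF c]) (use o G_step in \<open>unfold odd_match_def, blast+\<close>)
  then show ?case using o G_step by blast
qed

lemma F_graph_iff_H_graph: "F_graph \<alpha> p \<longleftrightarrow> H_graph p \<alpha>"
  using H_graph_imp_F_graph(1) F_graph_imp_H_graph(1) by blast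

lemma G_graph_iff_J_graph: "G_graph \<beta> q \<longleftrightarrow> J_graph q \<beta>"
  using H_graph_imp_F_graph(2) F_graph_imp_H_graph(2) by blast

lemma even_compose_not_Anti:
  assumes "odd_thread \<beta>"
  shows "even_compose \<beta> \<alpha> \<noteq> Anti"
proof -
  obtain bs where "\<beta> = Perm bs" using odd_thread_one_line[OF assms] by metis
  then show ?thesis by (cases \<alpha>) simp_all
qed

section \<open>The graphs are total functional relations\<close>

lemma F_graph_Anti: "F_graph Anti p \<Longrightarrow> p = []"
proof (erule F_graph.cases)
  fix \<pi> \<beta> \<alpha> p' q assume "Anti = \<pi>" "leftmost_decomp \<pi> \<beta> \<alpha>"
  then show "p = []" using even_compose_not_Anti unfolding leftmost_decomp_iff by metis
qed simp

lemma F_graph_stepE: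
  assumes "F_graph \<pi> r" "leftmost_decomp \<pi> \<beta> \<alpha>"
  obtains p q where "r = p @ [North] @ rev_path q @ [East]" "F_graph \<alpha> p" "G_graph \<beta> q"
  using assms(1)
proof (rule F_graph.cases)
  assume "\<pi> = Anti"
  then show thesis using assms(2) even_compose_not_Anti unfolding leftmost_decomp_iff by metis
next
  fix \<pi>' \<beta>' \<alpha>' p q
  assume h: "\<pi> = \<pi>'" "r = p @ [North] @ rev_path q @ [East]" "leftmost_decomp \<pi>' \<beta>' \<alpha>'" "F_graph \<alpha>' p" "G_graph \<beta>' q"
  then have "\<beta> = \<beta>'" "\<alpha> = \<alpha>'" using leftmost_decomp_unique[OF assms(2)] by blast+
  then show thesis using that h by blast
qed

lemma odd_compose_not_empty:
  assumes "odd_thread \<beta>"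
  shows "odd_compose \<alpha> \<beta> \<noteq> Perm []"
proof -
  obtain bs where bs: "\<beta> = Perm bs" using odd_thread_one_line[OF assms] by metis
  obtain ws where "odd_compose \<alpha> (Perm bs) = Perm ((length bs + 1) # ws)" using odd_compose_hd by blast
  then show ?thesis unfolding bs by simp
qed

lemma G_graph_empty: "G_graph (Perm []) q \<Longrightarrow> q = []"
proof (erule G_graph.cases)
  fix \<pi> \<alpha> \<beta> p q' assume "Perm [] = \<pi>" "odd_thread \<beta>" "\<pi> = odd_compose \<alpha> \<beta>"
  then show "q = []" using odd_compose_not_empty by metis
qed simp

lemma G_graph_stepE:
  assumes "G_graph (odd_compose \<alpha> \<beta>) r" "even_thread \<alpha>" "odd_thread \<beta>"
  obtains p q where "r = rev_path p @ [North] @ q @ [East]" "F_graph \<alpha> p" "G_graph \<beta> q"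
  using assms(1)
proof (rule G_graph.cases)
  assume "odd_compose \<alpha> \<beta> = Perm []"
  then show thesis using odd_compose_not_empty[OF assms(3)] by blast
next
  fix \<pi>' \<alpha>' \<beta>' p q
  assume h: "odd_compose \<alpha> \<beta> = \<pi>'" "r = rev_path p @ [North] @ q @ [East]" "even_thread \<alpha>'" "odd_thread \<beta>'"
    "\<pi>' = odd_compose \<alpha>' \<beta>'" "F_graph \<alpha>' p" "G_graph \<beta>' q"
  obtain bs bs' where b: "\<beta> = Perm bs" "\<beta>' = Perm bs'" using odd_thread_one_line assms(3) h(4) by metis
  have "odd_compose \<alpha> (Perm bs) = odd_compose \<alpha>' (Perm bs')" using h(1,5) unfolding b by (rule trans)
  then have "\<alpha> = \<alpha>'" "\<beta> = \<beta>'" using odd_compose_inject assms(2) h(3) unfolding b by blast+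
  then show thesis using that h by blast
qed

lemma F_graph_functional:
  "F_graph \<alpha> p \<Longrightarrow> (\<forall>p'. F_graph \<alpha> p' \<longrightarrow> p = p')"
  "G_graph \<beta> q \<Longrightarrow> (\<forall>q'. G_graph \<beta> q' \<longrightarrow> q = q')"
proof (induction rule: F_graph_G_graph.inducts)
  case F_anti
  then show ?case using F_graph_Anti by blast
next
  case (F_step \<pi> \<beta> \<alpha> p q)
  then show ?case using F_graph_stepE by metis
next
  case G_empty
  then show ?case using G_graph_empty by blast
next
  case (G_step \<pi> \<alpha> \<beta> p q)
  then show ?case using G_graph_stepE by metis
qed

lemma H_graph_Nil: "H_graph [] \<alpha> \<Longrightarrow> \<alpha> = Anti"
  by (erule H_graph.cases) simp_all

lemma J_graph_Nil: "J_graph [] \<beta> \<Longrightarrow> \<beta> = Perm []"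
  by (erule J_graph.cases) simp_all

lemma H_graph_stepE:
  assumes "H_graph (a @ [North] @ rev_path b @ [East]) \<gamma>" "catalan_path k a" "catalan_path l b"
  obtains \<alpha> \<beta> where "\<gamma> = even_compose \<beta> \<alpha>" "J_graph b \<beta>" "H_graph a \<alpha>"
  using assms(1)
proof (rule H_graph.cases)
  fix k' a' l' b' \<beta> \<alpha>
  assume h: "a @ [North] @ rev_path b @ [East] = a' @ [North] @ rev_path b' @ [East]" "\<gamma> = even_compose \<beta> \<alpha>"
    "catalan_path k' a'" "catalan_path l' b'" "J_graph b' \<beta>" "H_graph a' \<alpha>"
  have "a = a'" "rev_path b = rev_path b'"
    using catalan_path_decompose_unique[OF assms(2) catalan_path_rev_path[OF assms(3)] h(3) catalan_path_rev_path[OF h(4)] h(1)] by blast+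
  then have "a = a'" "b = b'" by (metis rev_path_rev_path)+
  then show thesis using that h by blast
qed simp

lemma J_graph_stepE:
  assumes "J_graph (rev_path a @ [North] @ b @ [East]) \<gamma>" "catalan_path k a" "catalan_path l b"
  obtains \<alpha> \<beta> where "\<gamma> = odd_compose \<alpha> \<beta>" "H_graph a \<alpha>" "J_graph b \<beta>"
  using assms(1)
proof (rule J_graph.cases)
  fix k' a' l' b' \<alpha> \<beta>
  assume h: "rev_path a @ [North] @ b @ [East] = rev_path a' @ [North] @ b' @ [East]" "\<gamma> = odd_compose \<alpha> \<beta>"
    "catalan_path k' a'" "catalan_path l' b'" "H_graph a' \<alpha>" "J_graph b' \<beta>"
  have "rev_path a = rev_path a'" "b = b'"
    using catalan_path_decompose_unique[OF catalan_path_rev_path[OF assms(2)] assms(3) catalan_path_rev_path[OF h(3)] h(4) h(1)] by blast+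
  then have "a = a'" "b = b'" by (metis rev_path_rev_path)+
  then show thesis using that h by blast
qed simp

lemma H_graph_functional:
  "H_graph p \<alpha> \<Longrightarrow> (\<forall>\<alpha>'. H_graph p \<alpha>' \<longrightarrow> \<alpha> = \<alpha>')"
  "J_graph q \<beta> \<Longrightarrow> (\<forall>\<beta>'. J_graph q \<beta>' \<longrightarrow> \<beta> = \<beta>')"
proof (induction rule: H_graph_J_graph.inducts)
  case H_empty
  then show ?case using H_graph_Nil by blast
next
  case (H_step k a l b \<beta> \<alpha>)
  then show ?case using H_graph_stepE by metis
next
  case J_empty
  then show ?case using J_graph_Nil by blast
next
  case (J_step k a l b \<alpha> \<beta>)
  then show ?case using J_graph_stepE by metis
qed

lemma plen_even_thread: "even_thread \<alpha> \<Longrightarrow> - 1 \<le> plen \<alpha>"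
  by (cases \<alpha>) simp_all

lemma plen_odd_thread: "odd_thread \<beta> \<Longrightarrow> 0 \<le> plen \<beta>"
  by (metis odd_thread_one_line plen.simps(2) of_nat_0_le_iff)

text \<open>
  In \<open>\<pi> = c(\<beta>) \<ominus> 1 \<ominus> \<alpha>\<close> with \<open>\<alpha> = @\<close> the odd thread \<open>\<beta>\<close> is as long as \<open>\<pi>\<close>; the
  measures \<open>2|\<pi>| + 3\<close> for even and \<open>2|\<pi>|\<close> for odd threads decrease nevertheless.
\<close>

lemma F_graph_total:
  "(\<forall>\<pi>. even_thread \<pi> \<and> 2 * plen \<pi> + 3 \<le> int n \<longrightarrow> (\<exists>p. F_graph \<pi> p)) \<and>
   (\<forall>\<pi>. odd_thread \<pi> \<and> 2 * plen \<pi> \<le> int n \<longrightarrow> (\<exists>q. G_graph \<pi> q))"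
proof (induction n rule: less_induct)
  case (less n)
  have IH: "\<exists>p. F_graph \<alpha> p" if "even_thread \<alpha>" "2 * plen \<alpha> + 3 < int n" for \<alpha>
  proof -
    have "nat (2 * plen \<alpha> + 3) < n" using that plen_even_thread[OF that(1)] by linarith
    from less.IH[OF this] show ?thesis using that(1) by auto
  qed
  have IH': "\<exists>q. G_graph \<beta> q" if "odd_thread \<beta>" "2 * plen \<beta> < int n" for \<beta>
  proof -
    have "nat (2 * plen \<beta>) < n" using that plen_odd_thread[OF that(1)] by linarith
    from less.IH[OF this] show ?thesis using that(1) by auto
  qed
  show ?case
  proof (intro conjI allI impI; elim conjE)
    fix \<pi> assume e: "even_thread \<pi>" and n: "2 * plen \<pi> + 3 \<le> int n"
    show "\<exists>p. F_graph \<pi> p"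
    proof (cases "\<pi> = Anti")
      case True
      then show ?thesis using F_anti by blast
    next
      case False
      obtain \<beta> \<alpha> where d: "leftmost_decomp \<pi> \<beta> \<alpha>" using leftmost_decomp_exists[OF e False] .
      then have t: "odd_thread \<beta>" "even_thread \<alpha>" "\<pi> = even_compose \<beta> \<alpha>" unfolding leftmost_decomp_iff by blast+
      have "plen \<pi> = plen \<beta> + plen \<alpha> + 1" unfolding t(3) by (rule plen_even_compose[OF t(1)])
      then have "2 * plen \<alpha> + 3 < int n" "2 * plen \<beta> < int n"
        using n plen_even_thread[OF t(2)] plen_odd_thread[OF t(1)] by linarith+
      then obtain p q where "F_graph \<alpha> p" "G_graph \<beta> q" using IH[OF t(2)] IH'[OF t(1)] by blast
      then show ?thesis using F_step[OF d] by blast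
    qed
  next
    fix \<pi> assume o: "odd_thread \<pi>" and n: "2 * plen \<pi> \<le> int n"
    show "\<exists>q. G_graph \<pi> q"
    proof (cases "\<pi> = Perm []")
      case True
      then show ?thesis using G_empty by blast
    next
      case False
      obtain \<alpha> \<beta> where t: "even_thread \<alpha>" "odd_thread \<beta>" "\<pi> = odd_compose \<alpha> \<beta>" using odd_thread_split[OF o False] .
      have "plen \<pi> = plen \<alpha> + 2 + plen \<beta>" unfolding t(3) by (rule plen_odd_compose[OF t(2)])
      then have "2 * plen \<alpha> + 3 < int n" "2 * plen \<beta> < int n"
        using n plen_even_thread[OF t(1)] plen_odd_thread[OF t(2)] by linarith+
      then obtain p q where "F_graph \<alpha> p" "G_graph \<beta> q" using IH[OF t(1)] IH'[OF t(2)] by blast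
      then show ?thesis using G_step[OF o t] by blast
    qed
  qed
qed

lemma H_graph_total:
  "(p \<in> ENNE k \<longrightarrow> (\<exists>\<alpha>. H_graph p \<alpha>)) \<and> (p \<in> NEEN k \<longrightarrow> (\<exists>\<beta>. J_graph p \<beta>))"
proof (induction "length p" arbitrary: p k rule: less_induct)
  case less
  show ?case
  proof (cases "p = []")
    case True
    then show ?thesis using H_empty J_empty by blast
  next
    case False
    show ?thesis
    proof (intro conjI impI)
      assume p: "p \<in> ENNE k"
      then have "catalan_path k p" unfolding ENNE_iff by blast
      then obtain m l a c where c: "catalan_path m a" "catalan_path l c" "p = a @ [North] @ c @ [East]"
        using catalan_path_decompose[OF _ False] by metis
      define b where "b = rev_path c"
      have b: "catalan_path l b" "p = a @ [North] @ rev_path b @ [East]"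
        unfolding b_def using c catalan_path_rev_path by simp_all
      have "a \<in> ENNE m" "b \<in> NEEN l" using ENNE_join[OF c(1) b(1)] p unfolding b(2) by blast+
      moreover have "length a < length p" "length b < length p" unfolding b(2) by simp_all
      ultimately obtain \<alpha> \<beta> where "H_graph a \<alpha>" "J_graph b \<beta>" using less by blast
      then show "\<exists>\<alpha>. H_graph p \<alpha>" using H_step[OF c(1) b(1)] p unfolding b(2) by blast
    next
      assume p: "p \<in> NEEN k"
      then have "catalan_path k p" unfolding NEEN_iff by blast
      then obtain m l c b where c: "catalan_path m c" "catalan_path l b" "p = c @ [North] @ b @ [East]"
        using catalan_path_decompose[OF _ False] by metis
      define a where "a = rev_path c"
      have a: "catalan_path m a" "p = rev_path a @ [North] @ b @ [East]"
        unfolding a_def using c catalan_path_rev_path by simp_all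
      have "a \<in> ENNE m" "b \<in> NEEN l" using NEEN_join[OF a(1) c(2)] p unfolding a(2) by blast+
      moreover have "length a < length p" "length b < length p" unfolding a(2) by simp_all
      ultimately obtain \<alpha> \<beta> where "H_graph a \<alpha>" "J_graph b \<beta>" using less by blast
      then show "\<exists>\<beta>. J_graph p \<beta>" using J_step[OF a(1) c(2)] p unfolding a(2) by blast
    qed
  qed
qed

lemma the_graph:
  "F_graph \<alpha> p \<Longrightarrow> F_map \<alpha> = p" "G_graph \<beta> q \<Longrightarrow> G_map \<beta> = q"
  "H_graph p \<alpha> \<Longrightarrow> H_map p = \<alpha>" "J_graph q \<beta> \<Longrightarrow> J_map q = \<beta>"
  unfolding F_map_def G_map_def H_map_def J_map_def
  using F_graph_functional H_graph_functional by (blast intro: the_equality)+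

theorem theorem4p6:
  shows "(\<forall>n::int. n \<ge> -1 \<longrightarrow> mutually_inverse_on (ET n) (ENNE (nat (n + 1))) F_map H_map) \<and>
         (\<forall>n::int. n \<ge> 0 \<longrightarrow> mutually_inverse_on (OT n) (NEEN (nat n)) G_map J_map)"
proof (intro conjI allI impI)
  fix n :: int assume n: "-1 \<le> n"
  have 1: "H_graph (F_map \<alpha>) \<alpha> \<and> F_map \<alpha> \<in> ENNE (nat (n + 1)) \<and> H_map (F_map \<alpha>) = \<alpha>" if "\<alpha> \<in> ET n" for \<alpha>
  proof -
    have a: "even_thread \<alpha>" "plen \<alpha> = n" using that unfolding ET_def by blast+
    obtain p where p: "F_graph \<alpha> p"
      using F_graph_total[of "nat (2 * plen \<alpha> + 3)"] a(1) plen_even_thread[OF a(1)] by auto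
    have "p \<in> ENNE (nat (n + 1))" using F_graph_imp_H_graph(1)[OF p] a(2) unfolding even_match_def by (metis nat_int)
    then show ?thesis using p the_graph F_graph_iff_H_graph by metis
  qed
  have 2: "H_map p \<in> ET n \<and> F_map (H_map p) = p" if p: "p \<in> ENNE (nat (n + 1))" for p
  proof -
    obtain \<alpha> where h: "H_graph p \<alpha>" using H_graph_total p by blast
    obtain k where k: "even_thread \<alpha>" "p \<in> ENNE k" "int k = plen \<alpha> + 1"
      using H_graph_imp_F_graph(1)[OF h] unfolding even_match_def by blast
    have "k = nat (n + 1)" using catalan_path_same p k(2) unfolding ENNE_iff by blast
    then have "\<alpha> \<in> ET n" using k n unfolding ET_def by simp
    then show ?thesis using h the_graph F_graph_iff_H_graph by metis
  qed
  show "mutually_inverse_on (ET n) (ENNE (nat (n + 1))) F_map H_map"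
    unfolding mutually_inverse_on_def using 1 2 by blast
next
  fix n :: int assume n: "0 \<le> n"
  have 1: "J_graph (G_map \<beta>) \<beta> \<and> G_map \<beta> \<in> NEEN (nat n) \<and> J_map (G_map \<beta>) = \<beta>" if "\<beta> \<in> OT n" for \<beta>
  proof -
    have a: "odd_thread \<beta>" "plen \<beta> = n" using that unfolding OT_def by blast+
    obtain q where q: "G_graph \<beta> q"
      using F_graph_total[of "nat (2 * plen \<beta>)"] a(1) plen_odd_thread[OF a(1)] by auto
    have "q \<in> NEEN (nat n)" using F_graph_imp_H_graph(2)[OF q] a(2) unfolding odd_match_def by (metis nat_int)
    then show ?thesis using q the_graph G_graph_iff_J_graph by metis
  qed
  have 2: "J_map q \<in> OT n \<and> G_map (J_map q) = q" if q: "q \<in> NEEN (nat n)" for q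
  proof -
    obtain \<beta> where h: "J_graph q \<beta>" using H_graph_total q by blast
    obtain k where k: "odd_thread \<beta>" "q \<in> NEEN k" "int k = plen \<beta>"
      using H_graph_imp_F_graph(2)[OF h] unfolding odd_match_def by blast
    have "k = nat n" using catalan_path_same q k(2) unfolding NEEN_iff by blast
    then have "\<beta> \<in> OT n" using k n unfolding OT_def by simp
    then show ?thesis using h the_graph G_graph_iff_J_graph by metis
  qed
  show "mutually_inverse_on (OT n) (NEEN (nat n)) G_map J_map"
    unfolding mutually_inverse_on_def using 1 2 by blast
qed

end
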